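(* Let $1\le q<\infty$, let $q'$ be the Hölder conjugate of $q$, and let $K$ be a kernel on $\mathbb{R}^n\setminus\{0\}$ such that $K\in H_{q'}$ and, for some constant $A$, $|K(x)|\le \frac{A}{|x|^n}$ for all $x\ne 0$. Let $T$ be a singular integral operator associated with $K$. If $T$ is bounded on $L^s(\mathbb{R}^n)$ for some $s\in(q,\infty]$ with bound $B$ (that is, $\|Tf\|_{L^s(\mathbb{R}^n)}\le B\|f\|_{L^s(\mathbb{R}^n)}$ for all $f\in L^s(\mathbb{R}^n)$), then $T$ maps $L^q(\mathbb{R}^n)$ to $L^{q,\infty}(\mathbb{R}^n)$ with bound at most a constant multiple of $B+[K]_{H_{q'}}$. That is, there is a constant $C_{n,s,q}$ depending only on $n,s,q$ such that $$\|Tf\|_{L^{q,\infty}(\mathbb{R}^n)}:=\sup_{\alpha>0}\alpha\,|\{x\in\mathbb{R}^n: |Tf(x)|>\alpha\}|^{\frac1q}\le C_{n,s,q}\,(B+[K]_{H_{q'}})\,\|f\|_{L^q(\mathbb{R}^n)}$$ for all $f\in L^q(\mathbb{R}^n)$.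
   Context: For $1\le r\le\infty$, a (measurable) kernel $K$ defined on $\mathbb{R}^n\setminus\{0\}$ is in the class $H_r$ if $$[K]_{H_r}:=\sup_{R>0}\bigg[\frac{1}{v_nR^n}\int_{|y|\le R}\bigg(\int_{|x|\ge 2R}|K(x-y)-K(x)|\,dx\bigg)^r dy\bigg]^{\frac1r}<\infty,$$ where $v_n$ is the volume of the unit ball $B(0,1)$ in $\mathbb{R}^n$; for $r=\infty$ the $L^r$ average over $|y|\le R$ is replaced by the essential supremum over $|y|\le R$. A singular integral operator associated with $K$ is a linear operator $T$ satisfying $Tf(x)=\int_{\mathbb{R}^n}K(x-y)f(y)\,dy$ for smooth compactly supported functions $f$, and more generally for integrable compactly supported $f$ on which $T$ is defined, and (almost every) $x\notin\operatorname{supp} f$. ($T$ is not uniquely determined by $K$.) For general $f\in L^q(\mathbb{R}^n)$, $Tf$ is understood via the extension of $T$ by density from the smooth compactly supported functions. $|E|$ denotes Lebesgue measure of $E$. *)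

theory Defs
  imports "HOL-Analysis.Analysis" "HOL-Probability.Essential_Supremum"
begin

(* Meant for exponents p > 0, where 0 and \<infinity> are mapped to themselves. *)
definition ennreal_powr :: "ennreal \<Rightarrow> real \<Rightarrow> ennreal" where
  "ennreal_powr x p = (if x = \<infinity> then \<infinity> else ennreal (enn2real x powr p))"

definition Lp_norm :: "ennreal \<Rightarrow> (real ^ 'n \<Rightarrow> complex) \<Rightarrow> ennreal" where
  "Lp_norm p f =
    (if p = \<infinity> then esssup lebesgue (\<lambda>x. ennreal (norm (f x)))
     else ennreal_powr (\<integral>\<^sup>+ x. ennreal (norm (f x) powr enn2real p) \<partial>lebesgue) (1 / enn2real p))"

(* L^p is represented by its functions, not by classes modulo null sets. *)
definition Lp :: "ennreal \<Rightarrow> (real ^ 'n \<Rightarrow> complex) set" where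
  "Lp p = {f. f \<in> borel_measurable lebesgue \<and> Lp_norm p f < \<infinity>}"

definition weak_Lp_norm :: "real \<Rightarrow> (real ^ 'n \<Rightarrow> complex) \<Rightarrow> ennreal" where
  "weak_Lp_norm q f =
    (SUP \<alpha>\<in>{0<..}. ennreal \<alpha> * ennreal_powr (emeasure lebesgue {x. \<alpha> < norm (f x)}) (1 / q))"

primrec C_k :: "nat \<Rightarrow> (real ^ 'n \<Rightarrow> complex) \<Rightarrow> bool" where
  "C_k 0 f \<longleftrightarrow> continuous_on UNIV f"
| "C_k (Suc k) f \<longleftrightarrow> (\<forall>x. f differentiable (at x)) \<and>
     (\<forall>v. C_k k (\<lambda>x. frechet_derivative f (at x) v))"

definition supp :: "(real ^ 'n \<Rightarrow> complex) \<Rightarrow> (real ^ 'n) set" where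
  "supp f = closure {x. f x \<noteq> 0}"

definition test_functions :: "(real ^ 'n \<Rightarrow> complex) set" where
  "test_functions = {f. (\<forall>k. C_k k f) \<and> compact (supp f)}"

definition Hr_const :: "ennreal \<Rightarrow> (real ^ 'n \<Rightarrow> complex) \<Rightarrow> ennreal" where
  "Hr_const r K =
    (SUP R\<in>{0<..}.
       let F = (\<lambda>y. \<integral>\<^sup>+ x\<in>{x. norm x \<ge> 2 * R}. ennreal (norm (K (x - y) - K x)) \<partial>lebesgue)
       in if r = \<infinity> then esssup (lebesgue_on {y. norm y \<le> R}) F
          else ennreal_powr
            ((\<integral>\<^sup>+ y\<in>{y. norm y \<le> R}. ennreal_powr (F y) (enn2real r) \<partial>lebesgue)
               / ennreal (measure lebesgue (ball (0 :: real ^ 'n) 1) * R ^ CARD('n)))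
            (1 / enn2real r))"

(* Kernels live on the complement of the origin; the value K 0 is irrelevant. *)
definition Hr_class :: "ennreal \<Rightarrow> (real ^ 'n \<Rightarrow> complex) set" where
  "Hr_class r = {K. K \<in> borel_measurable (lebesgue_on (UNIV - {0})) \<and> Hr_const r K < \<infinity>}"

(* A linear operator with domain D between spaces of measurable functions modulo
   null sets, given by its action on representatives. *)
definition ae_linear_operator ::
  "(real ^ 'n \<Rightarrow> complex) set \<Rightarrow> ((real ^ 'n \<Rightarrow> complex) \<Rightarrow> (real ^ 'n \<Rightarrow> complex)) \<Rightarrow> bool" where
  "ae_linear_operator D T \<longleftrightarrow>
     D \<subseteq> borel_measurable lebesgue \<and>
     (\<lambda>x. 0) \<in> D \<and>
     (\<forall>f\<in>D. T f \<in> borel_measurable lebesgue) \<and>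
     (\<forall>f\<in>D. \<forall>g\<in>borel_measurable lebesgue.
        (AE x in lebesgue. f x = g x) \<longrightarrow> g \<in> D \<and> (AE x in lebesgue. T f x = T g x)) \<and>
     (\<forall>f\<in>D. \<forall>g\<in>D. (\<lambda>x. f x + g x) \<in> D \<and>
        (AE x in lebesgue. T (\<lambda>x. f x + g x) x = T f x + T g x)) \<and>
     (\<forall>c. \<forall>f\<in>D. (\<lambda>x. c * f x) \<in> D \<and>
        (AE x in lebesgue. T (\<lambda>x. c * f x) x = c * T f x))"

definition singular_integral_operator ::
  "(real ^ 'n \<Rightarrow> complex) \<Rightarrow> (real ^ 'n \<Rightarrow> complex) set \<Rightarrow>
   ((real ^ 'n \<Rightarrow> complex) \<Rightarrow> (real ^ 'n \<Rightarrow> complex)) \<Rightarrow> bool" where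
  "singular_integral_operator K D T \<longleftrightarrow>
     ae_linear_operator D T \<and>
     test_functions \<subseteq> D \<and>
     (\<forall>f\<in>D. integrable lebesgue f \<and> compact (supp f) \<longrightarrow>
        (AE x in lebesgue. x \<notin> supp f \<longrightarrow> T f x = (\<integral>y. K (x - y) * f y \<partial>lebesgue)))"

definition bounded_on_Lp ::
  "ennreal \<Rightarrow> real \<Rightarrow> (real ^ 'n \<Rightarrow> complex) set \<Rightarrow>
   ((real ^ 'n \<Rightarrow> complex) \<Rightarrow> (real ^ 'n \<Rightarrow> complex)) \<Rightarrow> bool" where
  "bounded_on_Lp s B D T \<longleftrightarrow>
     Lp s \<subseteq> D \<and> (\<forall>f\<in>Lp s. Lp_norm s (T f) \<le> ennreal B * Lp_norm s f)"

(* S is the operator on L^q obtained from T restricted to test functions by density,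
   with limits taken in weak L^q; the values S f are thereby determined a.e. *)
definition density_extension ::
  "real \<Rightarrow> ((real ^ 'n \<Rightarrow> complex) \<Rightarrow> (real ^ 'n \<Rightarrow> complex)) \<Rightarrow>
   ((real ^ 'n \<Rightarrow> complex) \<Rightarrow> (real ^ 'n \<Rightarrow> complex)) \<Rightarrow> bool" where
  "density_extension q T S \<longleftrightarrow>
     ae_linear_operator (Lp (ennreal q)) S \<and>
     (\<forall>\<phi>\<in>test_functions. AE x in lebesgue. S \<phi> x = T \<phi> x) \<and>
     (\<forall>f\<in>Lp (ennreal q). \<forall>\<phi> :: nat \<Rightarrow> real ^ 'n \<Rightarrow> complex.
        (\<forall>k. \<phi> k \<in> test_functions) \<and>
        (\<lambda>k. Lp_norm (ennreal q) (\<lambda>x. \<phi> k x - f x)) \<longlonglongrightarrow> 0 \<longrightarrow>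
        (\<lambda>k. weak_Lp_norm q (\<lambda>x. T (\<phi> k) x - S f x)) \<longlonglongrightarrow> 0)"

end

theory Submission
  imports Defs
begin

text \<open>For a test function \<open>\<phi>\<close>, a level \<open>\<alpha>\<close>, \<open>G = 2 ^ (n + 1)\<close> and \<open>W > 0\<close> with \<open>W \<ge> B\<close> and \<open>W \<ge> [K]\<close>, a Calderon--Zygmund
  decomposition of \<open>|\<phi>|\<^sup>q\<close> at height \<open>t\<^sup>q\<close>, where \<open>t = \<alpha> / (2 G W)\<close>, splits \<open>\<phi>\<close> into a good part bounded
  by \<open>G t\<close>, handled by the \<open>L\<^sup>s\<close> bound, and mean-zero bad parts on cubes. Away from a dilated cube,
  \<open>T b(x) = \<integral> (K (x - y) - K (x - c)) b(y) dy\<close>, and Young's inequality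
  \<open>|b| F \<le> t W ((|b| / t)\<^sup>q + (F / W)\<^sup>p)\<close>, with \<open>p\<close> the conjugate exponent and \<open>F\<close> the inner
  integral in \<open>H\<^sub>p\<close>, bounds the \<open>L\<^sup>1\<close> norm by \<open>t W\<close> times the volume of the cube. Letting \<open>W\<close> decrease
  to \<open>B + [K]\<close> gives the weak-type bound on test functions; density and the completeness of weak
  \<open>L\<^sup>q\<close> give the extension.\<close>

text \<open>The q-th power of \<open>\<phi>\<close> is decomposed, not \<open>\<phi>\<close> itself,
  because the kernel condition has exponent p and pairs with \<open>L^q\<close> averages on the
  cubes. The height satisfies \<open>G * t = (\<alpha> / 2) / W\<close>. For infinite s the image of
  the good part then stays below \<open>\<alpha> / 2\<close> almost everywhere; for finite s all
  powers of \<open>W\<close> collapse to \<open>(W / \<alpha>) powr q\<close>. The bad parts produce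
  the same power of \<open>W / \<alpha>\<close>, so one number \<open>W\<close> serves both halves
  and the final bound is linear in it. It must be strictly positive, since t and Young's inequality
  divide by it, whereas \<open>B + [K]\<close> may vanish; hence the limit in \<open>W\<close>.
  Finitely many cubes matter beyond convenience: T is only linear, and for infinite s an infinite
  sum of bad parts need not converge in any sense that T respects. The pieces are discontinuous, so
  they enter the domain of T through \<open>L^s\<close>, not as test functions. The pointwise bound
  on K makes \<open>K (x - y) * b y\<close> integrable away from the cube, so that the cancellation
  of b may be used; A does not enter the estimate.\<close>

section \<open>Powers of extended nonnegative reals\<close>

lemma ennreal_powr_ennreal: "0 \<le> r \<Longrightarrow> ennreal_powr (ennreal r) p = ennreal (r powr p)"
  by (simp add: ennreal_powr_def)

lemma ennreal_powr_top [simp]: "ennreal_powr top p = top"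
  by (simp add: ennreal_powr_def)

lemma ennreal_powr_eq_top_iff [simp]: "ennreal_powr x p = top \<longleftrightarrow> x = top"
  by (simp add: ennreal_powr_def)

lemma ennreal_powr_0 [simp]: "ennreal_powr 0 p = 0"
  by (simp add: ennreal_powr_def)

lemma ennreal_powr_less_top_iff: "ennreal_powr x p < top \<longleftrightarrow> x < top"
  using ennreal_powr_eq_top_iff[of x p] by (simp only: less_top[symmetric])

lemma ennreal_powr_mono:
  assumes "0 \<le> p" "x \<le> y"
  shows "ennreal_powr x p \<le> ennreal_powr y p"
  using assms
  by (cases x; cases y) (auto simp: ennreal_powr_ennreal top_unique powr_mono2)

lemma ennreal_powr_powr_inverse:
  assumes "0 < p"
  shows "ennreal_powr (ennreal_powr x (1 / p)) p = x" "ennreal_powr (ennreal_powr x p) (1 / p) = x"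
  using assms
  by (cases x; auto simp: ennreal_powr_ennreal powr_powr)+

lemma ennreal_powr_le_iff:
  assumes "0 < p"
  shows "ennreal_powr x (1 / p) \<le> y \<longleftrightarrow> x \<le> ennreal_powr y p"
  using assms ennreal_powr_mono[of p "ennreal_powr x (1 / p)" y] ennreal_powr_mono[of "1 / p" x "ennreal_powr y p"]
  by (auto simp: ennreal_powr_powr_inverse)

lemma ennreal_powr_mult:
  assumes "0 < c" "0 < p"
  shows "ennreal_powr (ennreal c * x) p = ennreal (c powr p) * ennreal_powr x p"
proof (cases x)
  case (real r)
  then show ?thesis
    using assms by (simp add: ennreal_powr_ennreal powr_mult flip: ennreal_mult)
next
  case top
  then show ?thesis using assms by (simp add: ennreal_mult_top)
qed

text \<open>After division by \<open>a + b\<close> both summands lie in [0, 1], where a power with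
  exponent at most 1 only increases them. It is applied with exponent 1 / q to measures and
  integrals.\<close>

lemma powr_add_le:
  fixes a b p :: real
  assumes "0 \<le> a" "0 \<le> b" "0 < p" "p \<le> 1"
  shows "(a + b) powr p \<le> a powr p + b powr p"
proof (cases "a + b = 0")
  case False
  then have pos: "a + b > 0" using assms by linarith
  have *: "x / (a + b) \<le> (x / (a + b)) powr p" if "0 \<le> x" "x \<le> a + b" for x
    using powr_mono'[of p 1 "x / (a+b)"] that assms pos by (simp add: divide_simps split: if_splits)
  have "1 = a / (a + b) + b / (a + b)" using pos by (simp add: add_divide_distrib[symmetric])
  also have "\<dots> \<le> (a / (a + b)) powr p + (b / (a + b)) powr p"
    using * assms by (intro add_mono) auto
  also have "\<dots> = (a powr p + b powr p) / (a + b) powr p"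
    using assms pos by (simp add: powr_divide add_divide_distrib)
  finally show ?thesis using pos by (simp add: divide_simps)
qed (use assms in auto)

lemma ennreal_powr_add_le:
  assumes "0 < p" "p \<le> 1"
  shows "ennreal_powr (x + y) p \<le> ennreal_powr x p + ennreal_powr y p"
  using assms powr_add_le
  by (cases x; cases y) (auto simp: ennreal_powr_ennreal top_unique simp flip: ennreal_plus)

lemma powr_add_le_2:
  fixes a b p :: real
  assumes "0 \<le> a" "0 \<le> b" "0 < p"
  shows "(a + b) powr p \<le> 2 powr p * (a powr p + b powr p)"
proof -
  have "(a + b) powr p \<le> (2 * max a b) powr p"
    using assms by (intro powr_mono2) auto
  also have "\<dots> = 2 powr p * (max a b) powr p"
    using assms by (simp add: powr_mult)
  also have "\<dots> \<le> 2 powr p * (a powr p + b powr p)"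
    by (intro mult_left_mono) (auto simp: max_def)
  finally show ?thesis .
qed

subsection \<open>\<open>L\<^sup>p\<close> and weak \<open>L\<^sup>p\<close>\<close>

lemma superlevel_set_lebesgue:
  fixes f :: "real ^ 'n \<Rightarrow> complex"
  assumes [measurable]: "f \<in> borel_measurable lebesgue"
  shows "{x. a < norm (f x)} \<in> sets lebesgue"
proof -
  have "{x \<in> space lebesgue. a < norm (f x)} \<in> sets lebesgue" by measurable
  then show ?thesis by simp
qed

lemma Lp_norm_ennreal:
  assumes "1 \<le> p"
  shows "Lp_norm (ennreal p) f = ennreal_powr (\<integral>\<^sup>+ x. ennreal (norm (f x) powr p) \<partial>lebesgue) (1 / p)"
  using assms by (simp add: Lp_norm_def)

lemma Lp_norm_le_iff:
  assumes "1 \<le> p" "0 \<le> c"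
  shows "Lp_norm (ennreal p) f \<le> ennreal c \<longleftrightarrow>
    (\<integral>\<^sup>+ x. ennreal (norm (f x) powr p) \<partial>lebesgue) \<le> ennreal (c powr p)"
  using assms by (simp add: Lp_norm_ennreal ennreal_powr_le_iff ennreal_powr_ennreal)

lemma Lp_measurable: "f \<in> Lp p \<Longrightarrow> f \<in> borel_measurable lebesgue"
  by (simp add: Lp_def)

lemma Lp_iff:
  assumes "1 \<le> p"
  shows "f \<in> Lp (ennreal p) \<longleftrightarrow> f \<in> borel_measurable lebesgue \<and>
    (\<integral>\<^sup>+ x. ennreal (norm (f x) powr p) \<partial>lebesgue) < \<infinity>"
  using assms by (simp add: Lp_def Lp_norm_ennreal ennreal_powr_less_top_iff)

lemma Lp_norm_cong_AE:
  assumes "AE x in lebesgue. f x = g x" "1 \<le> p"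
  shows "Lp_norm (ennreal p) f = Lp_norm (ennreal p) g"
proof -
  have "(\<integral>\<^sup>+ x. ennreal (norm (f x) powr p) \<partial>lebesgue) = (\<integral>\<^sup>+ x. ennreal (norm (g x) powr p) \<partial>lebesgue)"
    using assms(1) by (intro nn_integral_cong_AE) auto
  then show ?thesis using assms(2) by (simp add: Lp_norm_ennreal)
qed

text \<open>A quasi-triangle inequality is enough here: it serves convergence to 0 and a constant in
  the final bound. The factor \<open>2 powr p\<close> under the integral becomes 2 after the p-th
  root, which is itself subadditive.\<close>

lemma Lp_norm_add_le:
  fixes f g :: "real ^ 'n \<Rightarrow> complex"
  assumes [measurable]: "f \<in> borel_measurable lebesgue" "g \<in> borel_measurable lebesgue" and p: "1 \<le> p"
  shows "Lp_norm (ennreal p) (\<lambda>x. f x + g x) \<le> 2 * (Lp_norm (ennreal p) f + Lp_norm (ennreal p) g)"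
proof -
  let ?I = "\<lambda>f :: real ^ 'n \<Rightarrow> complex. \<integral>\<^sup>+ x. ennreal (norm (f x) powr p) \<partial>lebesgue"
  have "?I (\<lambda>x. f x + g x) \<le> (\<integral>\<^sup>+ x. ennreal (2 powr p) * (ennreal (norm (f x) powr p) + ennreal (norm (g x) powr p)) \<partial>lebesgue)"
  proof (rule nn_integral_mono)
    fix x
    have "norm (f x + g x) powr p \<le> (norm (f x) + norm (g x)) powr p"
      using p by (intro powr_mono2 norm_triangle_ineq) auto
    also have "\<dots> \<le> 2 powr p * (norm (f x) powr p + norm (g x) powr p)"
      using p by (intro powr_add_le_2) auto
    finally show "ennreal (norm (f x + g x) powr p) \<le>
      ennreal (2 powr p) * (ennreal (norm (f x) powr p) + ennreal (norm (g x) powr p))"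
      by (simp flip: ennreal_plus ennreal_mult)
  qed
  also have "\<dots> = ennreal (2 powr p) * (?I f + ?I g)"
    by (subst nn_integral_cmult; (subst nn_integral_add)?; simp)
  finally have "ennreal_powr (?I (\<lambda>x. f x + g x)) (1 / p) \<le> ennreal_powr (ennreal (2 powr p) * (?I f + ?I g)) (1 / p)"
    using p by (intro ennreal_powr_mono) auto
  also have "\<dots> = 2 * ennreal_powr (?I f + ?I g) (1 / p)"
    using p by (subst ennreal_powr_mult) (auto simp: powr_powr)
  also have "\<dots> \<le> 2 * (ennreal_powr (?I f) (1 / p) + ennreal_powr (?I g) (1 / p))"
    using p by (intro mult_left_mono ennreal_powr_add_le) auto
  finally show ?thesis using p by (simp add: Lp_norm_ennreal)
qed

lemma Lp_norm_cmult:
  fixes f :: "real ^ 'n \<Rightarrow> complex"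
  assumes [measurable]: "f \<in> borel_measurable lebesgue" and p: "1 \<le> p"
  shows "Lp_norm (ennreal p) (\<lambda>x. c * f x) = ennreal (norm c) * Lp_norm (ennreal p) f"
proof (cases "c = 0")
  case False
  have "(\<integral>\<^sup>+ x. ennreal (norm (c * f x) powr p) \<partial>lebesgue) =
     (\<integral>\<^sup>+ x. ennreal (norm c powr p) * ennreal (norm (f x) powr p) \<partial>lebesgue)"
    by (simp add: norm_mult powr_mult ennreal_mult)
  also have "\<dots> = ennreal (norm c powr p) * (\<integral>\<^sup>+ x. ennreal (norm (f x) powr p) \<partial>lebesgue)"
    by (rule nn_integral_cmult) simp
  finally show ?thesis
    using p False by (simp add: Lp_norm_ennreal ennreal_powr_mult powr_powr)
qed (use p in \<open>simp add: Lp_norm_ennreal\<close>)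

lemma Lp_add:
  assumes "f \<in> Lp (ennreal p)" "g \<in> Lp (ennreal p)" "1 \<le> p"
  shows "(\<lambda>x. f x + g x) \<in> Lp (ennreal p)"
  using assms order.strict_trans1[OF Lp_norm_add_le[of f g p]]
  by (auto simp: Lp_def ennreal_mult_less_top)

lemma Lp_cmult:
  assumes "f \<in> Lp (ennreal p)" "1 \<le> p"
  shows "(\<lambda>x. c * f x) \<in> Lp (ennreal p)"
  using assms by (auto simp: Lp_def Lp_norm_cmult ennreal_mult_less_top)

section \<open>Weak \<open>L^p\<close> norms\<close>

lemma weak_Lp_norm_le_iff:
  assumes "1 \<le> q" "0 \<le> w"
  shows "weak_Lp_norm q f \<le> ennreal w \<longleftrightarrow>
    (\<forall>\<alpha>>0. emeasure lebesgue {x. \<alpha> < norm (f x)} \<le> ennreal ((w / \<alpha>) powr q))"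
proof -
  have "ennreal \<alpha> * ennreal_powr m (1 / q) \<le> ennreal w \<longleftrightarrow> m \<le> ennreal ((w / \<alpha>) powr q)"
    if "\<alpha> > 0" for \<alpha> and m
  proof -
    have "ennreal \<alpha> * y \<le> ennreal w \<longleftrightarrow> y \<le> ennreal (w / \<alpha>)" for y
      using that assms
      by (cases y) (auto simp: ennreal_mult_top top_unique field_simps simp flip: ennreal_mult)
    then show ?thesis
      using that assms by (simp add: ennreal_powr_le_iff ennreal_powr_ennreal)
  qed
  then show ?thesis
    by (auto simp: weak_Lp_norm_def SUP_le_iff)
qed

lemma ennreal_le_ennrealI:
  fixes x y :: ennreal
  assumes "\<And>w. 0 \<le> w \<Longrightarrow> y \<le> ennreal w \<Longrightarrow> x \<le> ennreal w"
  shows "x \<le> y"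
  using assms by (cases y) auto

text \<open>If a sum exceeds \<open>\<alpha>\<close>, one summand exceeds
  \<open>\<alpha> / 2\<close>; halving the level costs the factor 2, and the root with exponent 1 /
  q is subadditive on the measures.\<close>

lemma weak_Lp_norm_add_le:
  fixes f g :: "real ^ 'n \<Rightarrow> complex"
  assumes [measurable]: "f \<in> borel_measurable lebesgue" "g \<in> borel_measurable lebesgue" and q: "1 \<le> q"
  shows "weak_Lp_norm q (\<lambda>x. f x + g x) \<le> 2 * (weak_Lp_norm q f + weak_Lp_norm q g)"
proof -
  let ?m = "\<lambda>(f :: real ^ 'n \<Rightarrow> complex) \<alpha>. emeasure lebesgue {x. \<alpha> < norm (f x)}"
  have "ennreal \<alpha> * ennreal_powr (?m (\<lambda>x. f x + g x) \<alpha>) (1 / q) \<le> 2 * (weak_Lp_norm q f + weak_Lp_norm q g)"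
    if "\<alpha> > 0" for \<alpha>
  proof -
    have f: "{x. \<beta> < norm (f x)} \<in> sets lebesgue" and g: "{x. \<beta> < norm (g x)} \<in> sets lebesgue" for \<beta>
      by (simp_all add: superlevel_set_lebesgue)
    have "?m (\<lambda>x. f x + g x) \<alpha> \<le> emeasure lebesgue ({x. \<alpha>/2 < norm (f x)} \<union> {x. \<alpha>/2 < norm (g x)})"
    proof (rule emeasure_mono)
      show "{x. \<alpha> < norm (f x + g x)} \<subseteq> {x. \<alpha>/2 < norm (f x)} \<union> {x. \<alpha>/2 < norm (g x)}"
      proof (intro subsetI, rule ccontr)
        fix x assume "x \<in> {x. \<alpha> < norm (f x + g x)}" "x \<notin> {x. \<alpha>/2 < norm (f x)} \<union> {x. \<alpha>/2 < norm (g x)}"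
        then show False using norm_triangle_ineq[of "f x" "g x"] by auto
      qed
    qed (use f[of "\<alpha>/2"] g[of "\<alpha>/2"] in \<open>rule sets.Un\<close>)
    also have "\<dots> \<le> ?m f (\<alpha>/2) + ?m g (\<alpha>/2)"
      using f g by (rule emeasure_subadditive)
    finally have "ennreal_powr (?m (\<lambda>x. f x + g x) \<alpha>) (1 / q) \<le> ennreal_powr (?m f (\<alpha>/2) + ?m g (\<alpha>/2)) (1 / q)"
      using q by (intro ennreal_powr_mono) auto
    also have "\<dots> \<le> ennreal_powr (?m f (\<alpha>/2)) (1 / q) + ennreal_powr (?m g (\<alpha>/2)) (1 / q)"
      using q by (intro ennreal_powr_add_le) auto
    finally have "ennreal \<alpha> * ennreal_powr (?m (\<lambda>x. f x + g x) \<alpha>) (1 / q)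
      \<le> (2 * ennreal (\<alpha>/2)) * (ennreal_powr (?m f (\<alpha>/2)) (1 / q) + ennreal_powr (?m g (\<alpha>/2)) (1 / q))"
      using that by (subst ennreal_numeral[symmetric], subst ennreal_mult[symmetric]) (auto intro!: mult_left_mono)
    also have "\<dots> = 2 * (ennreal (\<alpha>/2) * ennreal_powr (?m f (\<alpha>/2)) (1 / q) + ennreal (\<alpha>/2) * ennreal_powr (?m g (\<alpha>/2)) (1 / q))"
      by (simp add: algebra_simps)
    also have "\<dots> \<le> 2 * (weak_Lp_norm q f + weak_Lp_norm q g)"
      unfolding weak_Lp_norm_def using that
      by (intro mult_left_mono add_mono SUP_upper) auto
    finally show ?thesis .
  qed
  then show ?thesis
    unfolding weak_Lp_norm_def[of q "\<lambda>x. f x + g x"] by (auto simp: SUP_le_iff)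
qed

lemma weak_Lp_norm_cmult_le:
  assumes "1 \<le> q"
  shows "weak_Lp_norm q (\<lambda>x. c * f x) \<le> ennreal (norm c) * weak_Lp_norm q f"
proof (cases "c = 0")
  case True
  then show ?thesis using assms
    by (simp add: weak_Lp_norm_def SUP_le_iff not_less)
next
  case False
  have "ennreal \<alpha> * ennreal_powr (emeasure lebesgue {x. \<alpha> < norm (c * f x)}) (1 / q) \<le> ennreal (norm c) * weak_Lp_norm q f"
    if "\<alpha> > 0" for \<alpha>
  proof -
    have "{x. \<alpha> < norm (c * f x)} = {x. \<alpha> / norm c < norm (f x)}"
      using False by (simp add: norm_mult field_simps)
    then have "ennreal \<alpha> * ennreal_powr (emeasure lebesgue {x. \<alpha> < norm (c * f x)}) (1 / q) =
       ennreal (norm c) * (ennreal (\<alpha> / norm c) * ennreal_powr (emeasure lebesgue {x. \<alpha> / norm c < norm (f x)}) (1 / q))"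
      using False that by (simp add: mult.assoc[symmetric] ennreal_mult[symmetric])
    also have "\<dots> \<le> ennreal (norm c) * weak_Lp_norm q f"
      unfolding weak_Lp_norm_def using that False by (intro mult_left_mono SUP_upper) auto
    finally show ?thesis .
  qed
  then show ?thesis unfolding weak_Lp_norm_def[of q "\<lambda>x. c * f x"] by (auto simp: SUP_le_iff)
qed

lemma weak_Lp_norm_cong_AE:
  assumes [measurable]: "f \<in> borel_measurable lebesgue" "g \<in> borel_measurable lebesgue"
    and "AE x in lebesgue. f x = g x"
  shows "weak_Lp_norm q f = weak_Lp_norm q g"
proof -
  have "emeasure lebesgue {x. \<alpha> < norm (f x)} = emeasure lebesgue {x. \<alpha> < norm (g x)}" for \<alpha>
    using assms(3) by (intro emeasure_eq_AE) (auto simp: superlevel_set_lebesgue)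
  then show ?thesis by (simp add: weak_Lp_norm_def)
qed

lemma weak_Lp_norm_eq_0_imp_AE:
  assumes f [measurable]: "f \<in> borel_measurable lebesgue" and "weak_Lp_norm q f = 0" "1 \<le> q"
  shows "AE x in lebesgue. f x = 0"
proof -
  have "emeasure lebesgue {x. \<alpha> < norm (f x)} = 0" if "\<alpha> > 0" for \<alpha>
    using weak_Lp_norm_le_iff[of q 0 f] assms that by auto
  then have "AE x in lebesgue. \<not> 1 / Suc k < norm (f x)" for k
    using superlevel_set_lebesgue[OF f] by (intro AE_I[where N="{x. 1 / Suc k < norm (f x)}"]) auto
  then have "AE x in lebesgue. \<forall>k. \<not> 1 / Suc k < norm (f x)"
    by (simp add: AE_all_countable)
  then show ?thesis
  proof eventually_elim
    case (elim x)
    show ?case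
    proof (rule ccontr)
      assume "f x \<noteq> 0"
      then obtain k where "inverse (real (Suc k)) < norm (f x)"
        using reals_Archimedean[of "norm (f x)"] by auto
      then show False using elim by (auto simp: inverse_eq_divide)
    qed
  qed
qed

text \<open>Because the level sets are defined by a strict inequality, a point of the level set of
  the limit eventually lies in those of the sequence. Their indicators therefore satisfy the
  hypothesis of Fatou's lemma at every level.\<close>

lemma weak_Lp_norm_Fatou:
  assumes f: "\<And>j. f j \<in> borel_measurable lebesgue" and g: "g \<in> borel_measurable lebesgue"
    and lim: "AE x in lebesgue. (\<lambda>j. f j x) \<longlonglongrightarrow> g x"
    and le: "\<And>j. weak_Lp_norm q (f j) \<le> w" and q: "1 \<le> q"
  shows "weak_Lp_norm q g \<le> w"
proof (rule ennreal_le_ennrealI)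
  fix v :: real assume v: "0 \<le> v" "w \<le> ennreal v"
  note [measurable] = f g
  show "weak_Lp_norm q g \<le> ennreal v"
    unfolding weak_Lp_norm_le_iff[OF q v(1)]
  proof (intro allI impI)
    fix \<alpha> :: real assume \<alpha>: "0 < \<alpha>"
    let ?A = "\<lambda>j. {x \<in> space lebesgue. \<alpha> < norm (f j x)}"
    have "emeasure lebesgue {x. \<alpha> < norm (g x)} = (\<integral>\<^sup>+ x. indicator {x. \<alpha> < norm (g x)} x \<partial>lebesgue)"
      by (simp add: superlevel_set_lebesgue g)
    also have "\<dots> \<le> (\<integral>\<^sup>+ x. liminf (\<lambda>j. indicator (?A j) x) \<partial>lebesgue)"
    proof (rule nn_integral_mono_AE)
      show "AE x in lebesgue. indicator {x. \<alpha> < norm (g x)} x \<le> liminf (\<lambda>j. indicator (?A j) x :: ennreal)"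
        using lim
      proof eventually_elim
        case (elim x)
        show ?case
        proof (cases "\<alpha> < norm (g x)")
          case True
          have "(\<lambda>j. norm (f j x)) \<longlonglongrightarrow> norm (g x)" using elim by (rule tendsto_norm)
          then have "eventually (\<lambda>j. \<alpha> < norm (f j x)) sequentially"
            using True by (rule order_tendstoD)
          then have "eventually (\<lambda>j. (1::ennreal) \<le> indicator (?A j) x) sequentially"
            by eventually_elim simp
          then have "1 \<le> liminf (\<lambda>j. indicator (?A j) x :: ennreal)"
            by (rule Liminf_bounded)
          then show ?thesis using True by simp
        qed simp
      qed
    qed
    also have "\<dots> \<le> liminf (\<lambda>j. \<integral>\<^sup>+ x. indicator (?A j) x \<partial>lebesgue)"
      by (rule nn_integral_liminf) measurable
    also have "\<dots> \<le> ennreal ((v / \<alpha>) powr q)"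
    proof (rule order_trans[OF Liminf_mono Liminf_const[THEN eq_refl]])
      show "eventually (\<lambda>j. (\<integral>\<^sup>+ x. indicator (?A j) x \<partial>lebesgue) \<le> ennreal ((v / \<alpha>) powr q)) sequentially"
      proof (intro always_eventually allI)
        fix j
        have "weak_Lp_norm q (f j) \<le> ennreal v" using le[of j] v by simp
        then show "(\<integral>\<^sup>+ x. indicator (?A j) x \<partial>lebesgue) \<le> ennreal ((v / \<alpha>) powr q)"
          using weak_Lp_norm_le_iff[OF q v(1), of "f j"] \<alpha> by (simp add: superlevel_set_lebesgue f)
      qed
    qed simp
    finally show "emeasure lebesgue {x. \<alpha> < norm (g x)} \<le> ennreal ((v / \<alpha>) powr q)" .
  qed
qed

subsection \<open>Smooth functions\<close>

lemma C_k_SucI: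
  assumes "\<And>x. (f has_derivative f' x) (at x)" "\<And>v. C_k k (\<lambda>x. f' x v)"
  shows "C_k (Suc k) f"
proof -
  have "frechet_derivative f (at x) = f' x" for x
    using frechet_derivative_at[OF assms(1)] by simp
  then show ?thesis using assms by (auto simp: differentiable_def)
qed

lemma C_k_has_derivative:
  assumes "C_k (Suc k) f"
  shows "(f has_derivative frechet_derivative f (at x)) (at x)"
  using assms by (simp add: frechet_derivative_works)

text \<open>The recursion constrains only derivatives, so losing an order needs its own induction.
  The product rule depends on it, as it leaves undifferentiated factors.\<close>

lemma C_k_Suc_imp_C_k: "C_k (Suc k) f \<Longrightarrow> C_k k f"
proof (induction k arbitrary: f)
  case 0
  then show ?case
    using differentiable_imp_continuous_within[of f _ UNIV]
    by (auto simp: continuous_on_eq_continuous_within)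
next
  case (Suc k)
  then have "C_k (Suc k) (\<lambda>x. frechet_derivative f (at x) v)" for v by simp
  then show ?case
    using Suc by (intro C_k_SucI[OF C_k_has_derivative[OF Suc.prems]]) blast
qed

lemma C_k_const: "C_k k (\<lambda>x. c)"
proof (induction k arbitrary: c)
  case (Suc k)
  then show ?case by (intro C_k_SucI[where f'="\<lambda>x v. 0"]) auto
qed simp

lemma C_k_add: "C_k k f \<Longrightarrow> C_k k g \<Longrightarrow> C_k k (\<lambda>x. f x + g x)"
proof (induction k arbitrary: f g)
  case 0
  then show ?case by (auto intro: continuous_intros)
next
  case (Suc k)
  show ?case
  proof (rule C_k_SucI)
    show "((\<lambda>x. f x + g x) has_derivative
        (\<lambda>v. frechet_derivative f (at x) v + frechet_derivative g (at x) v)) (at x)" for x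
      by (rule has_derivative_add[OF C_k_has_derivative[OF Suc.prems(1)] C_k_has_derivative[OF Suc.prems(2)]])
  qed (use Suc in simp)
qed

lemma C_k_mult: "C_k k f \<Longrightarrow> C_k k g \<Longrightarrow> C_k k (\<lambda>x. f x * g x)"
proof (induction k arbitrary: f g)
  case 0
  then show ?case by (auto intro: continuous_intros)
next
  case (Suc k)
  show ?case
  proof (rule C_k_SucI)
    show "((\<lambda>x. f x * g x) has_derivative
        (\<lambda>v. f x * frechet_derivative g (at x) v + frechet_derivative f (at x) v * g x)) (at x)" for x
      by (rule has_derivative_mult[OF C_k_has_derivative[OF Suc.prems(1)] C_k_has_derivative[OF Suc.prems(2)]])
    have "C_k k f" "C_k k g" using Suc.prems C_k_Suc_imp_C_k by auto
    then show "C_k k (\<lambda>x. f x * frechet_derivative g (at x) v + frechet_derivative f (at x) v * g x)" for v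
      using Suc.prems by (intro C_k_add Suc.IH) auto
  qed
qed

lemma C_k_bounded_linear:
  assumes "bounded_linear l"
  shows "C_k k l"
proof (cases k)
  case 0
  then show ?thesis using assms by (simp add: linear_continuous_on)
next
  case (Suc m)
  show ?thesis unfolding Suc
    by (rule C_k_SucI[OF bounded_linear_imp_has_derivative[OF assms] C_k_const])
qed

lemma C_k_real_polynomial_function:
  assumes "real_polynomial_function p"
  shows "C_k k (\<lambda>x. complex_of_real (p x))"
  using assms
proof induction
  case (linear f)
  then show ?case
    by (intro C_k_bounded_linear bounded_linear_compose[OF bounded_linear_of_real])
qed (auto intro: C_k_const C_k_add C_k_mult)

text \<open>Approximants from the Stone-Weierstrass theorem are thereby smooth already, so density
  of test functions needs no mollification.\<close>

lemma C_k_polynomial_function: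
  fixes p :: "real ^ 'n \<Rightarrow> complex"
  assumes "polynomial_function p"
  shows "C_k k p"
proof -
  have "real_polynomial_function (Re \<circ> p)" "real_polynomial_function (Im \<circ> p)"
    using assms by (simp_all add: polynomial_function_def bounded_linear_Re bounded_linear_Im)
  then have "C_k k (\<lambda>x. complex_of_real ((Re \<circ> p) x) + \<i> * complex_of_real ((Im \<circ> p) x))"
    by (intro C_k_add C_k_mult C_k_const C_k_real_polynomial_function)
  moreover have "(\<lambda>x. complex_of_real ((Re \<circ> p) x) + \<i> * complex_of_real ((Im \<circ> p) x)) = p"
    by (auto simp: complex_eq_iff)
  ultimately show ?thesis by simp
qed

text \<open>The family \<open>p (1 / t) * exp (- 1 / t)\<close>, \<open>t > 0\<close>, is closed under differentiation, so
  that each of its members is smooth on the real line.\<close>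

definition flat_exp :: "real poly \<Rightarrow> real \<Rightarrow> real" where
  "flat_exp p t = (if 0 < t then poly p (1 / t) * exp (- (1 / t)) else 0)"

lemma poly_times_exp_tendsto_0: "((\<lambda>u::real. poly p u * exp (- u)) \<longlongrightarrow> 0) at_top"
proof -
  have "((\<lambda>u. \<Sum>i\<le>degree p. coeff p i * (u ^ i / exp u)) \<longlongrightarrow> (\<Sum>i\<le>degree p. coeff p i * 0)) at_top"
    by (intro tendsto_intros tendsto_power_div_exp_0)
  moreover have "(\<lambda>u. \<Sum>i\<le>degree p. coeff p i * (u ^ i / exp u)) = (\<lambda>u. poly p u * exp (- u))"
    by (simp add: poly_altdef sum_distrib_right exp_minus divide_inverse mult.assoc)
  ultimately show ?thesis by simp
qed

lemma flat_exp_tendsto_0: "(flat_exp p \<longlongrightarrow> 0) (at 0)"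
proof (rule filterlim_split_at)
  show "(flat_exp p \<longlongrightarrow> 0) (at_left 0)"
    by (rule tendsto_eventually) (auto simp: eventually_at_filter flat_exp_def)
  have "((\<lambda>t. poly p (inverse t) * exp (- inverse t)) \<longlongrightarrow> 0) (at_right 0)"
    by (rule filterlim_compose[OF poly_times_exp_tendsto_0 filterlim_inverse_at_top_right])
  then show "(flat_exp p \<longlongrightarrow> 0) (at_right 0)"
    by (rule Lim_transform_eventually) (auto simp: eventually_at_filter flat_exp_def inverse_eq_divide)
qed

text \<open>The polynomial \<open>[:0, 0, 1:]\<close> is the factor \<open>1 / t^2\<close> from the
  derivative of \<open>1 / t\<close>. At 0 the difference quotient is again a member of the family,
  for \<open>[:0, 1:] * p\<close>, and so tends to 0.\<close>

lemma flat_exp_has_real_derivative: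
  "(flat_exp p has_real_derivative flat_exp ([:0, 0, 1:] * (p - pderiv p)) t) (at t)"
proof (cases t "0::real" rule: linorder_cases)
  case less
  have "((\<lambda>t. 0) has_real_derivative 0) (at t)" by simp
  then have "(flat_exp p has_real_derivative 0) (at t)"
    by (rule has_field_derivative_transform_within[where d="-t"]) (use less in \<open>auto simp: flat_exp_def dist_real_def\<close>)
  then show ?thesis using less by (simp add: flat_exp_def)
next
  case equal
  have "flat_exp ([:0, 1:] * p) = (\<lambda>h. flat_exp p h / h)"
    by (auto simp: flat_exp_def)
  with flat_exp_tendsto_0[of "[:0, 1:] * p"] have "((\<lambda>h. flat_exp p h / h) \<longlongrightarrow> 0) (at 0)"
    by (simp only:)
  then show ?thesis
    using equal by (simp add: has_field_derivative_iff flat_exp_def)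
next
  case greater
  have "((\<lambda>t. poly p (1 / t) * exp (- (1 / t))) has_real_derivative
      poly p (1 / t) * (exp (- (1 / t)) * (1 / t\<^sup>2)) + poly (pderiv p) (1 / t) * (- (1 / t\<^sup>2)) * exp (- (1 / t))) (at t)"
    using greater
    by (auto intro!: derivative_eq_intros DERIV_chain2[OF poly_DERIV] simp: power2_eq_square)
  then have "(flat_exp p has_real_derivative
      poly p (1 / t) * (exp (- (1 / t)) * (1 / t\<^sup>2)) + poly (pderiv p) (1 / t) * (- (1 / t\<^sup>2)) * exp (- (1 / t))) (at t)"
    by (rule has_field_derivative_transform_within[where d="t"]) (use greater in \<open>auto simp: flat_exp_def dist_real_def\<close>)
  then show ?thesis
    using greater by (simp add: flat_exp_def algebra_simps power2_eq_square)
qed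

text \<open>For \<open>p = 1\<close> and \<open>R > 0\<close> this is a cutoff with values in
  [0, 1], positive exactly on the open ball of radius R. The argument is quadratic in x, hence
  smooth also at the origin, where the norm is not.\<close>

definition bump :: "real poly \<Rightarrow> real \<Rightarrow> real ^ 'n \<Rightarrow> real" where
  "bump p R x = flat_exp p (R\<^sup>2 - x \<bullet> x)"

text \<open>The induction runs over all p at once: a directional derivative is a linear function
  times the bump of another polynomial.\<close>

lemma C_k_bump: "C_k k (\<lambda>x. complex_of_real (bump p R x))"
proof (induction k arbitrary: p)
  case 0
  have "continuous_on UNIV (flat_exp p)"
    by (rule DERIV_continuous_on) (rule has_field_derivative_at_within[OF flat_exp_has_real_derivative])
  then have "continuous_on UNIV (\<lambda>x. bump p R x :: real)"
    unfolding bump_def by (rule continuous_on_compose2) (intro continuous_intros, simp)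
  then show ?case by (simp add: continuous_on_of_real)
next
  case (Suc k)
  let ?p' = "[:0, 0, 1:] * (p - pderiv p)"
  show ?case
  proof (rule C_k_SucI)
    fix x :: "real ^ 'a"
    have "(bump p R has_derivative (\<lambda>v. (- (2 * (x \<bullet> v))) * bump ?p' R x)) (at x)"
      unfolding bump_def
      by (rule has_derivative_eq_rhs[OF has_derivative_compose[OF _ flat_exp_has_real_derivative[unfolded has_field_derivative_def]]])
         (auto intro!: derivative_eq_intros simp: inner_commute)
    then show "((\<lambda>x. complex_of_real (bump p R x)) has_derivative
       (\<lambda>v. complex_of_real (- (2 * (x \<bullet> v))) * complex_of_real (bump ?p' R x))) (at x)"
      using has_derivative_of_real by fastforce
  next
    fix v :: "real ^ 'a"
    have "C_k k (\<lambda>x::real ^ 'a. complex_of_real (- (2 * (x \<bullet> v))))"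
      by (intro C_k_bounded_linear bounded_linear_compose[OF bounded_linear_of_real]
          bounded_linear_minus bounded_linear_const_mult bounded_linear_inner_left)
    then show "C_k k (\<lambda>x. complex_of_real (- (2 * (x \<bullet> v))) * complex_of_real (bump ?p' R x))"
      by (intro C_k_mult Suc)
  qed
qed

subsection \<open>Test functions\<close>

lemma supp_subset: "closed S \<Longrightarrow> (\<And>x. x \<notin> S \<Longrightarrow> f x = 0) \<Longrightarrow> supp f \<subseteq> S"
  unfolding supp_def by (rule closure_minimal) auto

lemma compact_suppI:
  assumes "compact S" "\<And>x. x \<notin> S \<Longrightarrow> f x = 0"
  shows "compact (supp f)"
proof -
  have "supp f \<subseteq> S" using assms by (intro supp_subset compact_imp_closed)
  then have "supp f = S \<inter> closure {x. f x \<noteq> 0}" by (auto simp: supp_def)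
  then show ?thesis
    using compact_Int_closed[OF assms(1) closed_closure] by simp
qed

lemma not_in_supp: "x \<notin> supp f \<Longrightarrow> f x = 0"
  using closure_subset[of "{x. f x \<noteq> 0}"] by (auto simp: supp_def)

lemma test_function_add:
  assumes "f \<in> test_functions" "g \<in> test_functions"
  shows "(\<lambda>x. f x + g x) \<in> test_functions"
proof -
  have "compact (supp (\<lambda>x. f x + g x))"
    by (rule compact_suppI[where S="supp f \<union> supp g"]) (use assms in \<open>auto simp: test_functions_def not_in_supp\<close>)
  then show ?thesis using assms by (auto simp: test_functions_def C_k_add)
qed

lemma test_function_cmult:
  assumes "f \<in> test_functions"
  shows "(\<lambda>x. c * f x) \<in> test_functions"
proof -
  have "compact (supp (\<lambda>x. c * f x))"
    by (rule compact_suppI[where S="supp f"]) (use assms in \<open>auto simp: test_functions_def not_in_supp\<close>)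
  then show ?thesis using assms C_k_mult[OF C_k_const] by (auto simp: test_functions_def)
qed

lemma test_function_diff:
  assumes "f \<in> test_functions" "g \<in> test_functions"
  shows "(\<lambda>x. f x - g x) \<in> test_functions"
  using test_function_add[OF assms(1) test_function_cmult[OF assms(2), of "-1"]] by simp

lemma test_function_continuous: "f \<in> test_functions \<Longrightarrow> continuous_on UNIV f"
  by (auto simp: test_functions_def dest: spec[of _ 0])

lemma test_function_borel: "f \<in> test_functions \<Longrightarrow> f \<in> borel_measurable borel"
  by (rule borel_measurable_continuous_onI[OF test_function_continuous])

lemma test_function_bounds:
  assumes "f \<in> test_functions"
  obtains r m where "0 < r" "0 < m" "\<And>x. norm (f x) \<le> m" "\<And>x. r < norm x \<Longrightarrow> f x = 0"
proof -
  have cpt: "compact (supp f)" using assms by (simp add: test_functions_def)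
  then obtain r where r: "0 < r" "\<And>x. x \<in> supp f \<Longrightarrow> norm x \<le> r"
    using compact_imp_bounded[of "supp f"] unfolding bounded_pos by blast
  have "compact (f ` supp f)"
    using cpt test_function_continuous[OF assms] by (intro compact_continuous_image) (auto intro: continuous_on_subset)
  then obtain m where m: "0 < m" "\<And>x. x \<in> supp f \<Longrightarrow> norm (f x) \<le> m"
    using compact_imp_bounded[of "f ` supp f"] unfolding bounded_pos by blast
  show ?thesis
  proof
    show "norm (f x) \<le> m" for x
      using m not_in_supp[of x f] by (cases "x \<in> supp f") auto
    show "f x = 0" if "r < norm x" for x
      using r(2)[of x] that not_in_supp[of x f] by force
  qed (fact r(1) m(1))+
qed

text \<open>Continuity is not assumed and infinite p is included: this is what places the good and
  bad parts in \<open>L^s\<close>, hence in the domain of T.\<close>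

lemma bounded_support_in_Lp:
  fixes f :: "real ^ 'n \<Rightarrow> complex"
  assumes f: "f \<in> borel_measurable lebesgue" and m: "\<And>x. norm (f x) \<le> m" and r: "\<And>x. r < norm x \<Longrightarrow> f x = 0"
    and p: "1 \<le> p"
  shows "f \<in> Lp p"
proof (cases "p = \<infinity>")
  case True
  have "esssup lebesgue (\<lambda>x. ennreal (norm (f x))) \<le> ennreal m"
    using f m by (intro esssup_I) (auto intro!: ennreal_leI)
  then show ?thesis
    using True f by (auto simp: Lp_def Lp_norm_def intro: order.strict_trans1)
next
  case False
  then obtain p' where p': "p = ennreal p'" "1 \<le> p'"
    using p by (cases p) (auto simp: ennreal_ge_1)
  have "0 \<le> m" using m[of 0] norm_ge_zero order_trans by blast
  have "(\<integral>\<^sup>+ x. ennreal (norm (f x) powr p') \<partial>lebesgue) \<le> (\<integral>\<^sup>+ x. ennreal (m powr p') * indicator (cball (0::real^'n) r) x \<partial>lebesgue)"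
    using m r p' by (intro nn_integral_mono) (auto split: split_indicator intro!: ennreal_leI powr_mono2 simp: not_le)
  also have "\<dots> = ennreal (m powr p') * emeasure lebesgue (cball (0::real^'n) r)"
    by (rule nn_integral_cmult_indicator) simp
  also have "\<dots> < \<infinity>"
    using emeasure_lborel_cball_finite[of "0::real^'n" r] by (simp add: ennreal_mult_less_top)
  finally show ?thesis using p' f by (simp add: Lp_iff)
qed

lemma test_function_Lp:
  assumes "f \<in> test_functions" "1 \<le> p"
  shows "f \<in> Lp p"
proof -
  obtain r m where "0 < r" "0 < m" "\<And>x. norm (f x) \<le> m" "\<And>x. r < norm x \<Longrightarrow> f x = 0"
    using test_function_bounds[OF assms(1)] by blast
  moreover have "f \<in> borel_measurable lebesgue"
    using test_function_borel[OF assms(1)] by (intro measurable_completion) simp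
  ultimately show ?thesis using assms(2) by (intro bounded_support_in_Lp) auto
qed

lemma Lp_norm_tendsto_0:
  fixes f :: "nat \<Rightarrow> real ^ 'n \<Rightarrow> complex"
  assumes [measurable]: "\<And>j. f j \<in> borel_measurable lebesgue" "w \<in> borel_measurable lebesgue"
    and le: "\<And>j x. norm (f j x) powr p \<le> w x" and w: "(\<integral>\<^sup>+ x. ennreal (w x) \<partial>lebesgue) < \<infinity>"
    and lim: "AE x in lebesgue. (\<lambda>j. f j x) \<longlonglongrightarrow> 0" and p: "1 \<le> p"
  shows "(\<lambda>j. Lp_norm (ennreal p) (f j)) \<longlonglongrightarrow> 0"
proof (rule order_tendstoI)
  have *: "(\<lambda>j. (\<integral>\<^sup>+ x. ennreal (norm (f j x) powr p) \<partial>lebesgue)) \<longlonglongrightarrow> (\<integral>\<^sup>+ (x::real^'n). 0 \<partial>lebesgue)"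
  proof (rule nn_integral_dominated_convergence[where w="\<lambda>x. ennreal (w x)"])
    show "AE x in lebesgue. (\<lambda>j. ennreal (norm (f j x) powr p)) \<longlonglongrightarrow> 0"
      using lim
    proof eventually_elim
      case (elim x)
      have "(\<lambda>j. norm (f j x) powr p) \<longlonglongrightarrow> 0 powr p"
        using tendsto_norm[OF elim] p by (intro tendsto_powr') auto
      then show ?case using tendsto_ennrealI by fastforce
    qed
  qed (use le w in \<open>auto intro: ennreal_leI\<close>)
  fix e :: ennreal assume "0 < e"
  then obtain e' :: real where e': "0 < e'" "ennreal e' < e"
    by (metis dense ennreal_cases ennreal_less_zero_iff less_irrefl not_less_iff_gr_or_eq order_less_trans top_greatest linorder_not_le)
  have "eventually (\<lambda>j. (\<integral>\<^sup>+ x. ennreal (norm (f j x) powr p) \<partial>lebesgue) < ennreal (e' powr p)) sequentially"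
    using * e' by (intro order_tendstoD) auto
  then show "eventually (\<lambda>j. Lp_norm (ennreal p) (f j) < e) sequentially"
  proof eventually_elim
    case (elim j)
    then have "Lp_norm (ennreal p) (f j) \<le> ennreal e'"
      using Lp_norm_le_iff[OF p, of e' "f j"] e' by (simp add: less_imp_le)
    then show ?case using e' by simp
  qed
qed simp

section \<open>Density of test functions in \<open>L^p\<close>\<close>

text \<open>Domination by the cutoff makes the quotient h of u by the cutoff bounded. A measurable h
  is an a.e. limit of continuous functions, these are uniformly close to polynomials on the ball,
  and multiplying back by the cutoff gives smooth functions of compact support. Dominated
  convergence finishes.\<close>

lemma test_functions_dense_bounded:
  fixes u :: "real ^ 'n \<Rightarrow> complex"
  assumes u: "u \<in> borel_measurable lebesgue" and m: "0 \<le> m" and p: "1 \<le> p" and R: "0 < R"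
    and supp: "\<And>x. u x \<noteq> 0 \<Longrightarrow> norm x < R \<and> norm (u x) \<le> m * bump 1 R x"
  shows "\<exists>\<phi>. (\<forall>j. \<phi> j \<in> test_functions) \<and> (\<lambda>j. Lp_norm (ennreal p) (\<lambda>x. \<phi> j x - u x)) \<longlonglongrightarrow> 0"
proof -
  let ?\<chi> = "\<lambda>x::real^'n. complex_of_real (bump 1 R x)"
  have \<chi>0: "bump 1 R x = 0" if "R \<le> norm x" for x :: "real^'n"
    using that R power_mono[of R "norm x" 2] by (simp add: bump_def flat_exp_def dot_square_norm not_less)
  have \<chi>1: "0 \<le> bump 1 R x" "bump 1 R x \<le> 1" for x :: "real^'n"
    by (auto simp: bump_def flat_exp_def)
  have \<chi>2: "0 < bump 1 R x" if "norm x < R" for x :: "real^'n"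
    using that power_strict_mono[of "norm x" R 2] by (simp add: bump_def flat_exp_def dot_square_norm)
  have \<chi>m: "?\<chi> \<in> borel_measurable lebesgue"
  proof (rule measurable_completion)
    have "continuous_on UNIV ?\<chi>" using C_k_bump[of 0 1 R] by (simp only: C_k.simps)
    then have "?\<chi> \<in> borel_measurable borel" by (rule borel_measurable_continuous_onI)
    then show "?\<chi> \<in> borel_measurable lborel" by simp
  qed
  define h where "h x = u x / ?\<chi> x" for x
  have h: "h \<in> borel_measurable lebesgue"
    unfolding h_def using u \<chi>m by simp
  have hm: "norm (h x) \<le> m" for x
  proof (cases "u x = 0")
    case False
    then show ?thesis using supp[of x] \<chi>2[of x] by (simp add: h_def norm_divide divide_le_eq)
  qed (simp add: h_def m)
  have hu: "?\<chi> x * h x = u x" for x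
    using supp[of x] \<chi>2[of x] by (cases "u x = 0") (auto simp: h_def)
  have "h measurable_on UNIV"
    using h by (intro lebesgue_measurable_imp_measurable_on) auto
  then obtain N and g :: "nat \<Rightarrow> real ^ 'n \<Rightarrow> complex" where N: "negligible N" and
    g: "\<And>j. continuous_on UNIV (g j)" "\<And>x. x \<notin> N \<Longrightarrow> (\<lambda>j. g j x) \<longlonglongrightarrow> h x"
    by (auto simp: measurable_on_def)
  \<comment> \<open>Projecting the values onto the ball of radius m keeps continuity and the limit
    h, and supplies the uniform bound that dominated convergence needs.\<close>
  define c where "c j x = closest_point (cball 0 m) (g j x)" for j x
  have c: "continuous_on UNIV (c j)" for j
    unfolding c_def using m
    by (intro continuous_on_compose2[OF continuous_on_closest_point g(1)]) auto
  have cm: "norm (c j x) \<le> m" for j x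
    using closest_point_in_set[of "cball 0 m" "g j x"] m by (auto simp: c_def)
  have clim: "(\<lambda>j. c j x) \<longlonglongrightarrow> h x" if "x \<notin> N" for x
  proof -
    have "(\<lambda>j. closest_point (cball 0 m) (g j x)) \<longlonglongrightarrow> closest_point (cball 0 m) (h x)"
      by (rule isCont_tendsto_compose[OF _ g(2)[OF that]])
        (rule continuous_at_closest_point, use m in auto)
    then show ?thesis using hm[of x] by (simp add: c_def closest_point_self)
  qed
  have "\<exists>P. polynomial_function P \<and> (\<forall>x\<in>cball 0 R. norm (c j x - P x) < 1 / Suc j)" for j
    by (rule Stone_Weierstrass_polynomial_function) (auto intro: continuous_on_subset[OF c])
  then obtain P where P: "\<And>j. polynomial_function (P j)"
    "\<And>j x. x \<in> cball 0 R \<Longrightarrow> norm (c j x - P j x) < 1 / Suc j" by metis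
  define \<phi> where "\<phi> j x = ?\<chi> x * P j x" for j x
  have \<phi>: "\<phi> j \<in> test_functions" for j
  proof -
    have "C_k k (\<phi> j)" for k
      unfolding \<phi>_def by (intro C_k_mult C_k_bump C_k_polynomial_function P)
    moreover have "compact (supp (\<phi> j))"
      by (rule compact_suppI[where S="cball 0 R"]) (auto simp: \<phi>_def \<chi>0)
    ultimately show ?thesis by (simp add: test_functions_def)
  qed
  have \<phi>m: "\<phi> j \<in> borel_measurable lebesgue" for j
    using test_function_borel[OF \<phi>[of j]] by (intro measurable_completion) simp
  have ge: "R \<le> norm x \<Longrightarrow> u x = 0" for x using supp[of x] by force
  have "(\<lambda>j. Lp_norm (ennreal p) (\<lambda>x. \<phi> j x - u x)) \<longlonglongrightarrow> 0"
  proof (rule Lp_norm_tendsto_0[where w="\<lambda>x. (2 * m + 1) powr p * indicator (cball 0 R) x"])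
    show "norm (\<phi> j x - u x) powr p \<le> (2 * m + 1) powr p * indicator (cball 0 R) x" for j x
    proof (cases "norm x \<le> R")
      case True
      have "norm (P j x - h x) \<le> norm (c j x) + norm (h x) + norm (c j x - P j x)"
        by norm
      also have "\<dots> \<le> m + m + 1"
      proof (intro add_mono cm hm)
        have "norm (c j x - P j x) < 1 / Suc j" using True by (intro P) auto
        also have "\<dots> \<le> 1" by simp
        finally show "norm (c j x - P j x) \<le> 1" by simp
      qed
      finally have "norm (\<phi> j x - u x) \<le> 1 * (2 * m + 1)"
        unfolding hu[symmetric] \<phi>_def right_diff_distrib[symmetric] norm_mult
        using \<chi>1 by (intro mult_mono) auto
      then show ?thesis using True p by (auto intro!: powr_mono2)
    qed (simp add: \<phi>_def \<chi>0 ge)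
    have "(\<integral>\<^sup>+ x. ennreal ((2 * m + 1) powr p * indicator (cball (0::real^'n) R) x) \<partial>lebesgue) =
      (\<integral>\<^sup>+ x. ennreal ((2 * m + 1) powr p) * indicator (cball (0::real^'n) R) x \<partial>lebesgue)"
      by (intro nn_integral_cong) (auto split: split_indicator)
    also have "\<dots> < \<infinity>"
      using emeasure_lborel_cball_finite[of "0::real^'n" R]
      by (subst nn_integral_cmult_indicator) (auto simp: ennreal_mult_less_top)
    finally show "(\<integral>\<^sup>+ (x::real^'n). ennreal ((2 * m + 1) powr p * indicator (cball 0 R) x) \<partial>lebesgue) < \<infinity>" .
    show "AE x in lebesgue. (\<lambda>j. \<phi> j x - u x) \<longlonglongrightarrow> 0"
    proof (rule AE_I')
      show "N \<in> null_sets lebesgue" using N by (simp add: negligible_iff_null_sets)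
      show "{x \<in> space lebesgue. \<not> (\<lambda>j. \<phi> j x - u x) \<longlonglongrightarrow> 0} \<subseteq> N"
      proof (clarify, rule ccontr)
        fix x assume x: "\<not> (\<lambda>j. \<phi> j x - u x) \<longlonglongrightarrow> 0" "x \<notin> N"
        show False
        proof (cases "norm x \<le> R")
          case True
          have "(\<lambda>j. c j x - P j x) \<longlonglongrightarrow> 0"
          proof (rule Lim_null_comparison)
            show "eventually (\<lambda>j. norm (c j x - P j x) \<le> 1 / Suc j) sequentially"
              using P(2)[of x] True by (auto intro!: always_eventually less_imp_le)
            show "(\<lambda>j. 1 / real (Suc j)) \<longlonglongrightarrow> 0"
              using LIMSEQ_inverse_real_of_nat by (simp add: inverse_eq_divide)
          qed
          from tendsto_diff[OF clim[OF x(2)] this] have "(\<lambda>j. P j x) \<longlonglongrightarrow> h x" by simp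
          then have "(\<lambda>j. ?\<chi> x * P j x - u x) \<longlonglongrightarrow> ?\<chi> x * h x - u x"
            by (intro tendsto_intros)
          then show False using x(1) hu by (simp add: \<phi>_def)
        qed (use x(1) in \<open>simp add: \<phi>_def \<chi>0 ge\<close>)
      qed
    qed
    show "(\<lambda>x. \<phi> j x - u x) \<in> borel_measurable lebesgue" for j
      using \<phi>m[of j] u by (rule borel_measurable_diff)
    show "(\<lambda>x. (2 * m + 1) powr p * indicator (cball 0 R) x) \<in> borel_measurable lebesgue"
      by (intro borel_measurable_times borel_measurable_const borel_measurable_indicator) simp
  qed (fact p)
  with \<phi> show ?thesis by blast
qed

lemma test_functions_dense:
  fixes f :: "real ^ 'n \<Rightarrow> complex"
  assumes f: "f \<in> Lp (ennreal p)" and p: "1 \<le> p" and e: "0 < (e::real)"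
  shows "\<exists>\<phi>\<in>test_functions. Lp_norm (ennreal p) (\<lambda>x. \<phi> x - f x) < ennreal e"
proof -
  have [measurable]: "f \<in> borel_measurable lebesgue" using f by (rule Lp_measurable)
  \<comment> \<open>The condition on the cutoff gives
    \<open>norm (u j x) \<le> 2 * Suc j * bump 1 (Suc j) x\<close>, the domination required above.
    For fixed x the cutoff tends to 1 as its radius grows, so each x is eventually retained.\<close>
  let ?A = "\<lambda>j x. norm x < Suc j \<and> 1/2 \<le> bump 1 (Suc j) x \<and> norm (f x) \<le> Suc j"
  define u where "u j x = (if ?A j x then f x else 0)" for j :: nat and x
  have \<chi>m [measurable]: "bump 1 R \<in> borel_measurable borel" for R
  proof -
    have "continuous_on UNIV (\<lambda>x. Re (complex_of_real (bump 1 R x)))"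
      using C_k_bump[of 0 1 R] by (intro continuous_intros) simp
    then show ?thesis by (intro borel_measurable_continuous_onI) simp
  qed
  then have \<chi>m' [measurable]: "bump 1 R \<in> borel_measurable (lebesgue :: (real^'n) measure)" for R
    by (intro measurable_completion) simp
  have [measurable]: "(\<lambda>x::real^'n. x) \<in> borel_measurable lebesgue"
    by (intro measurable_completion) simp
  have um [measurable]: "u j \<in> borel_measurable lebesgue" for j
    unfolding u_def by measurable
  have "(\<lambda>j. Lp_norm (ennreal p) (\<lambda>x. u j x - f x)) \<longlonglongrightarrow> 0"
  proof (rule Lp_norm_tendsto_0[where w="\<lambda>x. norm (f x) powr p"])
    show "norm (u j x - f x) powr p \<le> norm (f x) powr p" for j x
      by (simp add: u_def)
    show "(\<integral>\<^sup>+ x. ennreal (norm (f x) powr p) \<partial>lebesgue) < \<infinity>"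
      using f p by (simp add: Lp_iff)
    show "AE x in lebesgue. (\<lambda>j. u j x - f x) \<longlonglongrightarrow> 0"
    proof (rule AE_I2)
      fix x :: "real ^ 'n"
      have *: "eventually (\<lambda>j. a < real (Suc j)) sequentially" for a
        using filterlim_compose[OF filterlim_real_sequentially filterlim_Suc]
        by (simp add: filterlim_at_top_dense)
      have "(\<lambda>j. exp (- (1 / ((real (Suc j))\<^sup>2 - x \<bullet> x)))) \<longlonglongrightarrow> 1"
      proof -
        have "filterlim (\<lambda>j. (real (Suc j))\<^sup>2 - x \<bullet> x) at_top sequentially"
          by real_asymp
        then have "(\<lambda>j. inverse ((real (Suc j))\<^sup>2 - x \<bullet> x)) \<longlonglongrightarrow> 0"
          by (rule tendsto_inverse_0_at_top)
        then have "(\<lambda>j. exp (- inverse ((real (Suc j))\<^sup>2 - x \<bullet> x))) \<longlonglongrightarrow> exp (- 0)"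
          by (intro tendsto_intros)
        then show ?thesis by (simp add: inverse_eq_divide)
      qed
      then have "eventually (\<lambda>j. 1/2 < exp (- (1 / ((real (Suc j))\<^sup>2 - x \<bullet> x)))) sequentially"
        by (rule order_tendstoD) simp
      then have "eventually (\<lambda>j. u j x - f x = 0) sequentially"
        using *[of "norm x"] *[of "norm (f x)"]
      proof eventually_elim
        case (elim j)
        have "(norm x)\<^sup>2 < (real (Suc j))\<^sup>2" using elim(2) by (intro power_strict_mono) auto
        then have "bump 1 (Suc j) x = exp (- (1 / ((real (Suc j))\<^sup>2 - x \<bullet> x)))"
          by (simp add: bump_def flat_exp_def dot_square_norm)
        then show ?case using elim by (simp add: u_def)
      qed
      then show "(\<lambda>j. u j x - f x) \<longlonglongrightarrow> 0" by (rule tendsto_eventually)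
    qed
  qed (use p in auto)
  \<comment> \<open>Two errors of size e / 4 add up to e under the quasi-triangle inequality with
    factor 2.\<close>
  moreover have e4: "0 < ennreal (e / 4)" using e by simp
  ultimately have "eventually (\<lambda>j. Lp_norm (ennreal p) (\<lambda>x. u j x - f x) < ennreal (e / 4)) sequentially"
    by (rule order_tendstoD)
  then obtain j where j: "Lp_norm (ennreal p) (\<lambda>x. u j x - f x) < ennreal (e / 4)"
    by (auto simp: eventually_sequentially)
  have "\<exists>\<phi>. (\<forall>i. \<phi> i \<in> test_functions) \<and> (\<lambda>i. Lp_norm (ennreal p) (\<lambda>x. \<phi> i x - u j x)) \<longlonglongrightarrow> 0"
  proof (rule test_functions_dense_bounded[OF um, of "2 * Suc j" p "Suc j"])
    fix x assume ux: "u j x \<noteq> 0"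
    then have "?A j x" and "u j x = f x" by (auto simp: u_def split: if_splits)
    moreover from \<open>?A j x\<close> have "1/2 \<le> bump 1 (real (Suc j)) x" by blast
    then have "2 * real (Suc j) * (1/2) \<le> 2 * real (Suc j) * bump 1 (real (Suc j)) x"
      by (intro mult_left_mono) auto
    then have "real (Suc j) \<le> 2 * real (Suc j) * bump 1 (real (Suc j)) x"
      by (simp only: mult.commute[of _ "1/2"] mult.assoc[symmetric]) simp
    ultimately show "norm x < real (Suc j) \<and> norm (u j x) \<le> real (2 * Suc j) * bump 1 (real (Suc j)) x"
      by auto
  qed (use p in auto)
  then obtain \<phi> where \<phi>: "\<And>i. \<phi> i \<in> test_functions"
    "(\<lambda>i. Lp_norm (ennreal p) (\<lambda>x. \<phi> i x - u j x)) \<longlonglongrightarrow> 0" by blast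
  have "eventually (\<lambda>i. Lp_norm (ennreal p) (\<lambda>x. \<phi> i x - u j x) < ennreal (e / 4)) sequentially"
    using \<phi>(2) e4 by (rule order_tendstoD)
  then obtain i where i: "Lp_norm (ennreal p) (\<lambda>x. \<phi> i x - u j x) < ennreal (e / 4)"
    by (auto simp: eventually_sequentially)
  have [measurable]: "\<phi> i \<in> borel_measurable lebesgue"
    using test_function_borel[OF \<phi>(1)[of i]] by (intro measurable_completion) simp
  have "Lp_norm (ennreal p) (\<lambda>x. (\<phi> i x - u j x) + (u j x - f x)) \<le>
     2 * (Lp_norm (ennreal p) (\<lambda>x. \<phi> i x - u j x) + Lp_norm (ennreal p) (\<lambda>x. u j x - f x))"
    by (rule Lp_norm_add_le) (use p in auto)
  also have "\<dots> < 2 * (ennreal (e / 4) + ennreal (e / 4))"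
    using i j by (intro ennreal_mult_strict_left_mono add_strict_mono) auto
  also have "\<dots> = ennreal e"
    using e by (simp flip: ennreal_plus ennreal_numeral ennreal_mult)
  finally show ?thesis using \<phi>(1)[of i] by (intro bexI[of _ "\<phi> i"]) auto
qed

subsection \<open>Extension by density\<close>

lemma Lp_norm_minus_commute: "Lp_norm p (\<lambda>x. f x - g x) = Lp_norm p (\<lambda>x. g x - f x)"
  by (simp add: Lp_norm_def norm_minus_commute)

lemma weak_Lp_norm_minus_commute: "weak_Lp_norm q (\<lambda>x. f x - g x) = weak_Lp_norm q (\<lambda>x. g x - f x)"
  by (simp add: weak_Lp_norm_def norm_minus_commute)

lemma Lp_norm_triangle:
  fixes f g h :: "real ^ 'n \<Rightarrow> complex"
  assumes "f \<in> borel_measurable lebesgue" "g \<in> borel_measurable lebesgue" "h \<in> borel_measurable lebesgue" "1 \<le> p"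
  shows "Lp_norm (ennreal p) (\<lambda>x. f x - h x) \<le>
    2 * (Lp_norm (ennreal p) (\<lambda>x. f x - g x) + Lp_norm (ennreal p) (\<lambda>x. g x - h x))"
  using Lp_norm_add_le[of "\<lambda>x. f x - g x" "\<lambda>x. g x - h x" p] assms by simp

lemma weak_Lp_norm_triangle:
  fixes f g h :: "real ^ 'n \<Rightarrow> complex"
  assumes "f \<in> borel_measurable lebesgue" "g \<in> borel_measurable lebesgue" "h \<in> borel_measurable lebesgue" "1 \<le> q"
  shows "weak_Lp_norm q (\<lambda>x. f x - h x) \<le>
    2 * (weak_Lp_norm q (\<lambda>x. f x - g x) + weak_Lp_norm q (\<lambda>x. g x - h x))"
  using weak_Lp_norm_add_le[of "\<lambda>x. f x - g x" "\<lambda>x. g x - h x" q] assms by simp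

lemma ennreal_tendsto_0_le:
  fixes a b :: "nat \<Rightarrow> ennreal"
  assumes "b \<longlonglongrightarrow> 0" "\<And>k. a k \<le> b k"
  shows "a \<longlonglongrightarrow> 0"
  by (rule tendsto_sandwich[OF _ _ tendsto_const assms(1)]) (use assms(2) in auto)

lemma ennreal_tendsto_0_bound:
  fixes a b :: "nat \<Rightarrow> ennreal"
  assumes "a \<longlonglongrightarrow> 0" "b \<longlonglongrightarrow> 0" "\<And>k. c k \<le> 2 * (a k + b k)"
  shows "c \<longlonglongrightarrow> 0"
proof (rule ennreal_tendsto_0_le[OF _ assms(3)])
  have "(\<lambda>k. 2 * (a k + b k)) \<longlonglongrightarrow> 2 * (0 + 0)"
    by (intro ennreal_tendsto_cmult tendsto_add assms) auto
  then show "(\<lambda>k. 2 * (a k + b k)) \<longlonglongrightarrow> 0" by simp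
qed

lemma ae_linear_operatorD:
  assumes "ae_linear_operator D T"
  shows "\<forall>f\<in>D. T f \<in> borel_measurable lebesgue"
    and "\<forall>f\<in>D. \<forall>g\<in>borel_measurable lebesgue.
        (AE x in lebesgue. f x = g x) \<longrightarrow> g \<in> D \<and> (AE x in lebesgue. T f x = T g x)"
    and "\<forall>f\<in>D. \<forall>g\<in>D. (\<lambda>x. f x + g x) \<in> D \<and>
        (AE x in lebesgue. T (\<lambda>x. f x + g x) x = T f x + T g x)"
    and "\<forall>c. \<forall>f\<in>D. (\<lambda>x. c * f x) \<in> D \<and>
        (AE x in lebesgue. T (\<lambda>x. c * f x) x = c * T f x)"
  using assms unfolding ae_linear_operator_def by - (elim conjE; assumption)+

context
  fixes q M :: real and D :: "(real ^ 'n \<Rightarrow> complex) set" and T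
  assumes q: "1 \<le> q" and M: "0 \<le> M"
    and lin: "ae_linear_operator D T" and test: "test_functions \<subseteq> D"
    and bound: "\<And>\<phi>. \<phi> \<in> test_functions \<Longrightarrow> weak_Lp_norm q (T \<phi>) \<le> ennreal M * Lp_norm (ennreal q) \<phi>"
begin

lemma T_measurable: "\<phi> \<in> test_functions \<Longrightarrow> T \<phi> \<in> borel_measurable lebesgue"
  using ae_linear_operatorD(1)[OF lin] test by blast

lemma T_add: "\<phi> \<in> test_functions \<Longrightarrow> \<psi> \<in> test_functions \<Longrightarrow>
    AE x in lebesgue. T (\<lambda>x. \<phi> x + \<psi> x) x = T \<phi> x + T \<psi> x"
  using bspec[OF bspec[OF ae_linear_operatorD(3)[OF lin]]] test by blast

lemma T_cmult: "\<phi> \<in> test_functions \<Longrightarrow> AE x in lebesgue. T (\<lambda>x. c * \<phi> x) x = c * T \<phi> x"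
  using bspec[OF spec[OF ae_linear_operatorD(4)[OF lin]]] test by blast

lemma T_diff:
  assumes "\<phi> \<in> test_functions" "\<psi> \<in> test_functions"
  shows "AE x in lebesgue. T (\<lambda>x. \<phi> x - \<psi> x) x = T \<phi> x - T \<psi> x"
  using T_add[OF assms(1) test_function_cmult[OF assms(2), of "-1"]] T_cmult[OF assms(2), of "-1"]
  by eventually_elim simp

lemma test_measurable: "\<phi> \<in> test_functions \<Longrightarrow> \<phi> \<in> borel_measurable lebesgue"
  using test_function_borel by (intro measurable_completion) simp

lemma weak_T_diff_le:
  assumes "\<phi> \<in> test_functions" "\<psi> \<in> test_functions"
  shows "weak_Lp_norm q (\<lambda>x. T \<phi> x - T \<psi> x) \<le> ennreal M * Lp_norm (ennreal q) (\<lambda>x. \<phi> x - \<psi> x)"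
proof -
  have "weak_Lp_norm q (\<lambda>x. T \<phi> x - T \<psi> x) = weak_Lp_norm q (T (\<lambda>x. \<phi> x - \<psi> x))"
    using T_diff[OF assms] T_measurable assms test_function_diff[OF assms]
    by (intro weak_Lp_norm_cong_AE) (auto simp: eq_commute)
  then show ?thesis using bound[OF test_function_diff[OF assms]] by simp
qed

text \<open>A relation, since h is determined only almost everywhere. One approximating sequence is
  demanded; that every sequence has the same limit is a consequence of the bound on T.\<close>

definition limit_of :: "(real ^ 'n \<Rightarrow> complex) \<Rightarrow> (real ^ 'n \<Rightarrow> complex) \<Rightarrow> bool" where
  "limit_of f h \<longleftrightarrow> h \<in> borel_measurable lebesgue \<and> (\<exists>\<phi>. (\<forall>k. \<phi> k \<in> test_functions) \<and>
      (\<lambda>k::nat. Lp_norm (ennreal q) (\<lambda>x. \<phi> k x - f x)) \<longlonglongrightarrow> 0 \<and>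
      (\<lambda>k. weak_Lp_norm q (\<lambda>x. T (\<phi> k) x - h x)) \<longlonglongrightarrow> 0)"

text \<open>Two sequences approximating f differ by test functions tending to 0 in
  \<open>L^q\<close>, so the bound forces their images together in weak \<open>L^q\<close>.\<close>

lemma limit_of_any_sequence:
  assumes f: "f \<in> borel_measurable lebesgue" and "limit_of f h" and \<psi>: "\<And>k::nat. \<psi> k \<in> test_functions"
    and conv: "(\<lambda>k. Lp_norm (ennreal q) (\<lambda>x. \<psi> k x - f x)) \<longlonglongrightarrow> 0"
  shows "(\<lambda>k. weak_Lp_norm q (\<lambda>x. T (\<psi> k) x - h x)) \<longlonglongrightarrow> 0"
proof -
  obtain \<phi> where h: "h \<in> borel_measurable lebesgue" and \<phi>: "\<And>k::nat. \<phi> k \<in> test_functions"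
    "(\<lambda>k. Lp_norm (ennreal q) (\<lambda>x. \<phi> k x - f x)) \<longlonglongrightarrow> 0"
    "(\<lambda>k. weak_Lp_norm q (\<lambda>x. T (\<phi> k) x - h x)) \<longlonglongrightarrow> 0"
    using assms(2) by (auto simp: limit_of_def)
  have *: "(\<lambda>k. Lp_norm (ennreal q) (\<lambda>x. \<psi> k x - \<phi> k x)) \<longlonglongrightarrow> 0"
  proof (rule ennreal_tendsto_0_bound[OF conv \<phi>(2)])
    show "Lp_norm (ennreal q) (\<lambda>x. \<psi> k x - \<phi> k x) \<le>
      2 * (Lp_norm (ennreal q) (\<lambda>x. \<psi> k x - f x) + Lp_norm (ennreal q) (\<lambda>x. \<phi> k x - f x))" for k
      using Lp_norm_triangle[OF test_measurable[OF \<psi>[of k]] f test_measurable[OF \<phi>(1)[of k]] q]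
      by (simp add: Lp_norm_minus_commute[of _ f])
  qed
  have "(\<lambda>k. ennreal M * Lp_norm (ennreal q) (\<lambda>x. \<psi> k x - \<phi> k x)) \<longlonglongrightarrow> ennreal M * 0"
    by (intro ennreal_tendsto_cmult *) auto
  then have "(\<lambda>k. weak_Lp_norm q (\<lambda>x. T (\<psi> k) x - T (\<phi> k) x)) \<longlonglongrightarrow> 0"
    unfolding mult_zero_right by (rule ennreal_tendsto_0_le) (rule weak_T_diff_le[OF \<psi> \<phi>(1)])
  then show ?thesis
    using \<phi>(3) by (rule ennreal_tendsto_0_bound)
      (intro weak_Lp_norm_triangle T_measurable \<psi> \<phi>(1) h q)
qed

lemma limit_of_unique:
  assumes f: "f \<in> borel_measurable lebesgue" and h: "limit_of f h" "limit_of f k"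
  shows "AE x in lebesgue. h x = k x"
proof -
  have m: "h \<in> borel_measurable lebesgue" "k \<in> borel_measurable lebesgue"
    using h by (auto simp: limit_of_def)
  obtain \<phi> where \<phi>: "\<And>j::nat. \<phi> j \<in> test_functions"
    "(\<lambda>j. Lp_norm (ennreal q) (\<lambda>x. \<phi> j x - f x)) \<longlonglongrightarrow> 0"
    using h(1) by (auto simp: limit_of_def)
  have "(\<lambda>j::nat. weak_Lp_norm q (\<lambda>x. h x - k x)) \<longlonglongrightarrow> 0"
  proof (rule ennreal_tendsto_0_bound[OF limit_of_any_sequence[OF f h(1) \<phi>] limit_of_any_sequence[OF f h(2) \<phi>]])
    show "weak_Lp_norm q (\<lambda>x. h x - k x) \<le> 2 * (weak_Lp_norm q (\<lambda>x. T (\<phi> j) x - h x) + weak_Lp_norm q (\<lambda>x. T (\<phi> j) x - k x))" for j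
      using weak_Lp_norm_triangle[OF m(1) T_measurable[OF \<phi>(1)] m(2) q, of j]
      by (simp add: weak_Lp_norm_minus_commute[of _ h])
  qed
  then have "weak_Lp_norm q (\<lambda>x. h x - k x) = 0"
    by (simp add: LIMSEQ_const_iff)
  then have "AE x in lebesgue. h x - k x = 0"
    using m q by (intro weak_Lp_norm_eq_0_imp_AE) auto
  then show ?thesis by simp
qed

lemma limit_of_test: "\<phi> \<in> test_functions \<Longrightarrow> limit_of \<phi> (T \<phi>)"
  unfolding limit_of_def using q
  by (intro conjI T_measurable exI[of _ "\<lambda>_. \<phi>"])
     (auto simp: Lp_norm_ennreal weak_Lp_norm_def SUP_le_iff not_less)

lemma limit_of_add:
  assumes "limit_of f h" "limit_of g k" and m: "f \<in> borel_measurable lebesgue" "g \<in> borel_measurable lebesgue"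
  shows "limit_of (\<lambda>x. f x + g x) (\<lambda>x. h x + k x)"
proof -
  obtain \<phi> where h: "h \<in> borel_measurable lebesgue" and \<phi>: "\<And>k::nat. \<phi> k \<in> test_functions"
    "(\<lambda>k. Lp_norm (ennreal q) (\<lambda>x. \<phi> k x - f x)) \<longlonglongrightarrow> 0"
    "(\<lambda>k. weak_Lp_norm q (\<lambda>x. T (\<phi> k) x - h x)) \<longlonglongrightarrow> 0"
    using assms(1) by (auto simp: limit_of_def)
  obtain \<psi> where k: "k \<in> borel_measurable lebesgue" and \<psi>: "\<And>k::nat. \<psi> k \<in> test_functions"
    "(\<lambda>k. Lp_norm (ennreal q) (\<lambda>x. \<psi> k x - g x)) \<longlonglongrightarrow> 0"
    "(\<lambda>j. weak_Lp_norm q (\<lambda>x. T (\<psi> j) x - k x)) \<longlonglongrightarrow> 0"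
    using assms(2) by (auto simp: limit_of_def)
  let ?\<xi> = "\<lambda>j x. \<phi> j x + \<psi> j x"
  have \<xi>: "?\<xi> j \<in> test_functions" for j
    using \<phi> \<psi> by (intro test_function_add)
  have 1: "(\<lambda>j. Lp_norm (ennreal q) (\<lambda>x. ?\<xi> j x - (f x + g x))) \<longlonglongrightarrow> 0"
  proof (rule ennreal_tendsto_0_bound[OF \<phi>(2) \<psi>(2)])
    fix j
    have "Lp_norm (ennreal q) (\<lambda>x. (\<phi> j x - f x) + (\<psi> j x - g x)) \<le>
      2 * (Lp_norm (ennreal q) (\<lambda>x. \<phi> j x - f x) + Lp_norm (ennreal q) (\<lambda>x. \<psi> j x - g x))"
      using test_measurable[OF \<phi>(1)[of j]] test_measurable[OF \<psi>(1)[of j]] m q by (intro Lp_norm_add_le) auto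
    then show "Lp_norm (ennreal q) (\<lambda>x. ?\<xi> j x - (f x + g x)) \<le>
      2 * (Lp_norm (ennreal q) (\<lambda>x. \<phi> j x - f x) + Lp_norm (ennreal q) (\<lambda>x. \<psi> j x - g x))"
      by (simp add: algebra_simps)
  qed
  have 2: "(\<lambda>j. weak_Lp_norm q (\<lambda>x. T (?\<xi> j) x - (h x + k x))) \<longlonglongrightarrow> 0"
  proof (rule ennreal_tendsto_0_bound[OF \<phi>(3) \<psi>(3)])
    fix j
    have "weak_Lp_norm q (\<lambda>x. T (?\<xi> j) x - (h x + k x)) =
        weak_Lp_norm q (\<lambda>x. (T (\<phi> j) x - h x) + (T (\<psi> j) x - k x))"
    proof (rule weak_Lp_norm_cong_AE)
      show "AE x in lebesgue. T (?\<xi> j) x - (h x + k x) = (T (\<phi> j) x - h x) + (T (\<psi> j) x - k x)"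
        using T_add[OF \<phi>(1) \<psi>(1), of j j] by eventually_elim simp
    qed (use T_measurable[OF \<phi>(1)[of j]] T_measurable[OF \<psi>(1)[of j]] T_measurable[OF \<xi>[of j]] h k in auto)
    also have "\<dots> \<le> 2 * (weak_Lp_norm q (\<lambda>x. T (\<phi> j) x - h x) + weak_Lp_norm q (\<lambda>x. T (\<psi> j) x - k x))"
      using T_measurable[OF \<phi>(1)[of j]] T_measurable[OF \<psi>(1)[of j]] h k q by (intro weak_Lp_norm_add_le) auto
    finally show "weak_Lp_norm q (\<lambda>x. T (?\<xi> j) x - (h x + k x)) \<le> \<dots>" .
  qed
  show ?thesis
    unfolding limit_of_def
    by (intro conjI exI[of _ ?\<xi>]) (rule borel_measurable_add allI \<xi> 1 2 h k)+
qed

lemma limit_of_cmult: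
  assumes "limit_of f h" and m: "f \<in> borel_measurable lebesgue"
  shows "limit_of (\<lambda>x. c * f x) (\<lambda>x. c * h x)"
proof -
  obtain \<phi> where h: "h \<in> borel_measurable lebesgue" and \<phi>: "\<And>k::nat. \<phi> k \<in> test_functions"
    "(\<lambda>k. Lp_norm (ennreal q) (\<lambda>x. \<phi> k x - f x)) \<longlonglongrightarrow> 0"
    "(\<lambda>k. weak_Lp_norm q (\<lambda>x. T (\<phi> k) x - h x)) \<longlonglongrightarrow> 0"
    using assms(1) by (auto simp: limit_of_def)
  let ?\<xi> = "\<lambda>j x. c * \<phi> j x"
  have \<xi>: "?\<xi> j \<in> test_functions" for j
    using \<phi> by (intro test_function_cmult)
  have "Lp_norm (ennreal q) (\<lambda>x. ?\<xi> j x - c * f x) = ennreal (norm c) * Lp_norm (ennreal q) (\<lambda>x. \<phi> j x - f x)" for j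
    using Lp_norm_cmult[of "\<lambda>x. \<phi> j x - f x" q c] test_measurable[OF \<phi>(1)] m q by (simp add: right_diff_distrib)
  moreover have "(\<lambda>j. ennreal (norm c) * Lp_norm (ennreal q) (\<lambda>x. \<phi> j x - f x)) \<longlonglongrightarrow> ennreal (norm c) * 0"
    by (intro ennreal_tendsto_cmult \<phi>(2)) auto
  ultimately have 1: "(\<lambda>j. Lp_norm (ennreal q) (\<lambda>x. ?\<xi> j x - c * f x)) \<longlonglongrightarrow> 0" by simp
  have le: "weak_Lp_norm q (\<lambda>x. T (?\<xi> j) x - c * h x) \<le> ennreal (norm c) * weak_Lp_norm q (\<lambda>x. T (\<phi> j) x - h x)" for j
  proof -
    have "weak_Lp_norm q (\<lambda>x. T (?\<xi> j) x - c * h x) = weak_Lp_norm q (\<lambda>x. c * (T (\<phi> j) x - h x))"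
    proof (rule weak_Lp_norm_cong_AE)
      show "AE x in lebesgue. T (?\<xi> j) x - c * h x = c * (T (\<phi> j) x - h x)"
        using T_cmult[OF \<phi>(1), of c j] by eventually_elim (simp add: right_diff_distrib)
    qed (use T_measurable[OF \<phi>(1)[of j]] T_measurable[OF \<xi>[of j]] h in auto)
    then show ?thesis using weak_Lp_norm_cmult_le[OF q] by simp
  qed
  have "(\<lambda>j. ennreal (norm c) * weak_Lp_norm q (\<lambda>x. T (\<phi> j) x - h x)) \<longlonglongrightarrow> ennreal (norm c) * 0"
    by (intro ennreal_tendsto_cmult \<phi>(3)) auto
  then have 2: "(\<lambda>j. weak_Lp_norm q (\<lambda>x. T (?\<xi> j) x - c * h x)) \<longlonglongrightarrow> 0"
    unfolding mult_zero_right by (rule ennreal_tendsto_0_le) (rule le)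
  show ?thesis
    unfolding limit_of_def
    by (intro conjI exI[of _ ?\<xi>]) (rule borel_measurable_times allI \<xi> 1 2 borel_measurable_const h)+
qed

lemma limit_of_cong_AE:
  assumes "limit_of f h" "AE x in lebesgue. f x = g x"
  shows "limit_of g h"
proof -
  have "Lp_norm (ennreal q) (\<lambda>x. \<phi> x - f x) = Lp_norm (ennreal q) (\<lambda>x. \<phi> x - g x)" for \<phi>
    using assms(2) q by (intro Lp_norm_cong_AE) auto
  then show ?thesis using assms(1) by (simp add: limit_of_def)
qed

text \<open>This is completeness of weak \<open>L^q\<close> along a fast sequence. Errors of order
  \<open>4^-k\<close> measured at levels \<open>2^-k\<close> leave exceptional sets of measure at
  most \<open>(4 * M) powr q * ((1/2) powr q) ^ k\<close>. These are summable, so Borel-Cantelli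
  gives pointwise convergence a.e., and the Fatou property upgrades it to convergence in weak
  \<open>L^q\<close>.\<close>

lemma limit_of_exists:
  assumes f: "f \<in> Lp (ennreal q)"
  shows "\<exists>h. limit_of f h"
proof -
  have fm: "f \<in> borel_measurable lebesgue" using f by (rule Lp_measurable)
  have "\<exists>\<phi>\<in>test_functions. Lp_norm (ennreal q) (\<lambda>x. \<phi> x - f x) < ennreal ((1/4) ^ k)" for k :: nat
    using test_functions_dense[OF f q] by simp
  then obtain \<phi> where \<phi>: "\<And>k. \<phi> k \<in> test_functions"
    "\<And>k. Lp_norm (ennreal q) (\<lambda>x. \<phi> k x - f x) < ennreal ((1/4) ^ k)" by metis
  have Tm [measurable]: "T (\<phi> k) \<in> borel_measurable lebesgue" for k using \<phi>(1) by (rule T_measurable)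
  have cauchy: "weak_Lp_norm q (\<lambda>x. T (\<phi> k) x - T (\<phi> (k + j)) x) \<le> ennreal (4 * M * (1/4) ^ k)" for k j
  proof -
    have "weak_Lp_norm q (\<lambda>x. T (\<phi> k) x - T (\<phi> (k + j)) x) \<le> ennreal M * Lp_norm (ennreal q) (\<lambda>x. \<phi> k x - \<phi> (k + j) x)"
      by (rule weak_T_diff_le[OF \<phi>(1) \<phi>(1)])
    also have "\<dots> \<le> ennreal M * (2 * (Lp_norm (ennreal q) (\<lambda>x. \<phi> k x - f x) + Lp_norm (ennreal q) (\<lambda>x. \<phi> (k + j) x - f x)))"
      using Lp_norm_triangle[of "\<phi> k" f "\<phi> (k + j)" q] fm test_measurable[OF \<phi>(1)] q
      by (intro mult_left_mono) (simp_all add: Lp_norm_minus_commute[of _ f])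
    also have "\<dots> \<le> ennreal M * (2 * (ennreal ((1/4) ^ k) + ennreal ((1/4) ^ k)))"
    proof (intro mult_left_mono add_mono)
      have "Lp_norm (ennreal q) (\<lambda>x. \<phi> (k + j) x - f x) \<le> ennreal ((1/4) ^ (k + j))"
        using \<phi>(2) by (rule less_imp_le)
      also have "\<dots> \<le> ennreal ((1/4) ^ k)"
        by (intro ennreal_leI power_decreasing) auto
      finally show "Lp_norm (ennreal q) (\<lambda>x. \<phi> (k + j) x - f x) \<le> ennreal ((1/4) ^ k)" .
    qed (use \<phi>(2)[of k] in auto)
    also have "\<dots> = ennreal (4 * M * (1/4) ^ k)"
      using M by (simp flip: ennreal_plus ennreal_numeral ennreal_mult)
    finally show ?thesis .
  qed
  have "AE x in lebesgue. eventually (\<lambda>k. x \<in> space lebesgue - {x. (1/2) ^ k < norm (T (\<phi> k) x - T (\<phi> (Suc k)) x)}) sequentially"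
  proof (rule borel_cantelli_AE1)
    have le: "emeasure lebesgue {x. (1/2) ^ k < norm (T (\<phi> k) x - T (\<phi> (Suc k)) x)} \<le> ennreal ((4 * M) powr q * ((1/2) powr q) ^ k)" for k
    proof -
      have "emeasure lebesgue {x. (1/2) ^ k < norm (T (\<phi> k) x - T (\<phi> (Suc k)) x)} \<le> ennreal ((4 * M * (1/4) ^ k / (1/2) ^ k) powr q)"
        using cauchy[of k 1] weak_Lp_norm_le_iff[OF q, of "4 * M * (1/4) ^ k" "\<lambda>x. T (\<phi> k) x - T (\<phi> (Suc k)) x"] M
        by simp
      also have "4 * M * (1/4) ^ k / (1/2) ^ k = 4 * M * (1/2) ^ k"
        by (simp add: field_simps flip: power_mult_distrib)
      also have "(4 * M * (1/2) ^ k) powr q = (4 * M) powr q * ((1/2) powr q) ^ k"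
        using M by (simp add: powr_mult powr_power powr_realpow[symmetric] powr_powr mult.commute)
      finally show ?thesis .
    qed
    show "{x. (1/2) ^ k < norm (T (\<phi> k) x - T (\<phi> (Suc k)) x)} \<in> sets lebesgue" for k
      by (intro superlevel_set_lebesgue) measurable
    show "emeasure lebesgue {x. (1/2) ^ k < norm (T (\<phi> k) x - T (\<phi> (Suc k)) x)} < \<infinity>" for k
      using le[of k] by (rule order.strict_trans1) simp
    show "summable (\<lambda>k. measure lebesgue {x. (1/2) ^ k < norm (T (\<phi> k) x - T (\<phi> (Suc k)) x)})"
    proof (rule summable_comparison_test')
      have "(1/2::real) powr q < 1" using q powr_less_mono2[of q "1/2" 1] by simp
      then show "summable (\<lambda>k. (4 * M) powr q * ((1/2) powr q) ^ k)"
        by (intro summable_mult summable_geometric) simp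
      show "norm (measure lebesgue {x. (1/2) ^ k < norm (T (\<phi> k) x - T (\<phi> (Suc k)) x)}) \<le> (4 * M) powr q * ((1/2) powr q) ^ k" for k
        using le[of k] by (simp add: measure_def enn2real_leI)
    qed
  qed
  then have conv: "AE x in lebesgue. convergent (\<lambda>k. T (\<phi> k) x)"
  proof eventually_elim
    case (elim x)
    then have ev: "eventually (\<lambda>k. norm (T (\<phi> (Suc k)) x - T (\<phi> k) x) \<le> (1/2) ^ k) sequentially"
      by eventually_elim (auto simp: not_less norm_minus_commute)
    have "summable (\<lambda>k. T (\<phi> (Suc k)) x - T (\<phi> k) x)"
      by (rule summable_comparison_test_ev[OF ev]) (simp add: summable_geometric)
    then have "convergent (\<lambda>n. (\<Sum>k<n. T (\<phi> (Suc k)) x - T (\<phi> k) x) + T (\<phi> 0) x)"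
      by (intro convergent_add convergent_const) (simp add: summable_iff_convergent)
    moreover have "(\<lambda>n. (\<Sum>k<n. T (\<phi> (Suc k)) x - T (\<phi> k) x) + T (\<phi> 0) x) = (\<lambda>n. T (\<phi> n) x)"
      by (simp only: sum_lessThan_telescope[where f="\<lambda>k. T (\<phi> k) x"] diff_add_cancel)
    ultimately show ?case by (simp only:)
  qed
  \<comment> \<open>Where the sequence diverges the value is arbitrary, but that happens only on a
    null set.\<close>
  define h where "h x = lim (\<lambda>k. T (\<phi> k) x)" for x
  have h: "h \<in> borel_measurable lebesgue"
    unfolding h_def by (rule borel_measurable_lim_metric) (rule Tm)
  have wk: "weak_Lp_norm q (\<lambda>x. T (\<phi> k) x - h x) \<le> ennreal (4 * M * (1/4) ^ k)" for k
  proof (rule weak_Lp_norm_Fatou[OF _ _ _ cauchy[of k] q])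
    show "AE x in lebesgue. (\<lambda>j. T (\<phi> k) x - T (\<phi> (k + j)) x) \<longlonglongrightarrow> T (\<phi> k) x - h x"
      using conv
    proof eventually_elim
      case (elim x)
      then have "(\<lambda>j. T (\<phi> j) x) \<longlonglongrightarrow> h x" by (simp add: h_def convergent_LIMSEQ_iff)
      then have "(\<lambda>j. T (\<phi> (j + k)) x) \<longlonglongrightarrow> h x" by (rule LIMSEQ_ignore_initial_segment)
      then show ?case by (intro tendsto_intros) (simp add: add.commute)
    qed
  qed (use h in auto)
  have z: "(\<lambda>k. ennreal (c * (1/4) ^ k)) \<longlonglongrightarrow> 0" for c
  proof -
    have "(\<lambda>k. c * (1/4) ^ k) \<longlonglongrightarrow> c * 0" by (intro tendsto_intros LIMSEQ_realpow_zero) auto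
    then show ?thesis using tendsto_ennrealI by fastforce
  qed
  have "limit_of f h"
    unfolding limit_of_def
  proof (intro conjI exI[of _ \<phi>] allI \<phi>(1) h)
    show "(\<lambda>k. Lp_norm (ennreal q) (\<lambda>x. \<phi> k x - f x)) \<longlonglongrightarrow> 0"
      using less_imp_le[OF \<phi>(2)] by (intro ennreal_tendsto_0_le[OF z[of 1]]) simp
    show "(\<lambda>k. weak_Lp_norm q (\<lambda>x. T (\<phi> k) x - h x)) \<longlonglongrightarrow> 0"
      by (rule ennreal_tendsto_0_le[OF z[of "4 * M"] wk])
  qed
  then show ?thesis by blast
qed

text \<open>Choosing any limit for each f is harmless: limits are unique a.e. and compatible with
  sums, multiples and a.e. equality, which is all that linearity modulo null sets asks.\<close>

lemma density_extension_exists: "\<exists>S. density_extension q T S"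
proof -
  define S where "S f = (SOME h. limit_of f h)" for f
  have S: "limit_of f (S f)" if "f \<in> Lp (ennreal q)" for f
    unfolding S_def using limit_of_exists[OF that] by (rule someI_ex)
  have q': "1 \<le> ennreal q" using q by simp
  have "ae_linear_operator (Lp (ennreal q)) S"
    unfolding ae_linear_operator_def
  proof (intro conjI ballI allI impI)
    show "Lp (ennreal q) \<subseteq> borel_measurable lebesgue" using Lp_measurable by blast
    show "(\<lambda>x. 0) \<in> Lp (ennreal q)" using q by (simp add: Lp_iff)
  next
    fix f :: "real ^ 'n \<Rightarrow> complex" assume f: "f \<in> Lp (ennreal q)"
    note fm = Lp_measurable[OF f]
    show "S f \<in> borel_measurable lebesgue" using S[OF f] by (simp add: limit_of_def)
    show cf: "(\<lambda>x. c * f x) \<in> Lp (ennreal q)" for c using f q by (rule Lp_cmult)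
    show "AE x in lebesgue. S (\<lambda>x. c * f x) x = c * S f x" for c
      using fm by (intro limit_of_unique[OF _ S[OF cf] limit_of_cmult[OF S[OF f] fm]]) auto
    fix g :: "real ^ 'n \<Rightarrow> complex"
    {
      assume g: "g \<in> borel_measurable lebesgue" and eq: "AE x in lebesgue. f x = g x"
      show gL: "g \<in> Lp (ennreal q)"
        using f g Lp_norm_cong_AE[OF eq q] by (simp add: Lp_def)
      show "AE x in lebesgue. S f x = S g x"
        by (rule limit_of_unique[OF g limit_of_cong_AE[OF S[OF f] eq] S[OF gL]])
    }
    assume g: "g \<in> Lp (ennreal q)"
    show fg: "(\<lambda>x. f x + g x) \<in> Lp (ennreal q)" using f g q by (rule Lp_add)
    show "AE x in lebesgue. S (\<lambda>x. f x + g x) x = S f x + S g x"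
      by (rule limit_of_unique[OF Lp_measurable[OF fg] S[OF fg] limit_of_add[OF S[OF f] S[OF g] fm Lp_measurable[OF g]]])
  qed
  moreover have "AE x in lebesgue. S \<phi> x = T \<phi> x" if "\<phi> \<in> test_functions" for \<phi>
    by (rule limit_of_unique[OF test_measurable[OF that] S[OF test_function_Lp[OF that q']] limit_of_test[OF that]])
  ultimately show ?thesis
    unfolding density_extension_def
    by (intro exI[of _ S]) (blast intro: limit_of_any_sequence[OF Lp_measurable S])
qed

text \<open>The factor 4 comes from two quasi-triangle inequalities, one comparing
  \<open>S f\<close> with \<open>T (\<phi> k)\<close> in weak \<open>L^q\<close> and one comparing
  \<open>\<phi> k\<close> with f in \<open>L^q\<close>; the error terms vanish in the limit.\<close>

lemma density_extension_bound:
  assumes S: "density_extension q T S" and f: "f \<in> Lp (ennreal q)"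
  shows "weak_Lp_norm q (S f) \<le> ennreal (4 * M) * Lp_norm (ennreal q) f"
proof -
  have fm: "f \<in> borel_measurable lebesgue" using f by (rule Lp_measurable)
  have Sm: "S f \<in> borel_measurable lebesgue"
    using S f ae_linear_operatorD(1) unfolding density_extension_def by blast
  obtain h where "limit_of f h" using limit_of_exists[OF f] by blast
  then obtain \<phi> where \<phi>: "\<And>j::nat. \<phi> j \<in> test_functions"
    "(\<lambda>j. Lp_norm (ennreal q) (\<lambda>x. \<phi> j x - f x)) \<longlonglongrightarrow> 0"
    by (auto simp: limit_of_def)
  have wk: "(\<lambda>k. weak_Lp_norm q (\<lambda>x. T (\<phi> k) x - S f x)) \<longlonglongrightarrow> 0"
    using S f \<phi> unfolding density_extension_def by blast
  let ?b = "\<lambda>k. 2 * (ennreal M * (2 * (Lp_norm (ennreal q) (\<lambda>x. \<phi> k x - f x) + Lp_norm (ennreal q) f))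
       + weak_Lp_norm q (\<lambda>x. T (\<phi> k) x - S f x))"
  have "weak_Lp_norm q (S f) \<le> ?b k" for k
  proof -
    have "weak_Lp_norm q (\<lambda>x. T (\<phi> k) x + (S f x - T (\<phi> k) x)) \<le>
        2 * (weak_Lp_norm q (T (\<phi> k)) + weak_Lp_norm q (\<lambda>x. S f x - T (\<phi> k) x))"
      using T_measurable[OF \<phi>(1)] Sm q by (intro weak_Lp_norm_add_le) auto
    also have "weak_Lp_norm q (T (\<phi> k)) \<le> ennreal M * Lp_norm (ennreal q) (\<phi> k)"
      by (rule bound[OF \<phi>(1)])
    also have "Lp_norm (ennreal q) (\<phi> k) \<le> 2 * (Lp_norm (ennreal q) (\<lambda>x. \<phi> k x - f x) + Lp_norm (ennreal q) f)"
      using Lp_norm_add_le[of "\<lambda>x. \<phi> k x - f x" f q] test_measurable[OF \<phi>(1)] fm q by simp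
    finally show ?thesis
      by (simp add: mult_left_mono add_mono weak_Lp_norm_minus_commute[of _ "S f"])
  qed
  moreover have "?b \<longlonglongrightarrow> 2 * (ennreal M * (2 * (0 + Lp_norm (ennreal q) f)) + 0)"
    using wk \<phi>(2) by (intro ennreal_tendsto_cmult tendsto_add tendsto_const) auto
  ultimately have "weak_Lp_norm q (S f) \<le> 2 * (ennreal M * (2 * (0 + Lp_norm (ennreal q) f)) + 0)"
    by (intro LIMSEQ_le_const) auto
  also have "\<dots> = ennreal (4 * M) * Lp_norm (ennreal q) f"
    using M by (simp add: ennreal_mult algebra_simps)
  finally show ?thesis .
qed

end

subsection \<open>Calderon--Zygmund decomposition\<close>

text \<open>The half-open cell of the grid of mesh s that contains x, labelled by any of its points.
  Cells of one mesh partition the space, and halving the mesh refines the partition.\<close>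

definition dcube :: "real \<Rightarrow> real ^ 'n \<Rightarrow> (real ^ 'n) set" where
  "dcube s x = {y. \<forall>i. \<lfloor>y $ i / s\<rfloor> = \<lfloor>x $ i / s\<rfloor>}"

text \<open>The lower corner of the cell. It later serves as the base point c of the kernel
  estimate, which needs a ball containing the cube but no exact centre.\<close>

definition corner :: "real \<Rightarrow> real ^ 'n \<Rightarrow> real ^ 'n" where
  "corner s x = (\<chi> i. s * real_of_int \<lfloor>x $ i / s\<rfloor>)"

lemma mem_dcube [simp]: "x \<in> dcube s x"
  by (simp add: dcube_def)

lemma dcube_eq: "y \<in> dcube s x \<Longrightarrow> dcube s y = dcube s x"
  by (simp add: dcube_def)

lemma dcube_iff:
  assumes "0 < s"
  shows "y \<in> dcube s x \<longleftrightarrow> (\<forall>i. corner s x $ i \<le> y $ i \<and> y $ i < corner s x $ i + s)"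
proof -
  have "\<lfloor>a / s\<rfloor> = m \<longleftrightarrow> s * real_of_int m \<le> a \<and> a < s * real_of_int m + s" for a m
    using assms by (auto simp: floor_eq_iff field_simps)
  then show ?thesis by (simp add: dcube_def corner_def)
qed

lemma dcube_borel:
  assumes "0 < s"
  shows "dcube s x \<in> sets borel"
proof -
  have "dcube s x = (\<Inter>i. {y. corner s x $ i \<le> y $ i} \<inter> {y. y $ i < corner s x $ i + s})"
    using assms by (auto simp: dcube_iff)
  also have "\<dots> \<in> sets borel"
    by (intro sets.countable_INT'' sets.Int borel_closed borel_open closed_halfspace_component_ge_cart
        open_halfspace_component_lt_cart) auto
  finally show ?thesis .
qed

text \<open>The cell lies between an open and a closed box of equal volume.\<close>

lemma emeasure_dcube:
  fixes x :: "real ^ 'n"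
  assumes "0 < s"
  shows "emeasure lborel (dcube s x) = ennreal (s ^ CARD('n))"
proof -
  let ?c = "corner s x" and ?d = "corner s x + (\<chi> i. s)"
  have ge: "?c $ i \<le> ?d $ i" for i using assms by simp
  have "emeasure lborel (cbox ?c ?d) = ennreal (\<Prod>b\<in>Basis. (?d - ?c) \<bullet> b)"
    using assms by (intro emeasure_lborel_cbox) (auto simp: Basis_vec_def inner_axis)
  also have "(\<Prod>b\<in>Basis. (?d - ?c) \<bullet> b) = s ^ CARD('n)"
  proof -
    have "(\<Prod>b\<in>Basis. (?d - ?c) \<bullet> b) = (\<Prod>b\<in>(Basis :: (real ^ 'n) set). s)"
      by (intro prod.cong) (auto simp: Basis_vec_def inner_axis)
    then show ?thesis by simp
  qed
  finally have cb: "emeasure lborel (cbox ?c ?d) = ennreal (s ^ CARD('n))" .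
  have "box ?c ?d \<subseteq> dcube s x" "dcube s x \<subseteq> cbox ?c ?d"
    using assms by (auto simp: dcube_iff mem_box_cart less_imp_le)
  then have "emeasure lborel (box ?c ?d) \<le> emeasure lborel (dcube s x)" "emeasure lborel (dcube s x) \<le> emeasure lborel (cbox ?c ?d)"
    using assms dcube_borel by (auto intro!: emeasure_mono)
  moreover have "emeasure lborel (box ?c ?d) = emeasure lborel (cbox ?c ?d)"
    by (simp add: emeasure_lborel_box_eq emeasure_lborel_cbox_eq)
  ultimately show ?thesis using cb by simp
qed

text \<open>The sum of the coordinates is a crude substitute for the diagonal; it makes n times the
  side the radius used in the kernel estimate.\<close>

lemma norm_diff_corner_le:
  fixes x y :: "real ^ 'n"
  assumes "0 < s" "y \<in> dcube s x"
  shows "norm (y - corner s x) \<le> real CARD('n) * s"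
proof -
  have "norm (y - corner s x) \<le> (\<Sum>i\<in>UNIV. \<bar>(y - corner s x) $ i\<bar>)" by (rule norm_le_l1_cart)
  also have "\<dots> \<le> (\<Sum>i\<in>(UNIV::'n set). s)"
    using assms by (intro sum_mono) (auto simp: dcube_iff abs_le_iff less_imp_le add.commute diff_le_eq)
  finally show ?thesis by simp
qed

lemma norm_diff_dcube_le:
  fixes x y z :: "real ^ 'n"
  assumes "0 < s" "y \<in> dcube s x" "z \<in> dcube s x"
  shows "norm (y - z) \<le> 2 * real CARD('n) * s"
proof -
  have "norm (y - z) \<le> norm (y - corner s x) + norm (z - corner s x)" by norm
  then show ?thesis using norm_diff_corner_le[OF assms(1,2)] norm_diff_corner_le[OF assms(1,3)] by linarith
qed

text \<open>Grid indices at mesh s are those at mesh s / 2 divided by 2 and rounded down, so points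
  sharing the fine index share the coarse one.\<close>

lemma dcube_half_subset:
  assumes "0 < s"
  shows "dcube (s / 2) x \<subseteq> dcube s x"
proof -
  have half: "\<lfloor>a / s\<rfloor> = \<lfloor>a / (s / 2)\<rfloor> div 2" for a
    using floor_divide_real_eq_div[of 2 "a / (s / 2)"] assms by simp
  show ?thesis
    unfolding dcube_def half[of "_ $ _"] by (intro Collect_mono) simp
qed

lemma finite_dcubes:
  fixes r s :: real
  assumes "0 < s"
  shows "finite (dcube s ` cball (0 :: real ^ 'n) r)"
proof -
  let ?A = "PiE (UNIV :: 'n set) (\<lambda>_. {\<lfloor>- r / s\<rfloor> .. \<lfloor>r / s\<rfloor>})"
  let ?F = "\<lambda>m. {y :: real ^ 'n. \<forall>i. \<lfloor>y $ i / s\<rfloor> = m i}"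
  have "dcube s ` cball 0 r \<subseteq> ?F ` ?A"
  proof
    fix Q assume "Q \<in> dcube s ` cball (0 :: real ^ 'n) r"
    then obtain x where x: "norm x \<le> r" "Q = dcube s x" by auto
    have "- r \<le> x $ i" "x $ i \<le> r" for i using component_le_norm_cart[of x i] x by linarith+
    then have "- r / s \<le> x $ i / s" "x $ i / s \<le> r / s" for i
      using assms by (simp_all only: divide_right_mono less_imp_le)
    then have "(\<lambda>i. \<lfloor>x $ i / s\<rfloor>) \<in> ?A"
      by (auto intro!: floor_mono)
    then show "Q \<in> ?F ` ?A"
      by (rule image_eqI[where f="?F" and x="\<lambda>i. \<lfloor>x $ i / s\<rfloor>", rotated]) (simp add: x dcube_def)
  qed
  moreover have "finite ?A" by (intro finite_PiE) auto
  ultimately show ?thesis using finite_subset by blast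
qed

lemma test_function_uniformly_continuous:
  fixes \<phi> :: "real ^ 'n \<Rightarrow> complex"
  assumes \<phi>: "\<phi> \<in> test_functions" and e: "0 < e"
  obtains d where "0 < d" "\<And>x y. norm (x - y) < d \<Longrightarrow> norm (\<phi> x - \<phi> y) < e"
proof -
  obtain r m where rm: "0 < r" "0 < m" "\<And>x. norm (\<phi> x) \<le> m" "\<And>x. r < norm x \<Longrightarrow> \<phi> x = 0"
    using test_function_bounds[OF \<phi>] by blast
  have "uniformly_continuous_on (cball 0 (r + 1)) \<phi>"
    by (intro compact_uniformly_continuous continuous_on_subset[OF test_function_continuous[OF \<phi>]]) auto
  then obtain d where d: "0 < d" "\<And>x y. x \<in> cball 0 (r + 1) \<Longrightarrow> y \<in> cball 0 (r + 1) \<Longrightarrow> dist y x < d \<Longrightarrow> dist (\<phi> y) (\<phi> x) < e"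
    unfolding uniformly_continuous_on_def using e by meson
  show ?thesis
  proof
    fix x y :: "real ^ 'n" assume xy: "norm (x - y) < min d 1"
    show "norm (\<phi> x - \<phi> y) < e"
    proof (cases "norm x \<le> r + 1 \<and> norm y \<le> r + 1")
      case True
      then show ?thesis using d(2)[of y x] xy by (simp add: dist_norm)
    next
      case False
      have "norm x \<le> norm y + norm (x - y)" "norm y \<le> norm x + norm (x - y)" by norm+
      then have "r < norm x" "r < norm y" using xy False by auto
      then show ?thesis using rm(4) e by simp
    qed
  qed (use d in auto)
qed

text \<open>Since \<open>\<phi>\<close> is uniformly continuous, the bisection can stop at a finite depth: this yields
  finitely many cubes and avoids the differentiation theorem.\<close>

lemma Calderon_Zygmund_cubes:
  fixes \<phi> :: "real ^ 'n \<Rightarrow> complex"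
  assumes \<phi>: "\<phi> \<in> test_functions" and q: "1 \<le> q" and t: "0 < t"
  obtains \<Q> where "finite \<Q>" "disjoint \<Q>" "\<And>Q. Q \<in> \<Q> \<Longrightarrow> \<exists>s x. 0 < s \<and> Q = dcube s x"
    "\<And>Q. Q \<in> \<Q> \<Longrightarrow> ennreal (t powr q) * emeasure lborel Q \<le> (\<integral>\<^sup>+y\<in>Q. ennreal (norm (\<phi> y) powr q) \<partial>lborel)"
    "\<And>Q. Q \<in> \<Q> \<Longrightarrow> (\<integral>\<^sup>+y\<in>Q. ennreal (norm (\<phi> y) powr q) \<partial>lborel) \<le> ennreal (2 ^ CARD('n) * t powr q) * emeasure lborel Q"
    "\<And>x. x \<notin> \<Union>\<Q> \<Longrightarrow> norm (\<phi> x) \<le> 2 * t"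
proof -
  note \<phi>m [measurable] = test_function_borel[OF \<phi>]
  obtain r m where rm: "0 < r" "0 < m" "\<And>x. norm (\<phi> x) \<le> m" "\<And>x. r < norm x \<Longrightarrow> \<phi> x = 0"
    using test_function_bounds[OF \<phi>] by blast
  define J where "J Q = (\<integral>\<^sup>+y\<in>Q. ennreal (norm (\<phi> y) powr q) \<partial>lborel)" for Q
  define bad where "bad s x \<longleftrightarrow> ennreal (t powr q) * emeasure lborel (dcube s x) < J (dcube s x)" for s x
  have J_mono: "J Q \<le> J Q'" if "Q \<subseteq> Q'" for Q Q'
    unfolding J_def using that by (intro nn_integral_mono) (auto split: split_indicator)
  have Jfin: "J UNIV < \<infinity>"
  proof -
    have "\<phi> \<in> Lp (ennreal q)" using \<phi> q by (intro test_function_Lp) auto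
    then show ?thesis unfolding J_def using q by (simp add: Lp_iff nn_integral_completion)
  qed
  \<comment> \<open>The starting side is so large that no cell is bad: the whole mass is at most
    \<open>t powr q * L\<close>, and \<open>L \<ge> 1\<close> makes this at most
    \<open>t powr q\<close> times the volume.\<close>
  define L where "L = max 1 (enn2real (J UNIV) / t powr q)"
  have L: "1 \<le> L" by (simp add: L_def)
  have bad_L: "\<not> bad L x" for x
  proof -
    have "J (dcube L x) \<le> J UNIV" by (rule J_mono) simp
    also have "\<dots> = ennreal (enn2real (J UNIV))" using Jfin by (simp add: less_top)
    also have "\<dots> \<le> ennreal (t powr q * L ^ CARD('n))"
    proof (rule ennreal_leI)
      have "enn2real (J UNIV) \<le> t powr q * L" using t by (auto simp: L_def field_simps max_def)
      also have "\<dots> \<le> t powr q * L ^ CARD('n)"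
        using L power_increasing[of 1 "CARD('n)" L] by (intro mult_left_mono) auto
      finally show "enn2real (J UNIV) \<le> t powr q * L ^ CARD('n)" .
    qed
    also have "\<dots> = ennreal (t powr q) * emeasure lborel (dcube L x)"
      using L by (simp add: emeasure_dcube ennreal_mult)
    finally show ?thesis by (simp add: bad_def not_less)
  qed
  obtain d where d: "0 < d" "\<And>x y. norm (x - y) < d \<Longrightarrow> norm (\<phi> x - \<phi> y) < t"
    using test_function_uniformly_continuous[OF \<phi> t] by blast
  \<comment> \<open>Depth at which the cells have diameter below the modulus d of uniform
    continuity.\<close>
  obtain N :: nat where N: "2 * real CARD('n) * L / d < 2 ^ N"
    using real_arch_pow[of 2 "2 * real CARD('n) * L / d"] by auto
  define side where "side k = L / 2 ^ k" for k :: nat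
  have side: "0 < side k" "side (Suc k) = side k / 2" for k
    using L by (auto simp: side_def)
  have mono: "dcube (side k) x \<subseteq> dcube (side j) x" if "j \<le> k" for j k x
    using that
  proof (induction k rule: dec_induct)
    case (step k)
    have "dcube (side (Suc k)) x \<subseteq> dcube (side k) x"
      unfolding side(2) by (rule dcube_half_subset[OF side(1)])
    then show ?case using step.IH by (rule subset_trans)
  qed simp
  \<comment> \<open>A cell is selected at the coarsest scale at which its average is too large.
    Minimality yields disjointness, and the parent, not being bad, yields the upper bound on the
    average.\<close>
  define first_bad where "first_bad k x \<longleftrightarrow> bad (side k) x \<and> (\<forall>j<k. \<not> bad (side j) x)" for k x
  have bad_cong: "bad s x \<longleftrightarrow> bad s y" if "y \<in> dcube s x" for s x y
    using dcube_eq[OF that] by (simp add: bad_def)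
  have first_bad_cong: "first_bad k x \<longleftrightarrow> first_bad k y" if "y \<in> dcube (side k) x" for k x y
  proof -
    have "bad (side j) x \<longleftrightarrow> bad (side j) y" if "j \<le> k" for j
      using mono[OF that, of x] \<open>y \<in> dcube (side k) x\<close> by (intro bad_cong) blast
    then show ?thesis by (auto simp: first_bad_def)
  qed
  define \<Q> where "\<Q> = {dcube (side k) x | k x. k \<le> N \<and> first_bad k x}"
  have "\<Q> \<subseteq> (\<Union>k\<le>N. dcube (side k) ` cball 0 r)"
  proof
    fix Q assume "Q \<in> \<Q>"
    then obtain k x where k: "k \<le> N" "bad (side k) x" "Q = dcube (side k) x" by (auto simp: \<Q>_def first_bad_def)
    \<comment> \<open>A bad cell carries mass, so it meets the ball outside which
      \<open>\<phi>\<close> vanishes; at each of the finitely many scales only finitely many cells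
      do.\<close>
    have "\<exists>y\<in>Q. y \<in> cball 0 r"
    proof (rule ccontr)
      assume "\<not> ?thesis"
      then have "\<And>y. y \<in> Q \<Longrightarrow> \<phi> y = 0" using rm(4) by (auto simp: not_le)
      then have "J Q = (\<integral>\<^sup>+(y::real^'n). 0 \<partial>lborel)" unfolding J_def by (intro nn_integral_cong) (auto split: split_indicator)
      then show False using k by (simp add: bad_def)
    qed
    then obtain y where "y \<in> dcube (side k) x" "y \<in> cball 0 r" using k by auto
    then have "Q \<in> dcube (side k) ` cball 0 r" using dcube_eq k by blast
    then show "Q \<in> (\<Union>k\<le>N. dcube (side k) ` cball 0 r)" using k by blast
  qed
  then have fin: "finite \<Q>"
    by (rule finite_subset) (use side finite_dcubes in auto)
  show ?thesis
  proof
    show "finite \<Q>" by (rule fin)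
    show "disjoint \<Q>"
    proof (rule disjointI)
      fix P Q assume "P \<in> \<Q>" "Q \<in> \<Q>" "P \<noteq> Q"
      then obtain j x k y where j: "P = dcube (side j) x" "first_bad j x"
        and k: "Q = dcube (side k) y" "first_bad k y" by (auto simp: \<Q>_def)
      \<comment> \<open>A common point z has only one first bad scale, and at that scale only one
        cell.\<close>
      show "P \<inter> Q = {}"
      proof (rule ccontr)
        assume "P \<inter> Q \<noteq> {}"
        then obtain z where z: "z \<in> dcube (side j) x" "z \<in> dcube (side k) y" using j k by auto
        then have "first_bad j z" "first_bad k z" using j k first_bad_cong by blast+
        then have "j = k" unfolding first_bad_def by (meson linorder_neqE_nat)
        then show False using dcube_eq[OF z(1)] dcube_eq[OF z(2)] j k \<open>P \<noteq> Q\<close> by simp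
      qed
    qed
  next
    fix Q assume "Q \<in> \<Q>"
    then obtain k x where k: "k \<le> N" "first_bad k x" "Q = dcube (side k) x" by (auto simp: \<Q>_def)
    show "\<exists>s x. 0 < s \<and> Q = dcube s x" using k side by blast
    show "ennreal (t powr q) * emeasure lborel Q \<le> (\<integral>\<^sup>+y\<in>Q. ennreal (norm (\<phi> y) powr q) \<partial>lborel)"
      using k by (simp add: first_bad_def bad_def J_def less_imp_le)
    \<comment> \<open>A selected cell therefore has a parent, whose volume is
      \<open>2 ^ CARD('n)\<close> times larger; this is the factor in the upper bound.\<close>
    have "k \<noteq> 0"
    proof
      assume "k = 0"
      then have "bad L x" using k(2) by (simp add: first_bad_def side_def)
      then show False using bad_L by simp
    qed
    then obtain j where j: "k = Suc j" by (cases k) auto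
    have "J Q \<le> J (dcube (side j) x)" unfolding k(3) using j by (intro J_mono mono) simp
    also have "\<dots> \<le> ennreal (t powr q) * emeasure lborel (dcube (side j) x)"
      using k(2) j by (simp add: first_bad_def bad_def not_less)
    also have "\<dots> = ennreal (2 ^ CARD('n) * t powr q) * emeasure lborel Q"
      unfolding k(3) j using side(1)[of j] side(1)[of "Suc j"]
      by (simp add: emeasure_dcube side(2) power_divide flip: ennreal_mult)
    finally show "(\<integral>\<^sup>+y\<in>Q. ennreal (norm (\<phi> y) powr q) \<partial>lborel) \<le> ennreal (2 ^ CARD('n) * t powr q) * emeasure lborel Q"
      by (simp add: J_def)
  next
    fix x assume x: "x \<notin> \<Union>\<Q>"
    \<comment> \<open>The first bad scale up to N, if there were one, would give a selected cell
      containing x.\<close>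
    have "\<not> bad (side k) x" if "k \<le> N" for k
      using that
    proof (induction k rule: less_induct)
      case (less k)
      show ?case
      proof
        assume "bad (side k) x"
        then have "first_bad k x" using less by (auto simp: first_bad_def)
        then have "dcube (side k) x \<in> \<Q>" using less.prems by (auto simp: \<Q>_def)
        then show False using x mem_dcube by blast
      qed
    qed
    then have nb: "J (dcube (side N) x) \<le> ennreal (t powr q) * emeasure lborel (dcube (side N) x)"
      by (simp add: bad_def not_less)
    show "norm (\<phi> x) \<le> 2 * t"
    proof (rule ccontr)
      assume "\<not> norm (\<phi> x) \<le> 2 * t"
      then have u: "t < norm (\<phi> x) - t" by simp
      \<comment> \<open>On the finest cell \<open>\<phi>\<close> varies by less than t, so a value
        above \<open>2 * t\<close> would keep it above t on the whole cell and contradict the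
        average bound there.\<close>
      have ge: "norm (\<phi> x) - t \<le> norm (\<phi> y)" if "y \<in> dcube (side N) x" for y
      proof -
        have "norm (x - y) \<le> 2 * real CARD('n) * side N"
          using that side by (intro norm_diff_dcube_le) auto
        also have "\<dots> < d" using N d(1) by (simp add: side_def field_simps)
        finally have "norm (\<phi> x - \<phi> y) < t" by (rule d)
        then show ?thesis using norm_triangle_ineq2[of "\<phi> x" "\<phi> y"] by linarith
      qed
      let ?u = "norm (\<phi> x) - t"
      have dm: "dcube (side N) x \<in> sets lborel" using dcube_borel[OF side(1)] by simp
      have "ennreal (t powr q) * emeasure lborel (dcube (side N) x) < ennreal (?u powr q) * emeasure lborel (dcube (side N) x)"
        using u t q side(1)[of N]
        by (simp add: emeasure_dcube flip: ennreal_mult) (auto intro!: ennreal_lessI mult_strict_right_mono powr_less_mono2)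
      also have "\<dots> = (\<integral>\<^sup>+y\<in>dcube (side N) x. ennreal (?u powr q) \<partial>lborel)"
        using dm by (rule nn_integral_cmult_indicator[symmetric])
      also have "\<dots> \<le> J (dcube (side N) x)"
        unfolding J_def using ge u t q
        by (intro nn_integral_mono) (auto split: split_indicator intro!: ennreal_leI powr_mono2)
      finally show False using nb by simp
    qed
  qed
qed

subsection \<open>Estimates for the kernel\<close>

lemma distr_lborel_shift: "distr lborel borel (\<lambda>x. x + c) = (lborel :: 'a :: euclidean_space measure)"
proof -
  have "(+) c = (\<lambda>x. x + c)" by (auto simp: add.commute)
  then show ?thesis using lborel_distr_plus[of c] by simp
qed

lemma distr_lborel_reflect: "distr lborel borel (\<lambda>y. x - y) = (lborel :: 'a :: euclidean_space measure)"
  using lborel_affine[of "-1" x] by (simp add: density_1 one_ennreal_def[symmetric])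

lemma nn_integral_lborel_shift:
  fixes f :: "'a :: euclidean_space \<Rightarrow> ennreal"
  assumes "f \<in> borel_measurable borel"
  shows "(\<integral>\<^sup>+x. f (x + c) \<partial>lborel) = (\<integral>\<^sup>+x. f x \<partial>lborel)"
  using nn_integral_distr[of "\<lambda>x. x + c" lborel borel f] assms by (simp add: distr_lborel_shift)

text \<open>P itself need not define a measurable set. Passing to a Borel null set allows the
  statement to be transported along translations and reflections.\<close>

lemma AE_lborel_obtain_null_set:
  assumes "AE x in lborel. P x"
  obtains N where "N \<in> sets borel" "AE x in lborel. x \<notin> N" "\<And>x. x \<notin> N \<Longrightarrow> P x"
proof -
  obtain N where N: "N \<in> null_sets lborel" "{x \<in> space lborel. \<not> P x} \<subseteq> N"
    using assms by (auto simp: eventually_ae_filter)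
  show ?thesis
    by (rule that[of N]) (use N in \<open>auto intro: AE_not_in\<close>)
qed

lemma AE_lborel_shift:
  fixes c :: "'a :: euclidean_space"
  assumes "AE x in lborel. P x"
  shows "AE x in lborel. P (x - c)"
proof -
  obtain N where N: "N \<in> sets borel" "AE x in (lborel :: 'a measure). x \<notin> N" "\<And>x. x \<notin> N \<Longrightarrow> P x"
    using AE_lborel_obtain_null_set[OF assms] by blast
  have "AE x in distr lborel borel (\<lambda>x. x + (- c)). x \<notin> N"
    using N(2) by (simp only: distr_lborel_shift)
  then have "AE x in lborel. x + (- c) \<notin> N"
    using N(1) by (subst (asm) AE_distr_iff) auto
  then show ?thesis by eventually_elim (use N(3) in simp)
qed

lemma AE_lborel_reflect:
  fixes c :: "'a :: euclidean_space"
  assumes "AE x in lborel. P x"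
  shows "AE x in lborel. P (c - x)"
proof -
  obtain N where N: "N \<in> sets borel" "AE x in (lborel :: 'a measure). x \<notin> N" "\<And>x. x \<notin> N \<Longrightarrow> P x"
    using AE_lborel_obtain_null_set[OF assms] by blast
  have "AE x in distr lborel borel (\<lambda>x. c - x). x \<notin> N"
    using N(2) by (simp only: distr_lborel_reflect)
  then have "AE x in lborel. c - x \<notin> N"
    using N(1) by (subst (asm) AE_distr_iff) auto
  then show ?thesis by eventually_elim (use N(3) in simp)
qed

text \<open>For a Borel function \<open>K (x - y)\<close> is jointly measurable in x and y, as
  Tonelli's theorem requires; Lebesgue measurability alone does not pass through this composition so
  directly.\<close>

lemma complex_ex_borel_measurable:
  fixes K :: "'a :: euclidean_space \<Rightarrow> complex"
  assumes [measurable]: "K \<in> borel_measurable lebesgue"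
  obtains K' where "K' \<in> borel_measurable borel" "AE x in lborel. K x = K' x"
proof -
  have "(\<lambda>x. Re (K x)) \<in> borel_measurable lebesgue" "(\<lambda>x. Im (K x)) \<in> borel_measurable lebesgue"
    by measurable
  from completion_ex_borel_measurable_real[OF this(1)] completion_ex_borel_measurable_real[OF this(2)]
  obtain u v where uv: "u \<in> borel_measurable borel" "AE x in lborel. Re (K x) = u x"
    "v \<in> borel_measurable borel" "AE x in lborel. Im (K x) = v x"
    by auto
  show ?thesis
  proof
    show "(\<lambda>x. Complex (u x) (v x)) \<in> borel_measurable borel"
      using uv by (simp add: borel_measurable_complex_iff)
    show "AE x in lborel. K x = Complex (u x) (v x)"
      using uv(2,4) by eventually_elim (simp add: complex_eq_iff)
  qed
qed

section \<open>The inner integral of the kernel condition\<close>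

definition hormander_integral :: "real \<Rightarrow> (real ^ 'n \<Rightarrow> complex) \<Rightarrow> real ^ 'n \<Rightarrow> ennreal" where
  "hormander_integral R K y = (\<integral>\<^sup>+ x\<in>{x. norm x \<ge> 2 * R}. ennreal (norm (K (x - y) - K x)) \<partial>lebesgue)"

text \<open>This holds at every y, not merely almost every one, because translates of null sets are
  null. The kernel may thus be exchanged for a Borel representative.\<close>

lemma hormander_integral_cong:
  assumes "AE x in lborel. K x = K' x"
  shows "hormander_integral R K y = hormander_integral R K' y"
  unfolding hormander_integral_def nn_integral_completion
proof (rule nn_integral_cong_AE)
  show "AE x in lborel. ennreal (norm (K (x - y) - K x)) * indicator {x. 2 * R \<le> norm x} x =
    ennreal (norm (K' (x - y) - K' x)) * indicator {x. 2 * R \<le> norm x} x"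
    using AE_lborel_shift[OF assms, of y] assms by eventually_elim simp
qed

lemma hormander_integral_measurable:
  fixes K :: "real ^ 'n \<Rightarrow> complex"
  assumes [measurable]: "K \<in> borel_measurable borel"
  shows "hormander_integral R K \<in> borel_measurable borel"
proof -
  have "(\<lambda>y. \<integral>\<^sup>+ x. ennreal (norm (K (x - y) - K x)) * indicator {x. norm x \<ge> 2 * R} x \<partial>lborel) \<in> borel_measurable borel"
    by measurable
  then show ?thesis
    by (simp add: hormander_integral_def[abs_def] nn_integral_completion)
qed

lemma ennreal_powr_measurable [measurable]: "(\<lambda>x. ennreal_powr x p) \<in> borel_measurable borel"
  unfolding ennreal_powr_def by measurable

lemma mult_le_powr_add_powr:
  fixes a b :: real
  assumes "0 \<le> a" "0 \<le> b" "1 < q" "1 / q + 1 / p = 1"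
  shows "a * b \<le> a powr q + b powr p"
proof -
  have p: "1 < p"
  proof (rule ccontr)
    assume "\<not> 1 < p"
    then have "1 / p \<le> 0 \<or> 1 \<le> 1 / p" by (cases "p \<le> 0") (auto simp: divide_simps)
    moreover have "0 < 1 / q" "1 / q < 1" using assms by auto
    ultimately show False using assms by linarith
  qed
  have "a * b \<le> a powr q / q + b powr p / p"
    using assms p by (intro Youngs_inequality) auto
  also have "\<dots> \<le> a powr q + b powr p"
    using assms p by (intro add_mono) (auto simp: divide_le_eq mult_le_cancel_left1 intro: mult_left_le)
  finally show ?thesis .
qed

text \<open>Let F be the inner integral. The product of \<open>norm (b y)\<close> and F equals
  \<open>t * W\<close> times the product of the normalised factors \<open>norm (b y) / t\<close> and
  \<open>F / W\<close>, so Young's inequality separates them additively; the kernel condition bounds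
  the integral of \<open>(F / W) powr p\<close> over the ball by its volume. For q = 1 the essential
  bound \<open>F \<le> W\<close> replaces Young's inequality, and the volume term is slack.\<close>

lemma hormander_integral_Hr_bound:
  fixes K :: "real ^ 'n \<Rightarrow> complex" and q :: real and q' :: ennreal
  assumes K: "K \<in> borel_measurable lebesgue" and H: "Hr_const q' K \<le> ennreal W"
    and q: "1 \<le> q" and q': "1 / ennreal q + 1 / q' = 1" and W: "0 < W" and R: "0 < R" and t: "0 < t"
    and b: "b \<in> borel_measurable borel" "\<And>y. R < norm y \<Longrightarrow> b y = 0"
  shows "(\<integral>\<^sup>+ y. ennreal (norm (b y :: complex)) * hormander_integral R K y \<partial>lborel) \<le>
    ennreal (t * W) * ((\<integral>\<^sup>+ y. ennreal ((norm (b y) / t) powr q) \<partial>lborel)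
      + ennreal (measure lebesgue (ball (0 :: real ^ 'n) 1) * R ^ CARD('n)))"
proof -
  obtain K' where K': "K' \<in> borel_measurable borel" "AE x in lborel. K x = K' x"
    using complex_ex_borel_measurable[OF K] by blast
  have F [measurable]: "hormander_integral R K \<in> borel_measurable borel"
  proof -
    have "hormander_integral R K = hormander_integral R K'"
      by (rule ext) (rule hormander_integral_cong[OF K'(2)])
    then show ?thesis using hormander_integral_measurable[OF K'(1), of R] by (simp only:)
  qed
  note [measurable] = b(1)
  let ?F = "hormander_integral R K" and ?v = "measure lebesgue (ball (0 :: real ^ 'n) 1) * R ^ CARD('n)"
  have v: "0 < ?v" using R by (simp add: content_ball_pos)
  let ?I = "\<integral>\<^sup>+ y. ennreal ((norm (b y) / t) powr q) \<partial>lborel"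
  show ?thesis
  proof (cases "q = 1")
    case True
    then have "1 / q' = 0" using q' by simp
    then have "q' = \<infinity>" by (simp add: divide_ennreal_def)
    have "esssup (lebesgue_on {y. norm y \<le> R}) ?F \<le> Hr_const q' K"
      unfolding Hr_const_def Let_def hormander_integral_def[abs_def]
      using \<open>q' = \<infinity>\<close> R by (intro SUP_upper2[of R]) auto
    also have "\<dots> \<le> ennreal W" by (rule H)
    finally have le: "esssup (lebesgue_on {y. norm y \<le> R}) ?F \<le> ennreal W" .
    have "AE y in lebesgue_on {y. norm y \<le> R}. ?F y \<le> ennreal W"
      using esssup_AE[where M="lebesgue_on {y. norm y \<le> R}" and f="?F"]
      by eventually_elim (rule order_trans[OF _ le])
    moreover have "{y::real^'n. norm y \<le> R} \<in> sets lebesgue"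
      using lmeasurable_cball[of "0::real^'n" R] by (simp add: cball_def dist_norm fmeasurable_def)
    ultimately have ae: "AE y in lborel. norm y \<le> R \<longrightarrow> ?F y \<le> ennreal W"
      by (simp add: AE_restrict_space_iff AE_completion_iff)
    have "(\<integral>\<^sup>+ y. ennreal (norm (b y)) * ?F y \<partial>lborel) \<le> (\<integral>\<^sup>+ y. ennreal (t * W) * ennreal ((norm (b y) / t) powr q) \<partial>lborel)"
    proof (rule nn_integral_mono_AE)
      show "AE y in lborel. ennreal (norm (b y)) * ?F y \<le> ennreal (t * W) * ennreal ((norm (b y) / t) powr q)"
        using ae
      proof eventually_elim
        case (elim y)
        have "ennreal (norm (b y)) * ?F y \<le> ennreal (norm (b y)) * ennreal W"
          using elim b(2)[of y] by (cases "norm y \<le> R") (auto intro: mult_left_mono)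
        also have "\<dots> = ennreal (t * W) * ennreal ((norm (b y) / t) powr q)"
          using t W True by (simp flip: ennreal_mult)
        finally show ?case .
      qed
    qed
    also have "\<dots> = ennreal (t * W) * ?I" by (intro nn_integral_cmult) measurable
    also have "\<dots> \<le> ennreal (t * W) * (?I + ennreal ?v)" by (intro mult_left_mono) auto
    finally show ?thesis .
  next
    case False
    then have q1: "1 < q" using q by simp
    define p where "p = q / (q - 1)"
    have p: "1 < p" "1 / q + 1 / p = 1" using q1 by (auto simp: p_def field_simps)
    \<comment> \<open>Conjugacy is given in the extended reals. Cancelling the finite
      \<open>1 / q\<close> leaves \<open>1 / q' = 1 / p\<close>, which excludes the values 0 and
      infinity.\<close>
    have "q' = ennreal p"
    proof -
      have "1 / ennreal q = ennreal (1 / q)" using q1 by (simp add: divide_ennreal[symmetric])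
      then have "ennreal (1 / q) + 1 / q' = ennreal (1 / q) + ennreal (1 / p)"
        using q' p q1 by (simp add: ennreal_plus[symmetric] del: ennreal_plus)
      then have *: "1 / q' = ennreal (1 / p)" by simp
      show ?thesis
      proof (cases q')
        case (real r)
        have "r \<noteq> 0" using * real by (auto simp: divide_ennreal_def)
        then have "ennreal (1 / r) = ennreal (1 / p)"
          using * real by (simp add: divide_ennreal_def inverse_ennreal inverse_eq_divide)
        then show ?thesis using real p \<open>r \<noteq> 0\<close> by simp
      next
        case top
        then show ?thesis using * p by (simp add: divide_ennreal_def)
      qed
    qed
    have "ennreal_powr ((\<integral>\<^sup>+ y\<in>{y. norm y \<le> R}. ennreal_powr (?F y) p \<partial>lebesgue) / ennreal ?v) (1 / p) \<le> Hr_const q' K"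
      unfolding Hr_const_def Let_def hormander_integral_def[abs_def]
      using \<open>q' = ennreal p\<close> R p by (intro SUP_upper2[of R]) auto
    also have "\<dots> \<le> ennreal W" by (rule H)
    finally have "(\<integral>\<^sup>+ y\<in>{y. norm y \<le> R}. ennreal_powr (?F y) p \<partial>lebesgue) / ennreal ?v \<le> ennreal (W powr p)"
      using p W by (simp add: ennreal_powr_le_iff ennreal_powr_ennreal)
    then have Fp: "(\<integral>\<^sup>+ y\<in>{y. norm y \<le> R}. ennreal_powr (?F y) p \<partial>lborel) \<le> ennreal (W powr p) * ennreal ?v"
    proof -
      have *: "x / ennreal ?v * ennreal ?v = x" for x
        using v R by (simp add: ennreal_divide_times divide_ennreal)
      show ?thesis
        using mult_right_mono[OF \<open>_ / ennreal ?v \<le> _\<close>, of "ennreal ?v"] unfolding * nn_integral_completion by simp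
    qed
    have "(\<integral>\<^sup>+ y. ennreal (norm (b y)) * ?F y \<partial>lborel) \<le> (\<integral>\<^sup>+ y. ennreal (t * W) * (ennreal ((norm (b y) / t) powr q)
        + ennreal (W powr - p) * (ennreal_powr (?F y) p * indicator {y. norm y \<le> R} y)) \<partial>lborel)"
    proof (rule nn_integral_mono)
      fix y
      show "ennreal (norm (b y)) * ?F y \<le> ennreal (t * W) * (ennreal ((norm (b y) / t) powr q)
        + ennreal (W powr - p) * (ennreal_powr (?F y) p * indicator {y. norm y \<le> R} y))"
      proof (cases "norm y \<le> R")
        case True
        show ?thesis
        \<comment> \<open>The inner integral may be infinite at some y; the right-hand side is then
          infinite too.\<close>
        proof (cases "?F y")
          case (real f)
          have "norm (b y) * f = (t * W) * ((norm (b y) / t) * (f / W))" using t W by simp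
          also have "\<dots> \<le> (t * W) * ((norm (b y) / t) powr q + (f / W) powr p)"
            using t W real q1 p by (intro mult_left_mono mult_le_powr_add_powr) auto
          also have "(f / W) powr p = W powr - p * f powr p"
            using W real by (simp add: powr_divide powr_minus_divide)
          finally show ?thesis
            using real True t W by (simp add: ennreal_powr_ennreal flip: ennreal_mult ennreal_plus)
        next
          case top
          then show ?thesis using True t W by (simp add: ennreal_mult_top)
        qed
      qed (use b(2)[of y] in simp)
    qed
    also have "\<dots> = ennreal (t * W) * (?I + ennreal (W powr - p) * (\<integral>\<^sup>+ y\<in>{y. norm y \<le> R}. ennreal_powr (?F y) p \<partial>lborel))"
      by (subst nn_integral_cmult; (subst nn_integral_add; (subst nn_integral_cmult)?)?; measurable)
    also have "\<dots> \<le> ennreal (t * W) * (?I + ennreal (W powr - p) * (ennreal (W powr p) * ennreal ?v))"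
      by (intro mult_left_mono add_mono Fp) auto
    also have "ennreal (W powr - p) * (ennreal (W powr p) * ennreal ?v) = ennreal ?v"
      using W v by (simp add: powr_minus field_simps flip: ennreal_mult)
    finally show ?thesis .
  qed
qed

text \<open>For \<open>2 * R \<le> norm (x - c)\<close> the point x is off the support of b, so
  \<open>T b\<close> is given by the kernel, and mean zero permits subtracting
  \<open>K (x - c)\<close>. Tonelli's theorem and the translation by c then leave b integrated
  against the inner integral of the kernel condition.\<close>

lemma singular_integral_mean_zero_bound:
  fixes K :: "real ^ 'n \<Rightarrow> complex" and q :: real and q' :: ennreal
  assumes T: "singular_integral_operator K D T" and K: "K \<in> Hr_class q'"
    and size: "\<And>x. x \<noteq> 0 \<Longrightarrow> norm (K x) \<le> A / norm x ^ CARD('n)"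
    and H: "Hr_const q' K \<le> ennreal W" and q: "1 \<le> q" and q': "1 / ennreal q + 1 / q' = 1"
    and W: "0 < W" and R: "0 < R" and t: "0 < t"
    and b: "b \<in> D" "b \<in> borel_measurable borel" "\<And>y. R < norm (y - c) \<Longrightarrow> b y = 0" "\<And>y. norm (b y) \<le> m"
    and mean: "(\<integral>y. b y \<partial>lborel) = 0"
  shows "(\<integral>\<^sup>+ x\<in>{x. 2 * R \<le> norm (x - c)}. ennreal (norm (T b x)) \<partial>lebesgue) \<le>
    ennreal (t * W) * ((\<integral>\<^sup>+ y. ennreal ((norm (b y) / t) powr q) \<partial>lborel)
      + ennreal (measure lebesgue (ball (0 :: real ^ 'n) 1) * R ^ CARD('n)))"
proof -
  \<comment> \<open>The kernel is measurable only off the origin; fixing a value there makes it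
    measurable on the whole space and changes it on a null set.\<close>
  define K0 where "K0 x = (if x = 0 then 0 else K x)" for x
  have K0m: "K0 \<in> borel_measurable lebesgue"
  proof -
    have "K0 = (\<lambda>x. if x \<in> UNIV - {0} then K x else 0)" by (auto simp: K0_def)
    moreover have "(\<lambda>x. if x \<in> UNIV - {0} then K x else 0) \<in> borel_measurable lebesgue"
      using K by (subst borel_measurable_if) (auto simp: Hr_class_def)
    ultimately show ?thesis by (simp only:)
  qed
  have ae0: "AE x in lborel. K0 x = K x"
    using AE_lborel_singleton[of 0] by eventually_elim (simp add: K0_def)
  obtain K' where K' [measurable]: "K' \<in> borel_measurable borel" and K0': "AE x in lborel. K0 x = K' x"
    using complex_ex_borel_measurable[OF K0m] by blast
  have KK': "AE x in lborel. K x = K' x" using ae0 K0' by eventually_elim simp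
  have Km: "K \<in> borel_measurable lebesgue"
    using borel_measurable_AE[OF K0m] ae0 by (simp add: AE_completion_iff)
  note [measurable] = b(2)
  have b_int: "integrable lborel b"
    using b(3,4) emeasure_lborel_cball_finite[of c R]
    by (intro integrableI_bounded_set[where A="cball c R" and B=m]) (auto simp: dist_norm norm_minus_commute)
  have suppb: "supp b \<subseteq> cball c R"
    using b(3) by (intro supp_subset) (auto simp: dist_norm norm_minus_commute not_le)
  have cs: "compact (supp b)"
    by (rule compact_suppI[of "cball c R"]) (use b(3) in \<open>auto simp: dist_norm norm_minus_commute not_le\<close>)
  have ae: "AE x in lebesgue. x \<notin> supp b \<longrightarrow> T b x = (\<integral>y. K (x - y) * b y \<partial>lebesgue)"
    using T b(1) cs b_int by (auto simp: singular_integral_operator_def integrable_completion)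
  have Tb: "ennreal (norm (\<integral>y. K (x - y) * b y \<partial>lebesgue)) \<le> (\<integral>\<^sup>+y. ennreal (norm (K' (x - y) - K' (x - c))) * ennreal (norm (b y)) \<partial>lborel)"
    if x: "2 * R \<le> norm (x - c)" for x
  proof -
    have K'x: "AE y in lborel. K (x - y) = K' (x - y)" by (rule AE_lborel_reflect[OF KK'])
    have "(\<integral>y. K (x - y) * b y \<partial>lebesgue) = (\<integral>y. K' (x - y) * b y \<partial>lebesgue)"
    proof (rule integral_cong_AE)
      have *: "(\<lambda>y. K' (x - y) * b y) \<in> borel_measurable borel" by measurable
      then show m: "(\<lambda>y. K' (x - y) * b y) \<in> borel_measurable lebesgue" by (intro measurable_completion) simp
      have "AE y in lborel. K' (x - y) * b y = K (x - y) * b y"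
        using K'x by eventually_elim simp
      then have ae: "AE y in lebesgue. K' (x - y) * b y = K (x - y) * b y"
        by (rule AE_completion)
      then show "(\<lambda>y. K (x - y) * b y) \<in> borel_measurable lebesgue"
        by (rule borel_measurable_AE[OF m])
      show "AE y in lebesgue. K (x - y) * b y = K' (x - y) * b y"
        using ae by eventually_elim (rule sym)
    qed
    also have "\<dots> = (\<integral>y. K' (x - y) * b y \<partial>lborel)"
      by (rule integral_completion) measurable
    also have "\<dots> = (\<integral>y. K' (x - y) * b y - K' (x - c) * b y \<partial>lborel)"
    proof -
      \<comment> \<open>Splitting the integral of the difference needs both terms integrable. On the
        support of b one has \<open>norm (x - y) \<ge> R\<close>, so the size condition bounds the
        kernel; the absolute value of A spares a sign assumption.\<close>
      have "integrable lborel (\<lambda>y. K' (x - y) * b y)"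
      proof (rule integrableI_bounded_set[where A="cball c R" and B="\<bar>A\<bar> / R ^ CARD('n) * m"])
        show "AE y in lborel. y \<in> cball c R \<longrightarrow> norm (K' (x - y) * b y) \<le> \<bar>A\<bar> / R ^ CARD('n) * m"
          using K'x
        proof eventually_elim
          case (elim y)
          show ?case
          proof
            assume "y \<in> cball c R"
            moreover have "norm (x - c) \<le> norm (x - y) + norm (c - y)" by norm
            ultimately have xy: "R \<le> norm (x - y)" using x by (simp add: dist_norm)
            then have "norm (K (x - y)) \<le> A / norm (x - y) ^ CARD('n)" using R by (intro size) auto
            also have "\<dots> \<le> \<bar>A\<bar> / R ^ CARD('n)"
              using xy R by (intro frac_le power_mono) auto
            finally show "norm (K' (x - y) * b y) \<le> \<bar>A\<bar> / R ^ CARD('n) * m"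
              unfolding elim[symmetric] norm_mult using b(4)[of y] R by (intro mult_mono) auto
          qed
        qed
      qed (use b(3) emeasure_lborel_cball_finite[of c R] in \<open>auto simp: dist_norm norm_minus_commute\<close>)
      then show ?thesis
        using b_int mean by (simp add: Bochner_Integration.integral_diff)
    qed
    finally have "ennreal (norm (\<integral>y. K (x - y) * b y \<partial>lebesgue)) = ennreal (norm (\<integral>y. K' (x - y) * b y - K' (x - c) * b y \<partial>lborel))"
      by simp
    \<comment> \<open>Without integrability the Bochner integral is 0 and the bound is
      trivial.\<close>
    also have "\<dots> \<le> (\<integral>\<^sup>+y. ennreal (norm (K' (x - y) * b y - K' (x - c) * b y)) \<partial>lborel)"
      by (cases "integrable lborel (\<lambda>y. K' (x - y) * b y - K' (x - c) * b y)")
         (auto intro: integral_norm_bound_ennreal simp: not_integrable_integral_eq)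
    also have "\<dots> = (\<integral>\<^sup>+y. ennreal (norm (K' (x - y) - K' (x - c))) * ennreal (norm (b y)) \<partial>lborel)"
      by (simp add: left_diff_distrib[symmetric] norm_mult ennreal_mult)
    finally show ?thesis .
  qed
  have "(\<integral>\<^sup>+ x\<in>{x. 2 * R \<le> norm (x - c)}. ennreal (norm (T b x)) \<partial>lebesgue) \<le>
    (\<integral>\<^sup>+ x. (\<integral>\<^sup>+y. ennreal (norm (K' (x - y) - K' (x - c))) * ennreal (norm (b y)) * indicator {x. 2 * R \<le> norm (x - c)} x \<partial>lborel) \<partial>lebesgue)"
  proof (rule nn_integral_mono_AE)
    show "AE x in lebesgue. ennreal (norm (T b x)) * indicator {x. 2 * R \<le> norm (x - c)} x \<le>
      (\<integral>\<^sup>+y. ennreal (norm (K' (x - y) - K' (x - c))) * ennreal (norm (b y)) * indicator {x. 2 * R \<le> norm (x - c)} x \<partial>lborel)"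
      using ae
    proof eventually_elim
      case (elim x)
      show ?case
      proof (cases "2 * R \<le> norm (x - c)")
        case True
        then have "x \<notin> supp b" using suppb R by (auto simp: dist_norm norm_minus_commute)
        then show ?thesis using elim Tb[OF True] True by simp
      qed simp
    qed
  qed
  also have "\<dots> = (\<integral>\<^sup>+ x. (\<integral>\<^sup>+y. ennreal (norm (K' (x - y) - K' (x - c))) * ennreal (norm (b y)) * indicator {x. 2 * R \<le> norm (x - c)} x \<partial>lborel) \<partial>lborel)"
    by (rule nn_integral_completion)
  also have "\<dots> = (\<integral>\<^sup>+ y. (\<integral>\<^sup>+x. ennreal (norm (K' (x - y) - K' (x - c))) * ennreal (norm (b y)) * indicator {x. 2 * R \<le> norm (x - c)} x \<partial>lborel) \<partial>lborel)"
    by (rule lborel_pair.Fubini') measurable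
  also have "\<dots> = (\<integral>\<^sup>+ y. ennreal (norm (b y)) * hormander_integral R K' (y - c) \<partial>lborel)"
  proof (intro nn_integral_cong)
    fix y
    have "(\<integral>\<^sup>+x. ennreal (norm (K' (x - y) - K' (x - c))) * ennreal (norm (b y)) * indicator {x. 2 * R \<le> norm (x - c)} x \<partial>lborel)
      = (\<integral>\<^sup>+x. ennreal (norm (K' ((x + c) - y) - K' ((x + c) - c))) * ennreal (norm (b y)) * indicator {x. 2 * R \<le> norm (x - c)} (x + c) \<partial>lborel)"
      by (rule nn_integral_lborel_shift[symmetric]) measurable
    also have "\<dots> = (\<integral>\<^sup>+x. ennreal (norm (b y)) * (ennreal (norm (K' (x - (y - c)) - K' x)) * indicator {x. 2 * R \<le> norm x} x) \<partial>lborel)"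
      by (intro nn_integral_cong) (auto simp: algebra_simps split: split_indicator)
    also have "\<dots> = ennreal (norm (b y)) * hormander_integral R K' (y - c)"
      unfolding hormander_integral_def nn_integral_completion by (rule nn_integral_cmult) measurable
    finally show "(\<integral>\<^sup>+x. ennreal (norm (K' (x - y) - K' (x - c))) * ennreal (norm (b y)) * indicator {x. 2 * R \<le> norm (x - c)} x \<partial>lborel) = \<dots>" .
  qed
  also have "\<dots> = (\<integral>\<^sup>+ y. ennreal (norm (b (y + c))) * hormander_integral R K' (y + c - c) \<partial>lborel)"
  proof (rule nn_integral_lborel_shift[symmetric])
    note [measurable] = hormander_integral_measurable[OF K', of R]
    show "(\<lambda>y. ennreal (norm (b y)) * hormander_integral R K' (y - c)) \<in> borel_measurable borel" by measurable
  qed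
  also have "\<dots> = (\<integral>\<^sup>+ y. ennreal (norm (b (y + c))) * hormander_integral R K y \<partial>lborel)"
    using hormander_integral_cong[OF KK', of R] by simp
  also have "\<dots> \<le> ennreal (t * W) * ((\<integral>\<^sup>+ y. ennreal ((norm (b (y + c)) / t) powr q) \<partial>lborel)
      + ennreal (measure lebesgue (ball (0 :: real ^ 'n) 1) * R ^ CARD('n)))"
    by (rule hormander_integral_Hr_bound[OF Km H q q' W R t]) (measurable, use b(3) in simp)
  also have "(\<integral>\<^sup>+ y. ennreal ((norm (b (y + c)) / t) powr q) \<partial>lborel) = (\<integral>\<^sup>+ y. ennreal ((norm (b y) / t) powr q) \<partial>lborel)"
    by (rule nn_integral_lborel_shift) measurable
  finally show ?thesis .
qed

subsection \<open>The weak-type estimate on test functions\<close>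

text \<open>Above t the factor \<open>(u / t) powr (q - 1)\<close> is at least 1. This elementary
  splitting takes the place of Jensen's inequality in bounding a mean by a q-th power mean.\<close>

lemma le_add_powr:
  fixes u t q :: real
  assumes "0 \<le> u" "0 < t" "1 \<le> q"
  shows "u \<le> t + t powr (1 - q) * u powr q"
proof (cases "u \<le> t")
  case False
  then have u: "0 < u" using assms by linarith
  have "u = u powr (1 - q) * u powr q" using u by (simp flip: powr_add)
  also have "\<dots> \<le> t powr (1 - q) * u powr q"
    using False assms by (intro mult_right_mono powr_mono2') auto
  finally show ?thesis using assms by linarith
qed (use assms in \<open>simp add: add_increasing2\<close>)

section \<open>Averages and bad parts on cubes\<close>

definition cube_average :: "(real ^ 'n \<Rightarrow> complex) \<Rightarrow> (real ^ 'n) set \<Rightarrow> complex" where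
  "cube_average \<phi> Q = (\<integral>y. indicator Q y *\<^sub>R \<phi> y \<partial>lborel) / of_real (measure lborel Q)"

definition bad_part :: "(real ^ 'n \<Rightarrow> complex) \<Rightarrow> (real ^ 'n) set \<Rightarrow> real ^ 'n \<Rightarrow> complex" where
  "bad_part \<phi> Q y = indicator Q y *\<^sub>R (\<phi> y - cube_average \<phi> Q)"

lemma integrable_test_function:
  assumes "\<phi> \<in> test_functions"
  shows "integrable lborel \<phi>"
proof -
  have "\<phi> \<in> Lp (ennreal 1)" using assms by (rule test_function_Lp) simp
  then have "(\<integral>\<^sup>+ x. ennreal (norm (\<phi> x)) \<partial>lborel) < \<infinity>"
    by (simp add: Lp_iff nn_integral_completion del: ennreal_1)
  then show ?thesis
    using test_function_borel[OF assms] by (intro integrableI_bounded) auto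
qed

lemma measure_dcube:
  fixes x :: "real ^ 'n"
  shows "0 < s \<Longrightarrow> measure lborel (dcube s x) = s ^ CARD('n)"
  by (simp add: measure_def emeasure_dcube)

text \<open>Origin of G: integrating \<open>le_add_powr\<close> over the cube bounds the mean by
  \<open>t + 2 ^ CARD('n) * t\<close>, and \<open>1 + 2 ^ n \<le> 2 ^ (n + 1)\<close>.\<close>

lemma cube_average_bound:
  fixes \<phi> :: "real ^ 'n \<Rightarrow> complex"
  assumes \<phi>: "\<phi> \<in> test_functions" and q: "1 \<le> q" and t: "0 < t" and s: "0 < s" and Q: "Q = dcube s x"
    and le: "(\<integral>\<^sup>+y\<in>Q. ennreal (norm (\<phi> y) powr q) \<partial>lborel) \<le> ennreal (2 ^ CARD('n) * t powr q) * emeasure lborel Q"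
  shows "norm (cube_average \<phi> Q) \<le> 2 ^ (CARD('n) + 1) * t"
proof -
  note [measurable] = test_function_borel[OF \<phi>]
  have Qm [measurable]: "Q \<in> sets borel" unfolding Q by (rule dcube_borel[OF s])
  define \<mu> where "\<mu> = s ^ CARD('n)"
  have \<mu>: "0 < \<mu>" "emeasure lborel Q = ennreal \<mu>" "measure lborel Q = \<mu>"
    using s by (simp_all add: \<mu>_def Q emeasure_dcube measure_dcube)
  have "ennreal (norm (\<integral>y. indicator Q y *\<^sub>R \<phi> y \<partial>lborel)) \<le> (\<integral>\<^sup>+y. ennreal (norm (indicator Q y *\<^sub>R \<phi> y)) \<partial>lborel)"
    by (rule integral_norm_bound_ennreal) (intro integrable_mult_indicator integrable_test_function[OF \<phi>], simp)
  also have "\<dots> \<le> (\<integral>\<^sup>+y. ennreal t * indicator Q y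
      + ennreal (t powr (1 - q)) * (ennreal (norm (\<phi> y) powr q) * indicator Q y) \<partial>lborel)"
    using le_add_powr[OF norm_ge_zero t q] t
    by (intro nn_integral_mono) (auto split: split_indicator simp flip: ennreal_mult ennreal_plus intro!: ennreal_leI)
  also have "\<dots> = ennreal t * emeasure lborel Q + ennreal (t powr (1 - q)) * (\<integral>\<^sup>+y\<in>Q. ennreal (norm (\<phi> y) powr q) \<partial>lborel)"
    by (subst nn_integral_add; (subst nn_integral_cmult)?; (subst nn_integral_cmult_indicator)?; simp)
  also have "\<dots> \<le> ennreal t * emeasure lborel Q + ennreal (t powr (1 - q)) * (ennreal (2 ^ CARD('n) * t powr q) * emeasure lborel Q)"
    by (intro add_mono mult_left_mono le) auto
  also have "\<dots> = ennreal ((1 + 2 ^ CARD('n)) * t * \<mu>)"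
  proof -
    have "t powr (1 - q) * t powr q = t" using t by (simp flip: powr_add)
    then have "t * \<mu> + t powr (1 - q) * (2 ^ CARD('n) * t powr q * \<mu>) = (1 + 2 ^ CARD('n)) * t * \<mu>"
      by (simp add: algebra_simps)
    then show ?thesis using \<mu> t by (simp flip: ennreal_mult ennreal_plus)
  qed
  finally have "norm (\<integral>y. indicator Q y *\<^sub>R \<phi> y \<partial>lborel) \<le> (1 + 2 ^ CARD('n)) * t * \<mu>"
    using t \<mu> by (simp add: ennreal_le_iff)
  then have "norm (cube_average \<phi> Q) \<le> (1 + 2 ^ CARD('n)) * t"
    using \<mu> by (simp add: cube_average_def norm_divide divide_le_eq)
  also have "\<dots> \<le> 2 ^ (CARD('n) + 1) * t"
    using t by (intro mult_right_mono) auto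
  finally show ?thesis .
qed

lemma bad_part_borel:
  assumes "\<phi> \<in> test_functions" "Q \<in> sets borel"
  shows "bad_part \<phi> Q \<in> borel_measurable borel"
proof -
  note [measurable] = test_function_borel[OF assms(1)] assms(2)
  show ?thesis unfolding bad_part_def[abs_def] by measurable
qed

lemma integral_bad_part:
  assumes \<phi>: "\<phi> \<in> test_functions" and s: "0 < s" and Q: "Q = dcube s x"
  shows "(\<integral>y. bad_part \<phi> Q y \<partial>lborel) = 0"
proof -
  have Qm: "Q \<in> sets lborel" unfolding Q using dcube_borel[OF s] by simp
  have \<mu>: "0 < measure lborel Q" "emeasure lborel Q < \<infinity>"
    using s by (simp_all add: Q emeasure_dcube measure_dcube)
  have 1: "integrable lborel (\<lambda>y. indicator Q y *\<^sub>R \<phi> y)"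
    using Qm by (intro integrable_mult_indicator integrable_test_function[OF \<phi>])
  have 2: "integrable lborel (\<lambda>y. indicator Q y *\<^sub>R cube_average \<phi> Q)"
    using Qm \<mu> by (intro integrable_scaleR_left integrable_real_indicator) auto
  have "(\<integral>y. bad_part \<phi> Q y \<partial>lborel) = (\<integral>y. indicator Q y *\<^sub>R \<phi> y \<partial>lborel) - (\<integral>y. indicator Q y *\<^sub>R cube_average \<phi> Q \<partial>lborel)"
    unfolding bad_part_def scaleR_diff_right by (rule Bochner_Integration.integral_diff[OF 1 2])
  also have "(\<integral>y. indicator Q y *\<^sub>R cube_average \<phi> Q \<partial>lborel) = measure lborel Q *\<^sub>R cube_average \<phi> Q"
    using Qm \<mu> by (simp add: integral_scaleR_left)
  finally show ?thesis using \<mu> by (simp add: cube_average_def scaleR_conv_of_real)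
qed

text \<open>On Q the bad part is at most \<open>norm (\<phi> y) + G * t\<close>. Splitting the power
  costs \<open>2 powr q\<close>; the term \<open>2 ^ CARD('n)\<close> is the upper bound on the mass
  of Q, and \<open>G powr q\<close> comes from the average.\<close>

lemma nn_integral_bad_part:
  fixes \<phi> :: "real ^ 'n \<Rightarrow> complex"
  assumes \<phi>: "\<phi> \<in> test_functions" and q: "1 \<le> q" and t: "0 < t" and s: "0 < s" and Q: "Q = dcube s x"
    and le: "(\<integral>\<^sup>+y\<in>Q. ennreal (norm (\<phi> y) powr q) \<partial>lborel) \<le> ennreal (2 ^ CARD('n) * t powr q) * emeasure lborel Q"
    and G: "G = 2 ^ (CARD('n) + 1)"
  shows "(\<integral>\<^sup>+y. ennreal ((norm (bad_part \<phi> Q y) / t) powr q) \<partial>lborel) \<le> ennreal (2 powr q * (2 ^ CARD('n) + G powr q) * s ^ CARD('n))"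
proof -
  note [measurable] = test_function_borel[OF \<phi>]
  have Qm [measurable]: "Q \<in> sets borel" unfolding Q by (rule dcube_borel[OF s])
  have G0: "0 < G" by (simp add: G)
  have av: "norm (cube_average \<phi> Q) \<le> G * t"
    using cube_average_bound[OF \<phi> q t s Q le] by (simp add: G)
  have "(\<integral>\<^sup>+y. ennreal ((norm (bad_part \<phi> Q y) / t) powr q) \<partial>lborel) \<le>
    (\<integral>\<^sup>+y. ennreal (2 powr q * t powr - q) * (ennreal (norm (\<phi> y) powr q) * indicator Q y)
        + ennreal (2 powr q * G powr q) * indicator Q y \<partial>lborel)"
  proof (rule nn_integral_mono)
    fix y
    show "ennreal ((norm (bad_part \<phi> Q y) / t) powr q) \<le> ennreal (2 powr q * t powr - q) * (ennreal (norm (\<phi> y) powr q) * indicator Q y)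
        + ennreal (2 powr q * G powr q) * indicator Q y"
    proof (cases "y \<in> Q")
      case True
      have "norm (bad_part \<phi> Q y) / t \<le> norm (\<phi> y) / t + G"
        using True norm_triangle_ineq4[of "\<phi> y" "cube_average \<phi> Q"] av t
        by (simp add: bad_part_def field_simps)
      then have "(norm (bad_part \<phi> Q y) / t) powr q \<le> (norm (\<phi> y) / t + G) powr q"
        using t q by (intro powr_mono2) auto
      also have "\<dots> \<le> 2 powr q * ((norm (\<phi> y) / t) powr q + G powr q)"
        using t q G0 by (intro powr_add_le_2) auto
      also have "(norm (\<phi> y) / t) powr q = t powr - q * norm (\<phi> y) powr q"
        using t by (simp add: powr_divide powr_minus_divide)
      finally show ?thesis
        using True by (simp add: algebra_simps flip: ennreal_mult ennreal_plus)
    qed (simp add: bad_part_def)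
  qed
  also have "\<dots> = ennreal (2 powr q * t powr - q) * (\<integral>\<^sup>+y\<in>Q. ennreal (norm (\<phi> y) powr q) \<partial>lborel) + ennreal (2 powr q * G powr q) * emeasure lborel Q"
    by (subst nn_integral_add; (subst nn_integral_cmult)?; (subst nn_integral_cmult_indicator)?; simp)
  also have "\<dots> \<le> ennreal (2 powr q * t powr - q) * (ennreal (2 ^ CARD('n) * t powr q) * emeasure lborel Q) + ennreal (2 powr q * G powr q) * emeasure lborel Q"
    by (intro add_mono mult_left_mono le) auto
  also have "\<dots> = ennreal (2 powr q * (2 ^ CARD('n) + G powr q) * s ^ CARD('n))"
  proof -
    have "t powr - q * t powr q = 1" using t by (simp flip: powr_add)
    then have "2 powr q * t powr - q * (2 ^ CARD('n) * t powr q * s ^ CARD('n)) + 2 powr q * G powr q * s ^ CARD('n) =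
      2 powr q * (2 ^ CARD('n) + G powr q) * s ^ CARD('n)"
      by (simp add: algebra_simps)
    then show ?thesis using s by (simp add: Q emeasure_dcube flip: ennreal_mult ennreal_plus)
  qed
  finally show ?thesis .
qed

text \<open>From here on the cubes survive only as indices with a side \<open>l Q\<close> and a base
  point \<open>c Q\<close>. Supports are described by balls because the kernel condition is. The
  last conclusion sums the lower bounds over the disjoint cubes; it will control both the
  exceptional set and the bad parts.\<close>

lemma Calderon_Zygmund_decomposition:
  fixes \<phi> :: "real ^ 'n \<Rightarrow> complex"
  assumes \<phi>: "\<phi> \<in> test_functions" and q: "1 \<le> q" and t: "0 < t" and G: "G = 2 ^ (CARD('n) + 1)"
  obtains \<Q> :: "(real ^ 'n) set set" and m l b c where "finite \<Q>" "0 \<le> m"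
    "\<And>Q. Q \<in> \<Q> \<Longrightarrow> 0 < (l Q :: real)"
    "\<And>Q. Q \<in> \<Q> \<Longrightarrow> b Q \<in> borel_measurable borel"
    "\<And>Q y. Q \<in> \<Q> \<Longrightarrow> norm (b Q y) \<le> m"
    "\<And>Q y. Q \<in> \<Q> \<Longrightarrow> real CARD('n) * l Q < norm (y - c Q) \<Longrightarrow> b Q y = 0"
    "\<And>Q. Q \<in> \<Q> \<Longrightarrow> (\<integral>y. b Q y \<partial>lborel) = 0"
    "\<And>Q. Q \<in> \<Q> \<Longrightarrow> (\<integral>\<^sup>+y. ennreal ((norm (b Q y) / t) powr q) \<partial>lborel) \<le> ennreal (2 powr q * (2 ^ CARD('n) + G powr q) * l Q ^ CARD('n))"
    "\<And>y. norm (\<phi> y - (\<Sum>Q\<in>\<Q>. b Q y)) \<le> G * t"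
    "(\<integral>\<^sup>+y. ennreal (norm (\<phi> y - (\<Sum>Q\<in>\<Q>. b Q y)) powr q) \<partial>lborel) \<le> ennreal (1 + G powr q) * (\<integral>\<^sup>+y. ennreal (norm (\<phi> y) powr q) \<partial>lborel)"
    "ennreal (t powr q * (\<Sum>Q\<in>\<Q>. l Q ^ CARD('n))) \<le> (\<integral>\<^sup>+y. ennreal (norm (\<phi> y) powr q) \<partial>lborel)"
proof -
  obtain \<Q> where fin: "finite \<Q>" and disj: "disjoint \<Q>" and cube: "\<And>Q. Q \<in> \<Q> \<Longrightarrow> \<exists>s x. 0 < s \<and> Q = dcube s x"
    and lower: "\<And>Q. Q \<in> \<Q> \<Longrightarrow> ennreal (t powr q) * emeasure lborel Q \<le> (\<integral>\<^sup>+y\<in>Q. ennreal (norm (\<phi> y) powr q) \<partial>lborel)"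
    and upper: "\<And>Q. Q \<in> \<Q> \<Longrightarrow> (\<integral>\<^sup>+y\<in>Q. ennreal (norm (\<phi> y) powr q) \<partial>lborel) \<le> ennreal (2 ^ CARD('n) * t powr q) * emeasure lborel Q"
    and off: "\<And>x. x \<notin> \<Union>\<Q> \<Longrightarrow> norm (\<phi> x) \<le> 2 * t"
    using Calderon_Zygmund_cubes[OF \<phi> q t] by blast
  obtain l x where lx: "\<And>Q. Q \<in> \<Q> \<Longrightarrow> 0 < l Q" "\<And>Q. Q \<in> \<Q> \<Longrightarrow> Q = dcube (l Q) (x Q)"
    using cube by metis
  note [measurable] = test_function_borel[OF \<phi>]
  have Qm: "Q \<in> sets borel" if "Q \<in> \<Q>" for Q
    using dcube_borel[OF lx(1)[OF that], of "x Q"] lx(2)[OF that] by simp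
  have \<mu>: "emeasure lborel Q = ennreal (l Q ^ CARD('n))" if "Q \<in> \<Q>" for Q
    using emeasure_dcube[OF lx(1)[OF that], of "x Q"] lx(2)[OF that] by simp
  obtain r m where rm: "0 < r" "0 < m" "\<And>x. norm (\<phi> x) \<le> m" "\<And>x. r < norm x \<Longrightarrow> \<phi> x = 0"
    using test_function_bounds[OF \<phi>] by blast
  have G2: "2 \<le> G" using power_increasing[of 1 "CARD('n) + 1" "2::real"] by (simp add: G)
  have av: "norm (cube_average \<phi> Q) \<le> G * t" if "Q \<in> \<Q>" for Q
    using cube_average_bound[OF \<phi> q t lx(1)[OF that] lx(2)[OF that] upper[OF that]] by (simp add: G)
  let ?I = "\<integral>\<^sup>+y. ennreal (norm (\<phi> y) powr q) \<partial>lborel"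
  let ?g = "\<lambda>y. \<phi> y - (\<Sum>Q\<in>\<Q>. bad_part \<phi> Q y)"
  \<comment> \<open>At a point of Q disjointness removes every other summand; this one fact
    evaluates the good part, the indicator sums and the mass sums.\<close>
  have sum_in: "(\<Sum>P\<in>\<Q>. f P y) = f Q y"
    if "Q \<in> \<Q>" "y \<in> Q" "\<And>P. y \<notin> P \<Longrightarrow> f P y = 0" for f :: "_ \<Rightarrow> _ \<Rightarrow> 'c :: comm_monoid_add" and Q y
  proof -
    have "f P y = 0" if "P \<in> \<Q> - {Q}" for P
      using that disj \<open>Q \<in> \<Q>\<close> \<open>y \<in> Q\<close> by (intro \<open>\<And>P. y \<notin> P \<Longrightarrow> f P y = 0\<close>) (auto simp: disjoint_def)
    then show ?thesis using fin \<open>Q \<in> \<Q>\<close> by (simp add: sum.remove)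
  qed
  have g_in: "?g y = cube_average \<phi> Q" if "Q \<in> \<Q>" "y \<in> Q" for Q y
    using sum_in[OF that, of "bad_part \<phi>"] that by (simp add: bad_part_def)
  have g_off: "?g y = \<phi> y" if "y \<notin> \<Union>\<Q>" for y
    using that by (simp add: bad_part_def)
  have sum_le: "(\<Sum>Q\<in>\<Q>. \<integral>\<^sup>+y\<in>Q. ennreal (norm (\<phi> y) powr q) \<partial>lborel) \<le> ?I"
  proof -
    have "(\<Sum>Q\<in>\<Q>. \<integral>\<^sup>+y\<in>Q. ennreal (norm (\<phi> y) powr q) \<partial>lborel) = (\<integral>\<^sup>+y. (\<Sum>Q\<in>\<Q>. ennreal (norm (\<phi> y) powr q) * indicator Q y) \<partial>lborel)"
    proof (rule nn_integral_sum[symmetric])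
      fix Q assume "Q \<in> \<Q>"
      note [measurable] = Qm[OF this]
      show "(\<lambda>y. ennreal (norm (\<phi> y) powr q) * indicator Q y) \<in> borel_measurable lborel" by measurable
    qed
    also have "\<dots> \<le> ?I"
    proof (rule nn_integral_mono)
      fix y
      show "(\<Sum>Q\<in>\<Q>. ennreal (norm (\<phi> y) powr q) * indicator Q y) \<le> ennreal (norm (\<phi> y) powr q)"
      proof (cases "y \<in> \<Union>\<Q>")
        case True
        then obtain Q where "Q \<in> \<Q>" "y \<in> Q" by blast
        then show ?thesis
          using sum_in[of Q y "\<lambda>Q y. ennreal (norm (\<phi> y) powr q) * indicator Q y"] by simp
      qed simp
    qed
    finally show ?thesis .
  qed
  have last: "ennreal (t powr q * (\<Sum>Q\<in>\<Q>. l Q ^ CARD('n))) \<le> ?I"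
  proof -
    have "ennreal (t powr q * (\<Sum>Q\<in>\<Q>. l Q ^ CARD('n))) = (\<Sum>Q\<in>\<Q>. ennreal (t powr q * l Q ^ CARD('n)))"
      using lx(1) by (subst sum_ennreal) (auto simp: sum_distrib_left less_imp_le)
    also have "\<dots> = (\<Sum>Q\<in>\<Q>. ennreal (t powr q) * emeasure lborel Q)"
      using lx(1) by (intro sum.cong) (auto simp: \<mu> ennreal_mult less_imp_le)
    also have "\<dots> \<le> (\<Sum>Q\<in>\<Q>. \<integral>\<^sup>+y\<in>Q. ennreal (norm (\<phi> y) powr q) \<partial>lborel)"
      by (intro sum_mono lower)
    also note sum_le
    finally show ?thesis .
  qed
  show ?thesis
  proof (rule that[of \<Q> "m + G * t" l "bad_part \<phi>" "\<lambda>Q. corner (l Q) (x Q)"])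
    show "norm (?g y) \<le> G * t" for y
    proof (cases "y \<in> \<Union>\<Q>")
      case True
      then show ?thesis using g_in av by fastforce
    next
      case False
      have "norm (\<phi> y) \<le> 2 * t" using off[OF False] .
      also have "\<dots> \<le> G * t" using G2 t by (intro mult_right_mono) auto
      finally show ?thesis using g_off[OF False] by simp
    qed
    show "(\<integral>\<^sup>+y. ennreal (norm (?g y) powr q) \<partial>lborel) \<le> ennreal (1 + G powr q) * ?I"
    proof -
      have "(\<integral>\<^sup>+y. ennreal (norm (?g y) powr q) \<partial>lborel) \<le>
        (\<integral>\<^sup>+y. ennreal (norm (\<phi> y) powr q) + (\<Sum>Q\<in>\<Q>. ennreal ((G * t) powr q) * indicator Q y) \<partial>lborel)"
      proof (rule nn_integral_mono)
        fix y
        show "ennreal (norm (?g y) powr q) \<le> ennreal (norm (\<phi> y) powr q) + (\<Sum>Q\<in>\<Q>. ennreal ((G * t) powr q) * indicator Q y)"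
        proof (cases "y \<in> \<Union>\<Q>")
          case True
          then obtain Q where Q: "Q \<in> \<Q>" "y \<in> Q" by blast
          have "ennreal (norm (?g y) powr q) \<le> ennreal ((G * t) powr q)"
            unfolding g_in[OF Q] using av[OF Q(1)] q by (intro ennreal_leI powr_mono2) auto
          also have "\<dots> = (\<Sum>Q\<in>\<Q>. ennreal ((G * t) powr q) * indicator Q y)"
            using sum_in[OF Q, of "\<lambda>Q y. ennreal ((G * t) powr q) * indicator Q y"] Q by simp
          finally show ?thesis by (simp add: add_increasing)
        qed (simp add: g_off)
      qed
      also have "\<dots> = ?I + (\<Sum>Q\<in>\<Q>. \<integral>\<^sup>+y. ennreal ((G * t) powr q) * indicator Q y \<partial>lborel)"
        using Qm by (subst nn_integral_add) (auto simp: nn_integral_sum)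
      \<comment> \<open>Regrouped so that the lower bound turns \<open>t powr q\<close> times the
        volume into the mass of \<open>\<phi>\<close> on the cube.\<close>
      also have "(\<Sum>Q\<in>\<Q>. \<integral>\<^sup>+y. ennreal ((G * t) powr q) * indicator Q y \<partial>lborel) = (\<Sum>Q\<in>\<Q>. ennreal (G powr q) * (ennreal (t powr q) * emeasure lborel Q))"
      proof (rule sum.cong[OF refl])
        fix Q assume "Q \<in> \<Q>"
        then have "Q \<in> sets lborel" using Qm by simp
        then show "(\<integral>\<^sup>+y. ennreal ((G * t) powr q) * indicator Q y \<partial>lborel) = ennreal (G powr q) * (ennreal (t powr q) * emeasure lborel Q)"
          using G2 t by (subst nn_integral_cmult_indicator) (simp_all add: powr_mult ennreal_mult mult.assoc)
      qed
      also have "\<dots> \<le> (\<Sum>Q\<in>\<Q>. ennreal (G powr q) * (\<integral>\<^sup>+y\<in>Q. ennreal (norm (\<phi> y) powr q) \<partial>lborel))"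
        by (intro sum_mono mult_left_mono lower) auto
      also have "\<dots> \<le> ennreal (G powr q) * ?I"
        unfolding sum_distrib_left[symmetric] by (intro mult_left_mono sum_le) auto
      also have "?I + ennreal (G powr q) * ?I = ennreal (1 + G powr q) * ?I"
        by (simp add: distrib_right)
      finally show ?thesis by (simp add: add_left_mono)
    qed
    show "ennreal (t powr q * (\<Sum>Q\<in>\<Q>. l Q ^ CARD('n))) \<le> ?I" by (rule last)
    show "finite \<Q>" by (rule fin)
    show "0 \<le> m + G * t" using rm G2 t by simp
    fix Q assume Q: "Q \<in> \<Q>"
    show "0 < l Q" using lx(1)[OF Q] .
    show "bad_part \<phi> Q \<in> borel_measurable borel" by (rule bad_part_borel[OF \<phi> Qm[OF Q]])
    show "(\<integral>y. bad_part \<phi> Q y \<partial>lborel) = 0" by (rule integral_bad_part[OF \<phi> lx(1)[OF Q] lx(2)[OF Q]])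
    show "(\<integral>\<^sup>+y. ennreal ((norm (bad_part \<phi> Q y) / t) powr q) \<partial>lborel) \<le> ennreal (2 powr q * (2 ^ CARD('n) + G powr q) * l Q ^ CARD('n))"
      by (rule nn_integral_bad_part[OF \<phi> q t lx(1)[OF Q] lx(2)[OF Q] upper[OF Q] G])
    fix y
    show "norm (bad_part \<phi> Q y) \<le> m + G * t"
    proof (cases "y \<in> Q")
      case True
      have "norm (\<phi> y - cube_average \<phi> Q) \<le> norm (\<phi> y) + norm (cube_average \<phi> Q)" by (rule norm_triangle_ineq4)
      also have "\<dots> \<le> m + G * t" by (intro add_mono rm av Q)
      finally show ?thesis using True by (simp add: bad_part_def)
    qed (use rm G2 t in \<open>simp add: bad_part_def\<close>)
    show "bad_part \<phi> Q y = 0" if "real CARD('n) * l Q < norm (y - corner (l Q) (x Q))"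
    proof -
      have "y \<notin> dcube (l Q) (x Q)" using norm_diff_corner_le[OF lx(1)[OF Q], of y "x Q"] that by auto
      then show ?thesis using lx(2)[OF Q] by (simp add: bad_part_def)
    qed
  qed
qed

text \<open>Each use of additivity has its own exceptional null set; a finite sum meets finitely
  many of them.\<close>

lemma linear_operator_sum:
  assumes lin: "ae_linear_operator D T" and fin: "finite F" and f: "\<And>i. i \<in> F \<Longrightarrow> f i \<in> D"
  shows "(\<lambda>x. \<Sum>i\<in>F. f i x) \<in> D \<and> (AE x in lebesgue. T (\<lambda>x. \<Sum>i\<in>F. f i x) x = (\<Sum>i\<in>F. T (f i) x))"
  using fin f
proof (induction F)
  case empty
  have z: "(\<lambda>x. 0) \<in> D" using lin unfolding ae_linear_operator_def by blast
  \<comment> \<open>Homogeneity with scalar 0 gives that T maps 0 to 0 almost everywhere, which is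
    the empty sum.\<close>
  have "(AE x in lebesgue. T (\<lambda>x. 0 * 0) x = 0 * T (\<lambda>x. 0) x)"
    using bspec[OF spec[OF ae_linear_operatorD(4)[OF lin], of 0] z] by blast
  then show ?case using z by simp
next
  case (insert i F)
  then have F: "(\<lambda>x. \<Sum>i\<in>F. f i x) \<in> D" and ae: "AE x in lebesgue. T (\<lambda>x. \<Sum>i\<in>F. f i x) x = (\<Sum>i\<in>F. T (f i) x)"
    and fi: "f i \<in> D"
    by simp_all
  note * = bspec[OF bspec[OF ae_linear_operatorD(3)[OF lin] fi] F]
  from * have "(\<lambda>x. f i x + (\<Sum>i\<in>F. f i x)) \<in> D" by (rule conjunct1)
  moreover from * have "AE x in lebesgue. T (\<lambda>x. f i x + (\<Sum>i\<in>F. f i x)) x = T (f i) x + T (\<lambda>x. \<Sum>i\<in>F. f i x) x"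
    by (rule conjunct2)
  moreover from this ae have "AE x in lebesgue. T (\<lambda>x. f i x + (\<Sum>i\<in>F. f i x)) x = T (f i) x + (\<Sum>i\<in>F. T (f i) x)"
    by eventually_elim simp
  ultimately show ?case using insert.hyps by simp
qed

text \<open>The height \<open>\<beta> / W\<close> is matched to the operator bound. For infinite s
  the image is at most \<open>\<beta>\<close> a.e., and the level set is null. For finite s with
  value \<open>\<sigma>\<close>, Chebyshev's inequality at exponent \<open>\<sigma>\<close> is
  combined with \<open>norm (g y) powr \<sigma> \<le> (\<beta> / W) powr (\<sigma> - q) * norm (g y)
  powr q\<close>, which trades the surplus exponent for the height.\<close>

lemma good_part_bound:
  fixes g :: "real ^ 'n \<Rightarrow> complex"
  assumes bd: "bounded_on_Lp s B D T" and Tg: "T g \<in> borel_measurable lebesgue" and g: "g \<in> Lp s"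
    and q: "1 \<le> q" and s: "ennreal q < s" and B: "0 \<le> B" "B \<le> W" and W: "0 < W" and \<beta>: "0 < \<beta>"
    and gb: "\<And>y. norm (g y) \<le> \<beta> / W"
  shows "emeasure lebesgue {x. \<beta> < norm (T g x)} \<le> ennreal ((W / \<beta>) powr q) * (\<integral>\<^sup>+y. ennreal (norm (g y) powr q) \<partial>lebesgue)"
proof -
  note [measurable] = Tg Lp_measurable[OF g]
  have bd': "Lp_norm s (T g) \<le> ennreal B * Lp_norm s g"
    using bd g by (simp add: bounded_on_Lp_def)
  show ?thesis
  proof (cases s)
    case top
    have "esssup lebesgue (\<lambda>x. ennreal (norm (g x))) \<le> ennreal (\<beta> / W)"
      using gb by (intro esssup_I AE_I2 ennreal_leI) auto
    then have "Lp_norm s g \<le> ennreal (\<beta> / W)" using top by (simp add: Lp_norm_def)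
    from order_trans[OF bd' mult_left_mono[OF this]]
    have "Lp_norm s (T g) \<le> ennreal B * ennreal (\<beta> / W)" by simp
    also have "\<dots> \<le> ennreal \<beta>"
      using B W \<beta> by (simp add: field_simps flip: ennreal_mult)
    finally have le: "esssup lebesgue (\<lambda>x. ennreal (norm (T g x))) \<le> ennreal \<beta>"
      using top by (simp add: Lp_norm_def)
    have "AE x in lebesgue. \<not> \<beta> < norm (T g x)"
      using esssup_AE[where M=lebesgue and f="\<lambda>x. ennreal (norm (T g x))"]
    proof eventually_elim
      case (elim x)
      then have "ennreal (norm (T g x)) \<le> ennreal \<beta>" using le by (rule order_trans)
      then show ?case using \<beta> by (simp add: ennreal_le_iff not_less)
    qed
    then have "emeasure lebesgue {x. \<beta> < norm (T g x)} = 0"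
      using superlevel_set_lebesgue[OF Tg] by (subst (asm) AE_iff_measurable[OF _ refl]) auto
    then show ?thesis by simp
  next
    case (real \<sigma>)
    have \<sigma>: "q < \<sigma>" "1 \<le> \<sigma>" using s q real by (auto simp: ennreal_less_iff)
    let ?J = "\<lambda>(f :: real ^ 'n \<Rightarrow> complex) p. \<integral>\<^sup>+y. ennreal (norm (f y) powr p) \<partial>lebesgue"
    have TJ: "?J (T g) \<sigma> \<le> ennreal (W powr \<sigma>) * ?J g \<sigma>"
    proof -
      have "Lp_norm s (T g) \<le> ennreal W * Lp_norm s g"
        by (rule order_trans[OF bd']) (intro mult_right_mono ennreal_leI B, simp)
      then have "?J (T g) \<sigma> \<le> ennreal_powr (ennreal W * ennreal_powr (?J g \<sigma>) (1 / \<sigma>)) \<sigma>"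
        using \<sigma> real by (simp add: Lp_norm_ennreal ennreal_powr_le_iff)
      also have "\<dots> = ennreal (W powr \<sigma>) * ?J g \<sigma>"
        using \<sigma> W by (simp add: ennreal_powr_mult ennreal_powr_powr_inverse)
      finally show ?thesis .
    qed
    have gJ: "?J g \<sigma> \<le> ennreal ((\<beta> / W) powr (\<sigma> - q)) * ?J g q"
    proof -
      have "?J g \<sigma> \<le> (\<integral>\<^sup>+y. ennreal ((\<beta> / W) powr (\<sigma> - q)) * ennreal (norm (g y) powr q) \<partial>lebesgue)"
      proof (rule nn_integral_mono)
        fix y
        have "norm (g y) powr \<sigma> = norm (g y) powr (\<sigma> - q) * norm (g y) powr q" by (simp flip: powr_add)
        also have "\<dots> \<le> (\<beta> / W) powr (\<sigma> - q) * norm (g y) powr q"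
          using gb \<sigma> by (intro mult_right_mono powr_mono2) auto
        finally show "ennreal (norm (g y) powr \<sigma>) \<le> ennreal ((\<beta> / W) powr (\<sigma> - q)) * ennreal (norm (g y) powr q)"
          by (simp flip: ennreal_mult)
      qed
      also have "\<dots> = ennreal ((\<beta> / W) powr (\<sigma> - q)) * ?J g q" by (rule nn_integral_cmult) measurable
      finally show ?thesis .
    qed
    have "emeasure lebesgue {x. \<beta> < norm (T g x)} = (\<integral>\<^sup>+x. indicator {x. \<beta> < norm (T g x)} x \<partial>lebesgue)"
      using superlevel_set_lebesgue[OF Tg] by simp
    also have "\<dots> \<le> (\<integral>\<^sup>+x. ennreal (\<beta> powr - \<sigma>) * ennreal (norm (T g x) powr \<sigma>) \<partial>lebesgue)"
    proof (rule nn_integral_mono)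
      fix x
      have "1 \<le> \<beta> powr - \<sigma> * norm (T g x) powr \<sigma>" if "\<beta> < norm (T g x)"
      proof -
        have "\<beta> powr - \<sigma> * \<beta> powr \<sigma> \<le> \<beta> powr - \<sigma> * norm (T g x) powr \<sigma>"
          using that \<beta> \<sigma> by (intro mult_left_mono powr_mono2) auto
        then show ?thesis using \<beta> by (simp flip: powr_add)
      qed
      then show "indicator {x. \<beta> < norm (T g x)} x \<le> ennreal (\<beta> powr - \<sigma>) * ennreal (norm (T g x) powr \<sigma>)"
        by (auto split: split_indicator simp flip: ennreal_mult ennreal_1 intro!: ennreal_leI)
    qed
    also have "\<dots> = ennreal (\<beta> powr - \<sigma>) * ?J (T g) \<sigma>" by (rule nn_integral_cmult) measurable
    also have "\<dots> \<le> ennreal (\<beta> powr - \<sigma>) * (ennreal (W powr \<sigma>) * (ennreal ((\<beta> / W) powr (\<sigma> - q)) * ?J g q))"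
      by (intro mult_left_mono order_trans[OF TJ] gJ) auto
    also have "\<dots> = ennreal (\<beta> powr - \<sigma> * W powr \<sigma> * (\<beta> / W) powr (\<sigma> - q)) * ?J g q"
      by (simp add: ennreal_mult mult.assoc)
    also have "\<beta> powr - \<sigma> * W powr \<sigma> * (\<beta> / W) powr (\<sigma> - q) = (W / \<beta>) powr q"
      using W \<beta> by (simp add: powr_divide powr_diff powr_minus_divide)
    finally show ?thesis .
  qed
qed

lemma emeasure_lebesgue_ball:
  fixes c :: "real ^ 'n"
  assumes "0 \<le> r"
  shows "emeasure lebesgue (ball c r) = ennreal (measure lebesgue (ball (0 :: real ^ 'n) 1) * r ^ CARD('n))"
  using emeasure_ball[OF assms, of c] content_ball[of 1 "0 :: real ^ 'n"] by simp

text \<open>The constant has three sources: \<open>2 powr q * (1 + G powr q)\<close> from the good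
  part at level \<open>\<alpha> / 2\<close>, the term with \<open>2 * CARD('n)\<close> from the
  doubled balls that are discarded, and \<open>C / G\<close> from Chebyshev's inequality for the bad
  parts outside them. Within C, the two summands are the \<open>L^q\<close> mass of one normalised
  bad part and the volume of its ball, per unit of cube volume.\<close>

lemma weak_type_test_function:
  fixes \<phi> K :: "real ^ 'n \<Rightarrow> complex" and q :: real and q' s :: ennreal
  defines "G \<equiv> 2 ^ (CARD('n) + 1) :: real" and "v \<equiv> measure lebesgue (ball (0 :: real ^ 'n) 1)"
  defines "C \<equiv> 2 powr q * (2 ^ CARD('n) + G powr q) + v * CARD('n) ^ CARD('n)"
  assumes T: "singular_integral_operator K D T" and bd: "bounded_on_Lp s B D T" and K: "K \<in> Hr_class q'"
    and size: "\<And>x. x \<noteq> 0 \<Longrightarrow> norm (K x) \<le> A / norm x ^ CARD('n)"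
    and H: "Hr_const q' K \<le> ennreal W" and q: "1 \<le> q" and q': "1 / ennreal q + 1 / q' = 1" and s: "ennreal q < s"
    and W: "0 < W" and B: "0 \<le> B" "B \<le> W" and \<phi>: "\<phi> \<in> test_functions" and \<alpha>: "0 < \<alpha>"
  shows "emeasure lebesgue {x. \<alpha> < norm (T \<phi> x)} \<le>
    ennreal ((2 powr q * (1 + G powr q) + (2 * G) powr q * (v * (2 * CARD('n)) ^ CARD('n) + C / G)) * (W / \<alpha>) powr q)
      * (\<integral>\<^sup>+y. ennreal (norm (\<phi> y) powr q) \<partial>lebesgue)"
proof -
  let ?n = "real CARD('n)"
  let ?I = "\<integral>\<^sup>+y. ennreal (norm (\<phi> y) powr q) \<partial>lborel"
  have G0: "0 < G" by (simp add: G_def)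
  have v0: "0 \<le> v" by (simp add: v_def)
  have C0: "0 \<le> C" using v0 by (simp add: C_def)
  \<comment> \<open>Solves \<open>G * t = (\<alpha> / 2) / W\<close>, the height that
    \<open>good_part_bound\<close> expects at level \<open>\<alpha> / 2\<close>.\<close>
  define t where "t = \<alpha> / (2 * G * W)"
  have t: "0 < t" using \<alpha> G0 W by (simp add: t_def)
  have lin: "ae_linear_operator D T" using T by (simp add: singular_integral_operator_def)
  have sub: "Lp s \<subseteq> D" using bd by (simp add: bounded_on_Lp_def)
  have Tm: "T f \<in> borel_measurable lebesgue" if "f \<in> D" for f
    using ae_linear_operatorD(1)[OF lin] that by blast
  have s1: "1 \<le> s" using q s by (metis ennreal_1 ennreal_leI order_trans less_imp_le)
  obtain r0 m0 where rm: "0 < r0" "0 < m0" "\<And>x. norm (\<phi> x) \<le> m0" "\<And>x. r0 < norm x \<Longrightarrow> \<phi> x = 0"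
    using test_function_bounds[OF \<phi>] by blast
  obtain \<Q> :: "(real ^ 'n) set set" and m l b c where fin: "finite \<Q>" and m: "0 \<le> m"
    and l: "\<And>Q. Q \<in> \<Q> \<Longrightarrow> 0 < l Q"
    and bm: "\<And>Q. Q \<in> \<Q> \<Longrightarrow> b Q \<in> borel_measurable borel"
    and bb: "\<And>Q y. Q \<in> \<Q> \<Longrightarrow> norm (b Q y) \<le> m"
    and bs: "\<And>Q y. Q \<in> \<Q> \<Longrightarrow> ?n * l Q < norm (y - c Q) \<Longrightarrow> b Q y = 0"
    and b0: "\<And>Q. Q \<in> \<Q> \<Longrightarrow> (\<integral>y. b Q y \<partial>lborel) = 0"
    and bq: "\<And>Q. Q \<in> \<Q> \<Longrightarrow> (\<integral>\<^sup>+y. ennreal ((norm (b Q y) / t) powr q) \<partial>lborel) \<le> ennreal (2 powr q * (2 ^ CARD('n) + G powr q) * l Q ^ CARD('n))"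
    and gb: "\<And>y. norm (\<phi> y - (\<Sum>Q\<in>\<Q>. b Q y)) \<le> G * t"
    and gq: "(\<integral>\<^sup>+y. ennreal (norm (\<phi> y - (\<Sum>Q\<in>\<Q>. b Q y)) powr q) \<partial>lborel) \<le> ennreal (1 + G powr q) * ?I"
    and lsum: "ennreal (t powr q * (\<Sum>Q\<in>\<Q>. l Q ^ CARD('n))) \<le> ?I"
    by (rule Calderon_Zygmund_decomposition[OF \<phi> q t meta_eq_to_obj_eq[OF G_def]]) (rule that)
  define g where "g y = \<phi> y - (\<Sum>Q\<in>\<Q>. b Q y)" for y
  define M where "M = (\<Sum>Q\<in>\<Q>. l Q ^ CARD('n))"
  have M0: "0 \<le> M" unfolding M_def using l by (intro sum_nonneg) (simp add: less_imp_le)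
  \<comment> \<open>Neither the bad parts nor g need be continuous, so T is defined on them because
    it is defined on \<open>L^s\<close>.\<close>
  have bL: "b Q \<in> Lp s" if "Q \<in> \<Q>" for Q
  proof (rule bounded_support_in_Lp[OF _ bb[OF that] _ s1])
    show "b Q \<in> borel_measurable lebesgue" using bm[OF that] by (intro measurable_completion) simp
    fix y :: "real ^ 'n" assume "norm (c Q) + ?n * l Q < norm y"
    moreover have "norm y \<le> norm (c Q) + norm (y - c Q)" by norm
    ultimately show "b Q y = 0" by (intro bs[OF that]) linarith
  qed
  then have bD: "b Q \<in> D" if "Q \<in> \<Q>" for Q using that sub by blast
  have gm: "g \<in> borel_measurable lebesgue"
  proof -
    have "g \<in> borel_measurable borel"
      unfolding g_def using bm test_function_borel[OF \<phi>] by (intro borel_measurable_diff borel_measurable_sum)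
    then show ?thesis by (intro measurable_completion) simp
  qed
  have gL: "g \<in> Lp s"
  proof (rule bounded_support_in_Lp[OF gm _ _ s1])
    show "norm (g y) \<le> G * t" for y unfolding g_def by (rule gb)
    let ?r = "r0 + (\<Sum>Q\<in>\<Q>. norm (c Q) + ?n * l Q)"
    fix y :: "real ^ 'n" assume y: "?r < norm y"
    have pos: "0 \<le> norm (c Q) + ?n * l Q" if "Q \<in> \<Q>" for Q using l[OF that] by simp
    have "b Q y = 0" if Q: "Q \<in> \<Q>" for Q
    proof (rule bs[OF Q])
      have "norm (c Q) + ?n * l Q \<le> (\<Sum>Q\<in>\<Q>. norm (c Q) + ?n * l Q)"
        using Q fin pos by (intro member_le_sum) auto
      moreover have "norm y \<le> norm (c Q) + norm (y - c Q)" by norm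
      ultimately show "?n * l Q < norm (y - c Q)" using y rm(1) by linarith
    qed
    moreover have "0 \<le> (\<Sum>Q\<in>\<Q>. norm (c Q) + ?n * l Q)" by (intro sum_nonneg pos)
    with y have "\<phi> y = 0" by (intro rm(4)) linarith
    ultimately show "g y = 0" by (simp add: g_def)
  qed
  have gD: "g \<in> D" using gL sub by blast
  have good: "emeasure lebesgue {x. \<alpha> / 2 < norm (T g x)} \<le> ennreal ((2 * W / \<alpha>) powr q * (1 + G powr q)) * ?I"
  proof -
    have "G * t = \<alpha> / 2 / W" using G0 W by (simp add: t_def)
    then have "emeasure lebesgue {x. \<alpha> / 2 < norm (T g x)} \<le> ennreal ((W / (\<alpha> / 2)) powr q) * (\<integral>\<^sup>+y. ennreal (norm (g y) powr q) \<partial>lebesgue)"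
      using gb \<alpha> by (intro good_part_bound[OF bd Tm[OF gD] gL q s B W]) (simp_all add: g_def)
    also have "\<dots> \<le> ennreal ((2 * W / \<alpha>) powr q) * (ennreal (1 + G powr q) * ?I)"
      using gq by (intro mult_mono) (simp_all add: g_def nn_integral_completion mult.commute)
    finally show ?thesis by (simp add: ennreal_mult mult.assoc)
  qed
  \<comment> \<open>The supporting balls have radius \<open>R = n * l Q\<close>; they are doubled
    because the kernel condition speaks of distances at least \<open>2 * R\<close>.\<close>
  let ?E = "\<Union>Q\<in>\<Q>. ball (c Q) (2 * (?n * l Q))"
  let ?S = "\<lambda>x. \<Sum>Q\<in>\<Q>. T (b Q) x"
  have E: "emeasure lebesgue ?E \<le> ennreal (v * (2 * ?n) ^ CARD('n) * M)"
  proof -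
    have "emeasure lebesgue ?E \<le> (\<Sum>Q\<in>\<Q>. emeasure lebesgue (ball (c Q) (2 * (?n * l Q))))"
      using fin by (intro emeasure_subadditive_finite) auto
    also have "\<dots> = (\<Sum>Q\<in>\<Q>. ennreal (v * (2 * ?n) ^ CARD('n) * l Q ^ CARD('n)))"
    proof (rule sum.cong[OF refl])
      fix Q assume "Q \<in> \<Q>"
      then have "0 \<le> 2 * (?n * l Q)" using l[of Q] by simp
      from emeasure_lebesgue_ball[OF this, of "c Q"]
      show "emeasure lebesgue (ball (c Q) (2 * (?n * l Q))) = ennreal (v * (2 * ?n) ^ CARD('n) * l Q ^ CARD('n))"
        by (simp only: v_def power_mult_distrib mult.assoc)
    qed
    also have "\<dots> = ennreal (v * (2 * ?n) ^ CARD('n) * M)"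
      using v0 l by (subst sum_ennreal) (auto simp: M_def sum_distrib_left less_imp_le)
    finally show ?thesis .
  qed
  have off: "(\<integral>\<^sup>+x\<in>- ?E. ennreal (norm (?S x)) \<partial>lebesgue) \<le> ennreal (t * W * C * M)"
  proof -
    have "(\<integral>\<^sup>+x\<in>- ?E. ennreal (norm (?S x)) \<partial>lebesgue) \<le>
      (\<integral>\<^sup>+x. (\<Sum>Q\<in>\<Q>. ennreal (norm (T (b Q) x)) * indicator {x. 2 * (?n * l Q) \<le> norm (x - c Q)} x) \<partial>lebesgue)"
    proof (rule nn_integral_mono)
      fix x
      show "ennreal (norm (?S x)) * indicator (- ?E) x \<le> (\<Sum>Q\<in>\<Q>. ennreal (norm (T (b Q) x)) * indicator {x. 2 * (?n * l Q) \<le> norm (x - c Q)} x)"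
      proof (cases "x \<in> ?E")
        case False
        have "ennreal (norm (?S x)) \<le> ennreal (\<Sum>Q\<in>\<Q>. norm (T (b Q) x))" by (intro ennreal_leI norm_sum)
        also have "\<dots> = (\<Sum>Q\<in>\<Q>. ennreal (norm (T (b Q) x)) * indicator {x. 2 * (?n * l Q) \<le> norm (x - c Q)} x)"
          using False by (subst sum_ennreal[symmetric]) (auto intro!: sum.cong simp: dist_norm norm_minus_commute not_less split: split_indicator)
        finally show ?thesis using False by simp
      qed simp
    qed
    also have "\<dots> = (\<Sum>Q\<in>\<Q>. \<integral>\<^sup>+x\<in>{x. 2 * (?n * l Q) \<le> norm (x - c Q)}. ennreal (norm (T (b Q) x)) \<partial>lebesgue)"
    proof (rule nn_integral_sum)
      fix Q assume Q: "Q \<in> \<Q>"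
      note [measurable] = Tm[OF bD[OF Q]]
      have "closed {x. 2 * (?n * l Q) \<le> norm (x - c Q)}"
        by (intro closed_Collect_le continuous_intros)
      then have [measurable]: "{x. 2 * (?n * l Q) \<le> norm (x - c Q)} \<in> sets lebesgue" by simp
      show "(\<lambda>x. ennreal (norm (T (b Q) x)) * indicator {x. 2 * (?n * l Q) \<le> norm (x - c Q)} x) \<in> borel_measurable lebesgue"
        by measurable
    qed
    also have "\<dots> \<le> (\<Sum>Q\<in>\<Q>. ennreal (t * W * C * l Q ^ CARD('n)))"
    proof (rule sum_mono)
      fix Q assume Q: "Q \<in> \<Q>"
      have R: "0 < ?n * l Q" using l[OF Q] by simp
      have "(\<integral>\<^sup>+x\<in>{x. 2 * (?n * l Q) \<le> norm (x - c Q)}. ennreal (norm (T (b Q) x)) \<partial>lebesgue) \<le>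
        ennreal (t * W) * ((\<integral>\<^sup>+ y. ennreal ((norm (b Q y) / t) powr q) \<partial>lborel) + ennreal (v * (?n * l Q) ^ CARD('n)))"
        unfolding v_def
        by (rule singular_integral_mean_zero_bound[OF T K size H q q' W R t bD[OF Q] bm[OF Q] bs[OF Q] bb[OF Q] b0[OF Q]])
      also have "\<dots> \<le> ennreal (t * W) * (ennreal (2 powr q * (2 ^ CARD('n) + G powr q) * l Q ^ CARD('n)) + ennreal (v * (?n * l Q) ^ CARD('n)))"
        by (intro mult_left_mono add_mono bq[OF Q]) auto
      also have "\<dots> = ennreal (t * W * C * l Q ^ CARD('n))"
        using t W v0 l[OF Q] by (simp add: C_def power_mult_distrib algebra_simps flip: ennreal_mult ennreal_plus)
      finally show "(\<integral>\<^sup>+x\<in>{x. 2 * (?n * l Q) \<le> norm (x - c Q)}. ennreal (norm (T (b Q) x)) \<partial>lebesgue) \<le> ennreal (t * W * C * l Q ^ CARD('n))" .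
    qed
    also have "\<dots> = ennreal (t * W * C * M)"
      using t W C0 l by (subst sum_ennreal) (auto simp: M_def sum_distrib_left less_imp_le)
    finally show ?thesis .
  qed
  have Em: "?E \<in> sets lebesgue" using fin by (intro sets.finite_UN) auto
  have Sm: "?S \<in> borel_measurable lebesgue" using Tm bD by (intro borel_measurable_sum) auto
  have bad: "emeasure lebesgue {x. \<alpha> / 2 < norm (?S x)} \<le> ennreal ((v * (2 * ?n) ^ CARD('n) + C / G) * M)"
  proof -
    have "emeasure lebesgue {x. \<alpha> / 2 < norm (?S x)} = (\<integral>\<^sup>+x. indicator {x. \<alpha> / 2 < norm (?S x)} x \<partial>lebesgue)"
      by (rule nn_integral_indicator[OF superlevel_set_lebesgue[OF Sm], symmetric])
    \<comment> \<open>On the exceptional set the indicator is bounded by 1; off it Chebyshev's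
      inequality applies at level \<open>\<alpha> / 2\<close>.\<close>
    also have "\<dots> \<le> (\<integral>\<^sup>+x. indicator ?E x + ennreal (2 / \<alpha>) * (ennreal (norm (?S x)) * indicator (- ?E) x) \<partial>lebesgue)"
    proof (rule nn_integral_mono)
      fix x
      have "1 \<le> 2 / \<alpha> * norm (?S x)" if "\<alpha> / 2 < norm (?S x)" using that \<alpha> by (simp add: field_simps)
      then show "indicator {x. \<alpha> / 2 < norm (?S x)} x \<le> indicator ?E x + ennreal (2 / \<alpha>) * (ennreal (norm (?S x)) * indicator (- ?E) x)"
        using \<alpha> by (cases "x \<in> ?E"; cases "\<alpha> / 2 < norm (?S x)") (simp_all flip: ennreal_mult ennreal_1)
    qed
    also have "\<dots> = emeasure lebesgue ?E + ennreal (2 / \<alpha>) * (\<integral>\<^sup>+x\<in>- ?E. ennreal (norm (?S x)) \<partial>lebesgue)"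
    proof -
      have "- ?E \<in> sets lebesgue" using sets.compl_sets[OF Em] by (simp add: Compl_eq_Diff_UNIV)
      then have "(\<lambda>x. ennreal (norm (?S x)) * indicator (- ?E) x) \<in> borel_measurable lebesgue"
        by (intro borel_measurable_times_ennreal borel_measurable_indicator
            measurable_compose[OF measurable_compose[OF Sm borel_measurable_norm] measurable_ennreal])
      from nn_integral_add[OF borel_measurable_indicator[OF Em] borel_measurable_times_ennreal[OF borel_measurable_const this]]
        nn_integral_cmult[OF this] Em
      show ?thesis by (simp only: nn_integral_indicator)
    qed
    also have "\<dots> \<le> ennreal (v * (2 * ?n) ^ CARD('n) * M) + ennreal (2 / \<alpha>) * ennreal (t * W * C * M)"
      by (intro add_mono E mult_left_mono off) auto
    also have "\<dots> = ennreal (v * (2 * ?n) ^ CARD('n) * M + 2 / \<alpha> * (t * W * C * M))"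
      using \<alpha> v0 M0 t W C0 by (simp flip: ennreal_mult ennreal_plus)
    \<comment> \<open>Here \<open>2 / \<alpha> * t * W = 1 / G\<close> by the choice of t, so
      neither \<open>\<alpha>\<close> nor \<open>W\<close> remains.\<close>
    also have "v * (2 * ?n) ^ CARD('n) * M + 2 / \<alpha> * (t * W * C * M) = (v * (2 * ?n) ^ CARD('n) + C / G) * M"
      using \<alpha> W G0 by (simp add: t_def field_simps)
    finally show ?thesis .
  qed
  \<comment> \<open>The dependence on \<open>W / \<alpha>\<close> returns here: the total volume M
    of the cubes is at most \<open>t powr - q\<close> times the mass.\<close>
  have MI: "ennreal M \<le> ennreal ((2 * G * W / \<alpha>) powr q) * ?I"
  proof -
    have "ennreal M = ennreal (t powr - q) * ennreal (t powr q * M)"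
      using t M0 by (simp add: powr_minus flip: ennreal_mult)
    also have "\<dots> \<le> ennreal (t powr - q) * ?I" using lsum by (intro mult_left_mono) (simp_all add: M_def)
    also have "t powr - q = (2 * G * W / \<alpha>) powr q"
      using \<alpha> W G0 by (simp add: t_def powr_minus powr_divide)
    finally show ?thesis .
  qed
  have ae: "AE x in lebesgue. T \<phi> x = T g x + ?S x"
  proof -
    have sumT: "(\<lambda>x. \<Sum>Q\<in>\<Q>. b Q x) \<in> D \<and> (AE x in lebesgue. T (\<lambda>x. \<Sum>Q\<in>\<Q>. b Q x) x = ?S x)"
      using lin fin bD by (rule linear_operator_sum)
    have *: "(\<lambda>x. g x + (\<Sum>Q\<in>\<Q>. b Q x)) = \<phi>" by (simp add: g_def)
    have "AE x in lebesgue. T \<phi> x = T g x + T (\<lambda>x. \<Sum>Q\<in>\<Q>. b Q x) x"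
      using conjunct2[OF bspec[OF bspec[OF ae_linear_operatorD(3)[OF lin] gD] conjunct1[OF sumT]]]
      unfolding * by simp
    then show ?thesis using conjunct2[OF sumT] by eventually_elim simp
  qed
  have "\<phi> \<in> D" using T \<phi> by (auto simp: singular_integral_operator_def)
  note Tm\<phi> = Tm[OF this]
  have "emeasure lebesgue {x. \<alpha> < norm (T \<phi> x)} = emeasure lebesgue {x. \<alpha> < norm (T g x + ?S x)}"
  proof (rule emeasure_eq_AE[OF _ superlevel_set_lebesgue[OF Tm\<phi>]
        superlevel_set_lebesgue[OF borel_measurable_add[OF Tm[OF gD] Sm]]])
    show "AE x in lebesgue. x \<in> {x. \<alpha> < norm (T \<phi> x)} \<longleftrightarrow> x \<in> {x. \<alpha> < norm (T g x + ?S x)}"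
      using ae by eventually_elim simp
  qed
  also have "\<dots> \<le> emeasure lebesgue ({x. \<alpha> / 2 < norm (T g x)} \<union> {x. \<alpha> / 2 < norm (?S x)})"
  proof (rule emeasure_mono)
    show "{x. \<alpha> < norm (T g x + ?S x)} \<subseteq> {x. \<alpha> / 2 < norm (T g x)} \<union> {x. \<alpha> / 2 < norm (?S x)}"
    proof
      fix x assume "x \<in> {x. \<alpha> < norm (T g x + ?S x)}"
      then have "\<alpha> < norm (T g x) + norm (?S x)" using norm_triangle_ineq[of "T g x" "?S x"] by simp
      then show "x \<in> {x. \<alpha> / 2 < norm (T g x)} \<union> {x. \<alpha> / 2 < norm (?S x)}" by (simp, linarith)
    qed
  qed (rule sets.Un[OF superlevel_set_lebesgue[OF Tm[OF gD]] superlevel_set_lebesgue[OF Sm]])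
  also have "\<dots> \<le> emeasure lebesgue {x. \<alpha> / 2 < norm (T g x)} + emeasure lebesgue {x. \<alpha> / 2 < norm (?S x)}"
    by (rule emeasure_subadditive[OF superlevel_set_lebesgue[OF Tm[OF gD]] superlevel_set_lebesgue[OF Sm]])
  also have "\<dots> \<le> ennreal ((2 * W / \<alpha>) powr q * (1 + G powr q)) * ?I
      + ennreal (v * (2 * ?n) ^ CARD('n) + C / G) * (ennreal ((2 * G * W / \<alpha>) powr q) * ?I)"
  proof (rule add_mono[OF good])
    note bad
    also have "ennreal ((v * (2 * ?n) ^ CARD('n) + C / G) * M) = ennreal (v * (2 * ?n) ^ CARD('n) + C / G) * ennreal M"
      using v0 C0 G0 M0 by (intro ennreal_mult) auto
    also have "\<dots> \<le> ennreal (v * (2 * ?n) ^ CARD('n) + C / G) * (ennreal ((2 * G * W / \<alpha>) powr q) * ?I)"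
      by (intro mult_left_mono MI) auto
    finally show "emeasure lebesgue {x. \<alpha> / 2 < norm (?S x)} \<le> \<dots>" .
  qed
  also have "\<dots> = ennreal ((2 * W / \<alpha>) powr q * (1 + G powr q) + (v * (2 * ?n) ^ CARD('n) + C / G) * (2 * G * W / \<alpha>) powr q) * ?I"
  proof -
    have "ennreal a * x + ennreal b * (ennreal c * x) = ennreal (a + b * c) * x"
      if "0 \<le> a" "0 \<le> b" "0 \<le> c" for a b c x
      using that by (simp add: ennreal_mult distrib_right mult.assoc)
    from this show ?thesis by rule (use v0 C0 G0 in auto)
  qed
  also have "(2 * W / \<alpha>) powr q * (1 + G powr q) + (v * (2 * ?n) ^ CARD('n) + C / G) * (2 * G * W / \<alpha>) powr q =
    (2 powr q * (1 + G powr q) + (2 * G) powr q * (v * (2 * ?n) ^ CARD('n) + C / G)) * (W / \<alpha>) powr q"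
  proof -
    have "(2 * W / \<alpha>) powr q = 2 powr q * (W / \<alpha>) powr q" "(2 * G * W / \<alpha>) powr q = (2 * G) powr q * (W / \<alpha>) powr q"
      using powr_mult[of 2 "W / \<alpha>" q] powr_mult[of "2 * G" "W / \<alpha>" q] W \<alpha> G0 by simp_all
    then show ?thesis by (simp add: algebra_simps)
  qed
  finally show ?thesis by (simp add: nn_integral_completion)
qed

section \<open>From test functions to all of \<open>L^q\<close>\<close>

theorem theorem1:
  fixes q :: real and s :: ennreal
  assumes "1 \<le> q" and "ennreal q < s"
  shows "\<exists>C::real. 0 < C \<and>
    (\<forall>(q' :: ennreal) (K :: real ^ 'n \<Rightarrow> complex) (A :: real) (B :: real)
      (D :: (real ^ 'n \<Rightarrow> complex) set) (T :: (real ^ 'n \<Rightarrow> complex) \<Rightarrow> (real ^ 'n \<Rightarrow> complex)).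
      1 / ennreal q + 1 / q' = 1 \<longrightarrow>
      K \<in> Hr_class q' \<longrightarrow>
      (\<forall>x. x \<noteq> 0 \<longrightarrow> norm (K x) \<le> A / norm x ^ CARD('n)) \<longrightarrow>
      singular_integral_operator K D T \<longrightarrow>
      0 \<le> B \<longrightarrow> bounded_on_Lp s B D T \<longrightarrow>
      (\<exists>S. density_extension q T S) \<and>
      (\<forall>S. density_extension q T S \<longrightarrow>
        (\<forall>f\<in>Lp (ennreal q).
          weak_Lp_norm q (S f) \<le> ennreal C * (ennreal B + Hr_const q' K) * Lp_norm (ennreal q) f)))"
proof -
  note q = assms(1) and s = assms(2)
  let ?G = "2 ^ (CARD('n) + 1) :: real" and ?v = "measure lebesgue (ball (0 :: real ^ 'n) 1)"
  \<comment> \<open>The constant of \<open>weak_type_test_function\<close> written out; only n and q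
    enter it.\<close>
  define C0 where "C0 = 2 powr q * (1 + ?G powr q) + (2 * ?G) powr q * (?v * (2 * CARD('n)) ^ CARD('n)
    + (2 powr q * (2 ^ CARD('n) + ?G powr q) + ?v * CARD('n) ^ CARD('n)) / ?G)"
  have "0 < 2 powr q * (1 + ?G powr q)" by (intro mult_pos_pos add_pos_pos) auto
  then have C0: "0 < C0" unfolding C0_def by (rule add_pos_nonneg) auto
  \<comment> \<open>The level set estimate bounds measures, which are q-th powers of the weak norm;
    hence the root.\<close>
  define C1 where "C1 = C0 powr (1 / q)"
  have C1: "0 < C1" "C1 powr q = C0" using C0 q by (simp_all add: C1_def powr_powr)
  show ?thesis
  \<comment> \<open>The factor 4 is the loss in passing from test functions to the
    extension.\<close>
  proof (rule exI[of _ "4 * C1"], intro conjI allI impI)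
    show "0 < 4 * C1" using C1 by simp
    fix q' :: ennreal and K :: "real ^ 'n \<Rightarrow> complex" and A B :: real
      and D :: "(real ^ 'n \<Rightarrow> complex) set" and T :: "(real ^ 'n \<Rightarrow> complex) \<Rightarrow> (real ^ 'n \<Rightarrow> complex)"
    assume q': "1 / ennreal q + 1 / q' = 1" and K: "K \<in> Hr_class q'"
      and size: "\<forall>x. x \<noteq> 0 \<longrightarrow> norm (K x) \<le> A / norm x ^ CARD('n)"
      and T: "singular_integral_operator K D T" and B: "0 \<le> B" and bd: "bounded_on_Lp s B D T"
    have "Hr_const q' K < \<infinity>" using K by (simp add: Hr_class_def)
    then obtain h where h: "0 \<le> h" "Hr_const q' K = ennreal h" by (cases "Hr_const q' K") auto
    have lin: "ae_linear_operator D T" and sub: "test_functions \<subseteq> D"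
      using T by (simp_all add: singular_integral_operator_def)
    have test: "weak_Lp_norm q (T \<phi>) \<le> ennreal (C1 * (B + h)) * Lp_norm (ennreal q) \<phi>" if \<phi>: "\<phi> \<in> test_functions" for \<phi>
    proof -
      have "Lp_norm (ennreal q) \<phi> < \<infinity>" using test_function_Lp[OF \<phi>, of "ennreal q"] q by (simp add: Lp_def)
      then obtain N where N: "0 \<le> N" "Lp_norm (ennreal q) \<phi> = ennreal N" by (cases "Lp_norm (ennreal q) \<phi>") auto
      then have NI: "(\<integral>\<^sup>+y. ennreal (norm (\<phi> y) powr q) \<partial>lebesgue) \<le> ennreal (N powr q)"
        using Lp_norm_le_iff[OF q, of N \<phi>] by simp
      have le_e: "weak_Lp_norm q (T \<phi>) \<le> ennreal (C1 * (B + h) * N + e)" if e: "0 < e" for e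
      proof -
        \<comment> \<open>The increment makes \<open>W = B + h + \<delta>\<close> positive even if
          \<open>B + h = 0\<close>, and costs at most e in the bound; the summand 1 covers
          \<open>N = 0\<close>.\<close>
        define \<delta> where "\<delta> = e / (C1 * (N + 1))"
        have \<delta>: "0 < \<delta>" using e C1 N by (simp add: \<delta>_def)
        have "C1 * \<delta> * N = e * (N / (N + 1))" using C1(1) by (simp add: \<delta>_def)
        also have "\<dots> \<le> e * 1" using e N by (intro mult_left_mono) auto
        finally have \<delta>': "C1 * \<delta> * N \<le> e" by simp
        define W where "W = B + h + \<delta>"
        have W: "0 < W" "B \<le> W" "Hr_const q' K \<le> ennreal W" using B h \<delta> by (auto simp: W_def intro: ennreal_leI)
        have "weak_Lp_norm q (T \<phi>) \<le> ennreal (C1 * W * N)"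
        proof (subst weak_Lp_norm_le_iff[OF q], safe)
          show "0 \<le> C1 * W * N" using C1 W N by simp
          fix \<alpha> :: real assume \<alpha>: "0 < \<alpha>"
          have "emeasure lebesgue {x. \<alpha> < norm (T \<phi> x)} \<le> ennreal (C0 * (W / \<alpha>) powr q) * (\<integral>\<^sup>+y. ennreal (norm (\<phi> y) powr q) \<partial>lebesgue)"
            unfolding C0_def using size
            by (intro weak_type_test_function[OF T bd K _ W(3) q q' s W(1) B W(2) \<phi> \<alpha>]) auto
          also have "\<dots> \<le> ennreal (C0 * (W / \<alpha>) powr q) * ennreal (N powr q)"
            by (intro mult_left_mono NI) auto
          also have "\<dots> = ennreal (C1 powr q * (W / \<alpha>) powr q * N powr q)"
            unfolding C1(2) using C0 by (simp flip: ennreal_mult)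
          also have "C1 powr q * (W / \<alpha>) powr q * N powr q = (C1 * (W / \<alpha>) * N) powr q"
            using C1(1) W(1) N(1) \<alpha> by (subst powr_mult; (subst powr_mult)?; simp)
          also have "C1 * (W / \<alpha>) * N = C1 * W * N / \<alpha>" by simp
          finally show "emeasure lebesgue {x. \<alpha> < norm (T \<phi> x)} \<le> ennreal ((C1 * W * N / \<alpha>) powr q)" .
        qed
        also have "\<dots> \<le> ennreal (C1 * (B + h) * N + e)"
          using \<delta>' by (intro ennreal_leI) (simp add: W_def algebra_simps)
        finally show ?thesis .
      qed
      have pos: "0 \<le> C1 * (B + h)" using C1(1) B h(1) by simp
      have "weak_Lp_norm q (T \<phi>) \<le> ennreal (C1 * (B + h) * N)"
      proof (rule ennreal_le_epsilon)
        fix e :: real assume e: "0 < e"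
        show "weak_Lp_norm q (T \<phi>) \<le> ennreal (C1 * (B + h) * N) + ennreal e"
          using le_e[OF e] ennreal_plus[of "C1 * (B + h) * N" e] mult_nonneg_nonneg[OF pos N(1)] e by simp
      qed
      then show ?thesis unfolding N(2) ennreal_mult[OF pos N(1)] .
    qed
    have M: "0 \<le> C1 * (B + h)" using C1 B h by simp
    show "\<exists>S. density_extension q T S"
      by (rule density_extension_exists[OF q M lin sub test])
    fix S assume S: "density_extension q T S"
    show "\<forall>f\<in>Lp (ennreal q). weak_Lp_norm q (S f) \<le> ennreal (4 * C1) * (ennreal B + Hr_const q' K) * Lp_norm (ennreal q) f"
    proof
      fix f :: "real ^ 'n \<Rightarrow> complex" assume f: "f \<in> Lp (ennreal q)"
      have "weak_Lp_norm q (S f) \<le> ennreal (4 * (C1 * (B + h))) * Lp_norm (ennreal q) f"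
        by (rule density_extension_bound[OF q M lin sub test S f])
      also have "ennreal (4 * (C1 * (B + h))) = ennreal (4 * C1) * (ennreal B + Hr_const q' K)"
        using C1 B h by (simp add: mult.assoc flip: ennreal_plus ennreal_mult)
      finally show "weak_Lp_norm q (S f) \<le> ennreal (4 * C1) * (ennreal B + Hr_const q' K) * Lp_norm (ennreal q) f" .
    qed
  qed
qed

end
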